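(* Let $N$ be a compact connected orientable smooth 2-manifold with trivial tangent bundle and finitely many (possibly zero) boundary circles labelled by $\ell$, with fixed base point $\bar x$ and fixed boundary families $\alpha_{\ell,\phi}$. Let $\{\tilde g,f,b_\ell,c_\ell\}$ and $\{\tilde g',f',b'_\ell,c'_\ell\}$ be two configurations, where $(\tilde g,f),(\tilde g',f'):\widetilde N\to\widetilde{\mathsf{ISO}}(1,2)$ are (smooth) normalized quasiperiodic functions and $b_\ell,b'_\ell\in\mathsf{SL}(2)$, $c_\ell,c'_\ell\in\mathfrak{sl}(2)$ for each boundary $\ell$. If $$\tilde g_\lambda=\tilde g'_\lambda,\qquad f_\lambda=f'_\lambda,\qquad b_\ell=b'_\ell,\qquad c_\ell=c'_\ell$$ for all $\lambda\in\Upsilon$ and all boundaries $\ell$ (i.e. the potentials coincide on the loop group and the boundary parameters are equal), then the two configurations (that is, the physical field configurations they parameterize) are related by a gauge transformation.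
   Context: Groups. $\mathsf{SL}(2)=\mathsf{SL}(2,\mathbb R)$ with Lie algebra $\mathfrak{sl}(2)$. $\widetilde{\mathsf{SL}}(2)$ is the universal covering group of $\mathsf{SL}(2)$; dropping the tilde denotes the projection $\tilde g\mapsto g\in\mathsf{SL}(2)$. $\widetilde{\mathsf{ISO}}(1,2)=\widetilde{\mathsf{SL}}(2)\times\mathfrak{sl}(2)$ with multiplication $(\tilde g,f)(\tilde g',f')=(\tilde g\tilde g',\,f+g f' g^{-1})$. Covering manifold. $\widetilde N$ is the set of homotopy classes (with fixed end points) of paths $\alpha:[0,1]\to N$ with $\alpha(0)=\bar x$, i.e. the universal cover, with projection $\pi(\alpha)=\alpha(1)$, locally carrying the same coordinates as $N$. $\alpha\bullet\beta$ denotes $\alpha$ followed by $\beta$. The loop group $\Upsilon=\pi^{-1}(\bar x)\subset\widetilde N$ is the group of classes of loops at $\bar x$ with product $\bullet$. Quasiperiodic functions. For a group $G$, a map $F:\widetilde N\to G$ is quasiperiodic if there are elements $F_\lambda\in G$ with $F(\lambda\bullet\alpha)=F_\lambda F(\alpha)$ for all $\lambda\in\Upsilon$, $\alpha\in\widetilde N$; it is normalized if moreover $F_\lambda=F(\lambda)$ for all $\lambda\in\Upsilon$. For $(\tilde g,f)$ normalized quasiperiodic, write $\tilde g_\lambda=\tilde g(\lambda)$, $f_\lambda=f(\lambda)$. Boundary family. Each boundary circle $\ell$ carries an angular coordinate $\phi$ of period $2\pi$; the boundary family is a fixed continuous map $\mathbb R\to\widetilde N$, $\phi\mapsto\alpha_{\ell,\phi}$,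 such that $\pi(\alpha_{\ell,\phi})$ is the point of the circle with coordinate $\phi$ (mod $2\pi$). Fields. A field configuration consists of two smooth $\mathfrak{sl}(2)$-valued one-forms $\omega_i,\gamma_i$ on $N$ and, for each boundary circle $\ell$, smooth functions $u:\mathbb R\to\mathsf{SL}(2)$, $v:\mathbb R\to\mathfrak{sl}(2)$ of $\phi$ such that for some constants $u_\ell\in\mathsf{SL}(2)$, $v_\ell\in\mathfrak{sl}(2)$: $u(\phi+2\pi)=u_\ell u(\phi)$, $v(\phi+2\pi)=v_\ell+u_\ell v(\phi)u_\ell^{-1}$. It is physical if $\partial_i\omega_j-\partial_j\omega_i+[\omega_i,\omega_j]=0$ and $\epsilon^{ij}(\partial_i\gamma_j+[\omega_i,\gamma_j])=0$ on $N$, and $u^{-1}\partial_\phi u=\omega_\phi$, $u^{-1}(\partial_\phi v)u=\gamma_\phi$ on each boundary circle. The configuration $\{\tilde g,f,b_\ell,c_\ell\}$ parameterizes the physical field configuration $$\omega_i(x)=g^{-1}\partial_ig(\alpha_x),\quad \gamma_i(x)=g^{-1}\partial_if\,g(\alpha_x),\quad u(\phi)=b_\ell^{-1}g(\alpha_{\ell,\phi}),\quad v(\phi)=b_\ell^{-1}\big(f(\alpha_{\ell,\phi})-c_\ell\big)b_\ell,$$ where $\alpha_x\in\widetilde N$ is any point with $\pi(\alpha_x)=x$ (every physical configuration arises from exactly one such set of data). Gauge transformations. Two physical field configurations are related by a gauge transformation if there is a smooth family of physical field configurations $(\omega_i,\gamma_i,u,v)_s$, $s\in[0,1]$, connecting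 them (at $s=0$ and $s=1$) and $\mathfrak{sl}(2)$-valued smooth functions $\Lambda_s,n_s$ on $N$ (depending smoothly on $s$) such that for all $s$ $$\tfrac{d}{ds}\omega_i=\partial_i\Lambda_s+[\omega_i,\Lambda_s],\quad \tfrac{d}{ds}\gamma_i=[\gamma_i,\Lambda_s]+\partial_in_s+[\omega_i,n_s],\quad \tfrac{d}{ds}u=u\Lambda_s,\quad \tfrac{d}{ds}v=u\,n_s\,u^{-1},$$ where in the last two equations $\Lambda_s,n_s$ are evaluated at the boundary point with coordinate $\phi$. (These right hand sides are the Poisson brackets of the fields with the smeared constraints generating Lorentz rotations with parameter $\Lambda_s$ and translations with parameter $n_s$.) *)

theory Defs
  imports "HOL-Analysis.Analysis" "HOL-Algebra.Group"
begin

section \<open>Smooth functions on subsets of Euclidean spaces\<close>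

primrec k_smooth :: "nat \<Rightarrow> 'e::euclidean_space set \<Rightarrow> ('e \<Rightarrow> 'f::real_normed_vector) \<Rightarrow> bool" where
  "k_smooth 0 S f \<longleftrightarrow> continuous_on S f"
| "k_smooth (Suc k) S f \<longleftrightarrow>
     (\<forall>x\<in>S. f differentiable (at x)) \<and>
     (\<forall>v. k_smooth k S (\<lambda>x. frechet_derivative f (at x) v))"

text \<open>Smoothness on an arbitrary set (a half plane, a product with \<open>[0,1]\<close>, \dots) is, as usual,
  local extendability to a smooth function on an open set.\<close>

definition smooth_on :: "'e::euclidean_space set \<Rightarrow> ('e \<Rightarrow> 'f::real_normed_vector) \<Rightarrow> bool" where
  "smooth_on S f \<longleftrightarrow>
     (\<forall>x\<in>S. \<exists>W h. open W \<and> x \<in> W \<and> (\<forall>k. k_smooth k W h) \<and> (\<forall>y\<in>S \<inter> W. h y = f y))"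


section \<open>Smooth surfaces with boundary\<close>

text \<open>A chart is a pair of its domain and its coordinate map, which takes values in the
  closed half plane.  Values of the coordinate map outside the domain are irrelevant.\<close>

type_synonym 'm chart = "'m set \<times> ('m \<Rightarrow> real^2)"

definition half_plane :: "(real^2) set" where
  "half_plane = {y. 0 \<le> y $ 1}"

definition chart_image :: "'m chart \<Rightarrow> (real^2) set" where
  "chart_image c = snd c ` fst c"

definition chart_inv :: "'m chart \<Rightarrow> real^2 \<Rightarrow> 'm" where
  "chart_inv c = inv_into (fst c) (snd c)"

definition is_chart :: "'m topology \<Rightarrow> 'm chart \<Rightarrow> bool" where
  "is_chart X c \<longleftrightarrow>
     openin X (fst c) \<and> openin (top_of_set half_plane) (chart_image c) \<and>
     homeomorphic_map (subtopology X (fst c)) (top_of_set (chart_image c)) (snd c)"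

text \<open>Atlases are not required to be maximal.\<close>

definition smooth_atlas :: "'m topology \<Rightarrow> 'm chart set \<Rightarrow> bool" where
  "smooth_atlas X A \<longleftrightarrow>
     (\<forall>c\<in>A. is_chart X c) \<and> (\<Union>c\<in>A. fst c) = topspace X \<and>
     (\<forall>c\<in>A. \<forall>d\<in>A. smooth_on (snd c ` (fst c \<inter> fst d)) (snd d \<circ> chart_inv c))"

definition smooth_fun :: "'m chart set \<Rightarrow> ('m \<Rightarrow> 'f::real_normed_vector) \<Rightarrow> bool" where
  "smooth_fun A F \<longleftrightarrow> (\<forall>c\<in>A. smooth_on (chart_image c) (F \<circ> chart_inv c))"

text \<open>The partial derivative \<open>\<partial>\<^sub>i F\<close> in the coordinates of the chart \<open>c\<close>.  The derivative is taken
  within the chart image, which makes it one-sided at boundary points.\<close>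

definition pderiv_chart :: "'m chart \<Rightarrow> 2 \<Rightarrow> ('m \<Rightarrow> 'f::real_normed_vector) \<Rightarrow> 'm \<Rightarrow> 'f" where
  "pderiv_chart c i F x =
     frechet_derivative (F \<circ> chart_inv c) (at (snd c x) within chart_image c) (axis i 1)"

definition jacobian :: "'m chart \<Rightarrow> 'm chart \<Rightarrow> 'm \<Rightarrow> real^2^2" where
  "jacobian c d x = (\<chi> j i. pderiv_chart c i (\<lambda>z. snd d z $ j) x)"

definition surface_boundary :: "'m chart set \<Rightarrow> 'm set" where
  "surface_boundary A = {x. \<exists>c\<in>A. x \<in> fst c \<and> snd c x $ 1 = 0}"

definition orientable :: "'m topology \<Rightarrow> 'm chart set \<Rightarrow> bool" where
  "orientable X A \<longleftrightarrow>
     (\<exists>B. smooth_atlas X B \<and> smooth_atlas X (A \<union> B) \<and>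
          (\<forall>c\<in>B. \<forall>d\<in>B. \<forall>x\<in>fst c \<inter> fst d. 0 < det (jacobian c d x)))"

text \<open>Vector fields and one-forms are given by their components in every chart of the atlas,
  subject to the contravariant, respectively covariant, transformation law.\<close>

definition smooth_vector_field :: "'m chart set \<Rightarrow> ('m chart \<Rightarrow> 'm \<Rightarrow> real^2) \<Rightarrow> bool" where
  "smooth_vector_field A e \<longleftrightarrow>
     (\<forall>c\<in>A. smooth_on (chart_image c) (e c \<circ> chart_inv c)) \<and>
     (\<forall>c\<in>A. \<forall>d\<in>A. \<forall>x\<in>fst c \<inter> fst d. e d x = jacobian c d x *v e c x)"

definition trivial_tangent_bundle :: "'m chart set \<Rightarrow> bool" where
  "trivial_tangent_bundle A \<longleftrightarrow>
     (\<exists>e :: 2 \<Rightarrow> 'm chart \<Rightarrow> 'm \<Rightarrow> real^2.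
        (\<forall>a. smooth_vector_field A (e a)) \<and>
        (\<forall>c\<in>A. \<forall>x\<in>fst c. det (\<chi> a. e a c x) \<noteq> 0))"

text \<open>Angular coordinates on the boundary circles, given as \<open>2\<pi>\<close>-periodic parametrizations
  \<open>\<sigma> \<ell>\<close>, where the labels \<open>\<ell>\<close> range over \<open>L\<close>.\<close>

definition boundary_circles ::
  "'a::topological_space chart set \<Rightarrow> 'l set \<Rightarrow> ('l \<Rightarrow> real \<Rightarrow> 'a) \<Rightarrow> bool" where
  "boundary_circles A L \<sigma> \<longleftrightarrow>
     finite L \<and> (\<Union>l\<in>L. range (\<sigma> l)) = surface_boundary A \<and>
     (\<forall>l\<in>L. \<forall>m\<in>L. l \<noteq> m \<longrightarrow> range (\<sigma> l) \<inter> range (\<sigma> m) = {}) \<and>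
     (\<forall>l\<in>L. continuous_on UNIV (\<sigma> l) \<and>
        (\<forall>t. \<sigma> l (t + 2 * pi) = \<sigma> l t) \<and> inj_on (\<sigma> l) {0..<2 * pi} \<and>
        (\<forall>c\<in>A. smooth_on {t. \<sigma> l t \<in> fst c} (snd c \<circ> \<sigma> l) \<and>
               (\<forall>t. \<sigma> l t \<in> fst c \<longrightarrow> vector_derivative (snd c \<circ> \<sigma> l) (at t) \<noteq> 0)))"


section \<open>Universal covers as spaces of homotopy classes of paths\<close>

text \<open>This is used both for the surface and for \<open>SL(2)\<close>.\<close>

type_synonym 'a path_class = "(real \<Rightarrow> 'a) set"

definition path_class :: "'a::topological_space set \<Rightarrow> (real \<Rightarrow> 'a) \<Rightarrow> 'a path_class" where
  "path_class S p = {q. homotopic_paths S p q}"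

definition ucover :: "'a::topological_space set \<Rightarrow> 'a \<Rightarrow> 'a path_class set" where
  "ucover S b = {path_class S p | p. path p \<and> path_image p \<subseteq> S \<and> pathstart p = b}"

definition endpoint :: "'a::topological_space path_class \<Rightarrow> 'a" where
  "endpoint C = pathfinish (SOME p. p \<in> C)"

definition class_join ::
  "'a::topological_space set \<Rightarrow> 'a path_class \<Rightarrow> 'a path_class \<Rightarrow> 'a path_class" where
  "class_join S C D = {r. \<exists>p\<in>C. \<exists>q\<in>D. homotopic_paths S (p +++ q) r}"

definition loop_classes :: "'a::topological_space set \<Rightarrow> 'a \<Rightarrow> 'a path_class set" where
  "loop_classes S b = {C \<in> ucover S b. endpoint C = b}"

text \<open>Basic open sets: continue a path \<open>p\<close> by the paths starting at its end point and lying in a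
  relatively open set \<open>V\<close>.\<close>

definition ucover_topology :: "'a::topological_space set \<Rightarrow> 'a \<Rightarrow> 'a path_class topology" where
  "ucover_topology S b = topology_generated_by
     {{path_class S (p +++ q) | q. path q \<and> path_image q \<subseteq> V \<and> pathstart q = pathfinish p} | p V.
        path p \<and> path_image p \<subseteq> S \<and> pathstart p = b \<and>
        openin (top_of_set S) V \<and> pathfinish p \<in> V}"

text \<open>The charts of the cover that carry the same coordinates as the chart \<open>c\<close> of the base.\<close>

definition lifted_charts ::
  "'a::topological_space set \<Rightarrow> 'a \<Rightarrow> 'a chart \<Rightarrow> 'a path_class chart set" where
  "lifted_charts S b c =
     {(W, snd c \<circ> endpoint) | W.
        openin (ucover_topology S b) W \<and> endpoint ` W \<subseteq> fst c \<and> inj_on endpoint W}"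

definition ucover_atlas ::
  "'a::topological_space set \<Rightarrow> 'a \<Rightarrow> 'a chart set \<Rightarrow> 'a path_class chart set" where
  "ucover_atlas S b A = (\<Union>c\<in>A. lifted_charts S b c)"

text \<open>Partial derivative of a function on the cover, in the coordinates of a chart \<open>c\<close> of the base;
  it does not depend on the choice of the lifted chart.\<close>

definition pderiv_ucover ::
  "'a::topological_space set \<Rightarrow> 'a \<Rightarrow> 'a chart \<Rightarrow> 2 \<Rightarrow>
   ('a path_class \<Rightarrow> 'f::real_normed_vector) \<Rightarrow> 'a path_class \<Rightarrow> 'f" where
  "pderiv_ucover S b c i F C =
     pderiv_chart (SOME d. d \<in> lifted_charts S b c \<and> C \<in> fst d) i F C"


section \<open>The groups\<close>

type_synonym mat2 = "real^2^2"

definition SL2 :: "mat2 set" where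
  "SL2 = {M. det M = 1}"

definition sl2 :: "mat2 set" where
  "sl2 = {M. trace M = 0}"

definition comm :: "mat2 \<Rightarrow> mat2 \<Rightarrow> mat2" where
  "comm X Y = X ** Y - Y ** X"

text \<open>The universal covering group: path classes in \<open>SL(2)\<close> starting at the unit matrix, with
  pointwise multiplication of paths.  The covering projection to \<open>SL(2)\<close> is \<open>endpoint\<close>.\<close>

definition SL2_cover :: "mat2 path_class monoid" where
  "SL2_cover =
     \<lparr>carrier = ucover SL2 (mat 1),
      mult = (\<lambda>C D. {r. \<exists>p\<in>C. \<exists>q\<in>D. homotopic_paths SL2 (\<lambda>t. p t ** q t) r}),
      one = path_class SL2 (\<lambda>_. mat 1)\<rparr>"

definition ISO12_cover :: "(mat2 path_class \<times> mat2) monoid" where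
  "ISO12_cover =
     \<lparr>carrier = carrier SL2_cover \<times> sl2,
      mult = (\<lambda>(g, f) (g', f').
        (g \<otimes>\<^bsub>SL2_cover\<^esub> g', f + endpoint g ** f' ** matrix_inv (endpoint g))),
      one = (\<one>\<^bsub>SL2_cover\<^esub>, 0)\<rparr>"


section \<open>Quasiperiodic functions and configurations\<close>

definition quasiperiodic_with ::
  "'a::topological_space set \<Rightarrow> 'a \<Rightarrow> ('g, 'r) monoid_scheme \<Rightarrow>
   ('a path_class \<Rightarrow> 'g) \<Rightarrow> ('a path_class \<Rightarrow> 'g) \<Rightarrow> bool" where
  "quasiperiodic_with N x0 G F F\<^sub>0 \<longleftrightarrow>
     F \<in> ucover N x0 \<rightarrow> carrier G \<and> F\<^sub>0 \<in> loop_classes N x0 \<rightarrow> carrier G \<and>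
     (\<forall>l\<in>loop_classes N x0. \<forall>C\<in>ucover N x0. F (class_join N l C) = F\<^sub>0 l \<otimes>\<^bsub>G\<^esub> F C)"

definition normalized_quasiperiodic ::
  "'a::topological_space set \<Rightarrow> 'a \<Rightarrow> ('g, 'r) monoid_scheme \<Rightarrow> ('a path_class \<Rightarrow> 'g) \<Rightarrow> bool" where
  "normalized_quasiperiodic N x0 G F \<longleftrightarrow>
     (\<exists>F\<^sub>0. quasiperiodic_with N x0 G F F\<^sub>0 \<and> (\<forall>l\<in>loop_classes N x0. F\<^sub>0 l = F l))"

text \<open>Since the smooth structure of the universal covering group is the one that makes the
  projection a local diffeomorphism, a function into it is smooth iff it is continuous and its
  projection to \<open>SL(2) \<subseteq> \<real>\<^sup>2\<^sup>\<times>\<^sup>2\<close> is smooth.\<close>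

definition smooth_ISO12 ::
  "'a::topological_space set \<Rightarrow> 'a \<Rightarrow> 'a chart set \<Rightarrow>
   ('a path_class \<Rightarrow> mat2 path_class) \<Rightarrow> ('a path_class \<Rightarrow> mat2) \<Rightarrow> bool" where
  "smooth_ISO12 N x0 A g f \<longleftrightarrow>
     continuous_map (ucover_topology N x0) (ucover_topology SL2 (mat 1)) g \<and>
     smooth_fun (ucover_atlas N x0 A) (endpoint \<circ> g) \<and>
     smooth_fun (ucover_atlas N x0 A) f"

definition configuration ::
  "'a::topological_space set \<Rightarrow> 'a \<Rightarrow> 'a chart set \<Rightarrow> 'l set \<Rightarrow>
   ('a path_class \<Rightarrow> mat2 path_class) \<Rightarrow> ('a path_class \<Rightarrow> mat2) \<Rightarrow>
   ('l \<Rightarrow> mat2) \<Rightarrow> ('l \<Rightarrow> mat2) \<Rightarrow> bool" where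
  "configuration N x0 A L g f b c \<longleftrightarrow>
     normalized_quasiperiodic N x0 ISO12_cover (\<lambda>C. (g C, f C)) \<and>
     smooth_ISO12 N x0 A g f \<and>
     (\<forall>l\<in>L. b l \<in> SL2 \<and> c l \<in> sl2)"

definition boundary_families ::
  "'a::topological_space set \<Rightarrow> 'a \<Rightarrow> 'l set \<Rightarrow> ('l \<Rightarrow> real \<Rightarrow> 'a) \<Rightarrow>
   ('l \<Rightarrow> real \<Rightarrow> 'a path_class) \<Rightarrow> bool" where
  "boundary_families N x0 L \<sigma> \<alpha> \<longleftrightarrow>
     (\<forall>l\<in>L. continuous_map euclideanreal (ucover_topology N x0) (\<alpha> l) \<and>
            (\<forall>t. endpoint (\<alpha> l t) = \<sigma> l t))"


section \<open>Fields\<close>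

text \<open>The one-forms are given by their components \<open>\<omega>\<^sub>i(x)\<close>, \<open>\<gamma>\<^sub>i(x)\<close> in each chart.\<close>

record ('a, 'l) fields =
  om :: "'a chart \<Rightarrow> 2 \<Rightarrow> 'a \<Rightarrow> mat2"
  ga :: "'a chart \<Rightarrow> 2 \<Rightarrow> 'a \<Rightarrow> mat2"
  bu :: "'l \<Rightarrow> real \<Rightarrow> mat2"
  bv :: "'l \<Rightarrow> real \<Rightarrow> mat2"

definition smooth_one_form :: "'a chart set \<Rightarrow> ('a chart \<Rightarrow> 2 \<Rightarrow> 'a \<Rightarrow> mat2) \<Rightarrow> bool" where
  "smooth_one_form A \<omega> \<longleftrightarrow>
     (\<forall>c\<in>A. \<forall>i. smooth_on (chart_image c) (\<omega> c i \<circ> chart_inv c) \<and> (\<forall>x\<in>fst c. \<omega> c i x \<in> sl2)) \<and>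
     (\<forall>c\<in>A. \<forall>d\<in>A. \<forall>x\<in>fst c \<inter> fst d. \<forall>i.
        \<omega> c i x = (\<Sum>j\<in>UNIV. (jacobian c d x $ j $ i) *\<^sub>R \<omega> d j x))"

definition field_configuration :: "'a chart set \<Rightarrow> 'l set \<Rightarrow> ('a, 'l) fields \<Rightarrow> bool" where
  "field_configuration A L \<Phi> \<longleftrightarrow>
     smooth_one_form A (om \<Phi>) \<and> smooth_one_form A (ga \<Phi>) \<and>
     (\<forall>l\<in>L. smooth_on UNIV (bu \<Phi> l) \<and> range (bu \<Phi> l) \<subseteq> SL2 \<and>
            smooth_on UNIV (bv \<Phi> l) \<and> range (bv \<Phi> l) \<subseteq> sl2 \<and>
            (\<exists>u\<^sub>0\<in>SL2. \<exists>v\<^sub>0\<in>sl2. \<forall>t.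
               bu \<Phi> l (t + 2 * pi) = u\<^sub>0 ** bu \<Phi> l t \<and>
               bv \<Phi> l (t + 2 * pi) = v\<^sub>0 + u\<^sub>0 ** bv \<Phi> l t ** matrix_inv u\<^sub>0))"

definition levi_civita :: "2 \<Rightarrow> 2 \<Rightarrow> real" where
  "levi_civita i j = (if i = j then 0 else if i = 1 then 1 else - 1)"

text \<open>The component of a one-form along \<open>\<partial>\<^sub>\<phi>\<close> at the boundary point with coordinate \<open>t\<close>.\<close>

definition tangential ::
  "'a chart \<Rightarrow> (real \<Rightarrow> 'a) \<Rightarrow> ('a chart \<Rightarrow> 2 \<Rightarrow> 'a \<Rightarrow> mat2) \<Rightarrow> real \<Rightarrow> mat2" where
  "tangential c s \<omega> t =
     (\<Sum>i\<in>UNIV. (vector_derivative (snd c \<circ> s) (at t) $ i) *\<^sub>R \<omega> c i (s t))"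

definition physical ::
  "'a chart set \<Rightarrow> 'l set \<Rightarrow> ('l \<Rightarrow> real \<Rightarrow> 'a) \<Rightarrow> ('a, 'l) fields \<Rightarrow> bool" where
  "physical A L \<sigma> \<Phi> \<longleftrightarrow>
     field_configuration A L \<Phi> \<and>
     (\<forall>c\<in>A. \<forall>x\<in>fst c.
        (\<forall>i j. pderiv_chart c i (om \<Phi> c j) x - pderiv_chart c j (om \<Phi> c i) x
               + comm (om \<Phi> c i x) (om \<Phi> c j x) = 0) \<and>
        (\<Sum>i\<in>UNIV. \<Sum>j\<in>UNIV. levi_civita i j *\<^sub>R
           (pderiv_chart c i (ga \<Phi> c j) x + comm (om \<Phi> c i x) (ga \<Phi> c j x))) = 0) \<and>
     (\<forall>l\<in>L. \<forall>t. \<forall>c\<in>A. \<sigma> l t \<in> fst c \<longrightarrow>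
        matrix_inv (bu \<Phi> l t) ** vector_derivative (bu \<Phi> l) (at t)
          = tangential c (\<sigma> l) (om \<Phi>) t \<and>
        matrix_inv (bu \<Phi> l t) ** vector_derivative (bv \<Phi> l) (at t) ** bu \<Phi> l t
          = tangential c (\<sigma> l) (ga \<Phi>) t)"

text \<open>The fields parametrized by a configuration; for a quasiperiodic configuration their values do
  not depend on the choice of the point of the cover above \<open>x\<close>.\<close>

definition point_above :: "'a::topological_space set \<Rightarrow> 'a \<Rightarrow> 'a \<Rightarrow> 'a path_class" where
  "point_above N x0 x = (SOME C. C \<in> ucover N x0 \<and> endpoint C = x)"

definition fields_of ::
  "'a::topological_space set \<Rightarrow> 'a \<Rightarrow> ('l \<Rightarrow> real \<Rightarrow> 'a path_class) \<Rightarrow>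
   ('a path_class \<Rightarrow> mat2 path_class) \<Rightarrow> ('a path_class \<Rightarrow> mat2) \<Rightarrow>
   ('l \<Rightarrow> mat2) \<Rightarrow> ('l \<Rightarrow> mat2) \<Rightarrow> ('a, 'l) fields" where
  "fields_of N x0 \<alpha> g f b c =
     \<lparr>om = (\<lambda>k i x. let C = point_above N x0 x in
         matrix_inv (endpoint (g C)) ** pderiv_ucover N x0 k i (endpoint \<circ> g) C),
      ga = (\<lambda>k i x. let C = point_above N x0 x in
         matrix_inv (endpoint (g C)) ** pderiv_ucover N x0 k i f C ** endpoint (g C)),
      bu = (\<lambda>l t. matrix_inv (b l) ** endpoint (g (\<alpha> l t))),
      bv = (\<lambda>l t. matrix_inv (b l) ** (f (\<alpha> l t) - c l) ** b l)\<rparr>"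

text \<open>Components of a one-form in a chart only matter on the domain of the chart.\<close>

definition same_fields :: "'a chart set \<Rightarrow> 'l set \<Rightarrow> ('a, 'l) fields \<Rightarrow> ('a, 'l) fields \<Rightarrow> bool" where
  "same_fields A L \<Phi> \<Psi> \<longleftrightarrow>
     (\<forall>c\<in>A. \<forall>x\<in>fst c. \<forall>i. om \<Phi> c i x = om \<Psi> c i x \<and> ga \<Phi> c i x = ga \<Psi> c i x) \<and>
     (\<forall>l\<in>L. bu \<Phi> l = bu \<Psi> l \<and> bv \<Phi> l = bv \<Psi> l)"


section \<open>Gauge transformations\<close>

definition smooth_family_fun :: "'a chart set \<Rightarrow> (real \<Rightarrow> 'a \<Rightarrow> mat2) \<Rightarrow> bool" where
  "smooth_family_fun A F \<longleftrightarrow>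
     (\<forall>c\<in>A. smooth_on ({0..1} \<times> chart_image c) (\<lambda>(s, y). F s (chart_inv c y)))"

definition smooth_family_fields ::
  "'a chart set \<Rightarrow> 'l set \<Rightarrow> (real \<Rightarrow> ('a, 'l) fields) \<Rightarrow> bool" where
  "smooth_family_fields A L \<Phi> \<longleftrightarrow>
     (\<forall>c\<in>A. \<forall>i.
        smooth_on ({0..1} \<times> chart_image c) (\<lambda>(s, y). om (\<Phi> s) c i (chart_inv c y)) \<and>
        smooth_on ({0..1} \<times> chart_image c) (\<lambda>(s, y). ga (\<Phi> s) c i (chart_inv c y))) \<and>
     (\<forall>l\<in>L.
        smooth_on ({0..1} \<times> UNIV) (\<lambda>(s, t). bu (\<Phi> s) l t) \<and>
        smooth_on ({0..1} \<times> UNIV) (\<lambda>(s, t). bv (\<Phi> s) l t))"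

definition gauge_flow ::
  "'a chart set \<Rightarrow> 'l set \<Rightarrow> ('l \<Rightarrow> real \<Rightarrow> 'a) \<Rightarrow> (real \<Rightarrow> ('a, 'l) fields) \<Rightarrow>
   (real \<Rightarrow> 'a \<Rightarrow> mat2) \<Rightarrow> (real \<Rightarrow> 'a \<Rightarrow> mat2) \<Rightarrow> bool" where
  "gauge_flow A L \<sigma> \<Phi> \<Lambda> n \<longleftrightarrow>
     (\<forall>s\<in>{0..1}.
        (\<forall>c\<in>A. \<forall>x\<in>fst c. \<forall>i.
           ((\<lambda>r. om (\<Phi> r) c i x) has_vector_derivative
              pderiv_chart c i (\<Lambda> s) x + comm (om (\<Phi> s) c i x) (\<Lambda> s x)) (at s within {0..1}) \<and>
           ((\<lambda>r. ga (\<Phi> r) c i x) has_vector_derivative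
              comm (ga (\<Phi> s) c i x) (\<Lambda> s x) + pderiv_chart c i (n s) x
                + comm (om (\<Phi> s) c i x) (n s x)) (at s within {0..1})) \<and>
        (\<forall>l\<in>L. \<forall>t.
           ((\<lambda>r. bu (\<Phi> r) l t) has_vector_derivative
              bu (\<Phi> s) l t ** \<Lambda> s (\<sigma> l t)) (at s within {0..1}) \<and>
           ((\<lambda>r. bv (\<Phi> r) l t) has_vector_derivative
              bu (\<Phi> s) l t ** n s (\<sigma> l t) ** matrix_inv (bu (\<Phi> s) l t)) (at s within {0..1})))"

definition gauge_related ::
  "'a set \<Rightarrow> 'a chart set \<Rightarrow> 'l set \<Rightarrow> ('l \<Rightarrow> real \<Rightarrow> 'a) \<Rightarrow>
   ('a, 'l) fields \<Rightarrow> ('a, 'l) fields \<Rightarrow> bool" where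
  "gauge_related N A L \<sigma> \<Phi>\<^sub>0 \<Phi>\<^sub>1 \<longleftrightarrow>
     physical A L \<sigma> \<Phi>\<^sub>0 \<and> physical A L \<sigma> \<Phi>\<^sub>1 \<and>
     (\<exists>\<Phi> \<Lambda> n.
        same_fields A L (\<Phi> 0) \<Phi>\<^sub>0 \<and> same_fields A L (\<Phi> 1) \<Phi>\<^sub>1 \<and>
        (\<forall>s\<in>{0..1}. physical A L \<sigma> (\<Phi> s)) \<and> smooth_family_fields A L \<Phi> \<and>
        (\<forall>s\<in>{0..1}. \<forall>x\<in>N. \<Lambda> s x \<in> sl2 \<and> n s x \<in> sl2) \<and>
        smooth_family_fun A \<Lambda> \<and> smooth_family_fun A n \<and>
        gauge_flow A L \<sigma> \<Phi> \<Lambda> n)"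

end

theory Submission
  imports Defs
begin

text \<open>The map \<open>h = g\<inverse> g'\<close> from the cover of the surface to the covering group is invariant under loops
  because the potentials coincide on them.  The logarithm \<open>w\<close> of the first column of \<open>h\<close> is single
  valued on the covering group and identifies it, together with one real coordinate of the second
  column, with \<open>\<complex> \<times> \<real>\<close>.  Scaling these coordinates contracts \<open>h\<close> to a family \<open>h\<^sub>r\<close> of loop
  invariant maps, so that \<open>g\<^sub>r = g h\<^sub>r\<close> and \<open>f\<^sub>r = (1 - r) f + r f'\<close> interpolate between the two
  configurations with quasiperiodicity factors that do not depend on \<open>r\<close>.  Hence the parameters
  \<open>\<Lambda> = g\<^sub>r\<inverse> \<partial>\<^sub>r g\<^sub>r\<close> and \<open>n = g\<^sub>r\<inverse> (\<partial>\<^sub>r f\<^sub>r) g\<^sub>r\<close> descend to the surface.  The flow equations are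
  the flatness of the connection \<open>(g\<^sub>r, f\<^sub>r)\<inverse> d (g\<^sub>r, f\<^sub>r)\<close> in the directions \<open>r\<close> and \<open>x\<^sub>i\<close>; in the directions
  \<open>x\<^sub>i\<close> and \<open>x\<^sub>j\<close> the same identity makes the fields physical.\<close>

section \<open>Calculus of smooth functions\<close>

text \<open>The obstacle is global: \<open>SL2\<close> has the homotopy type of a circle, so a map
  from the surface to \<open>SL2\<close> may wind and then cannot be deformed to a constant.
  Equality on loops is assumed in the covering group and not only after projection; this excludes
  winding, since the quotient then takes values in a contractible space. The coordinates come from
  reading the columns of M as complex numbers z and \<zeta>: det M = Im (cnj z * \<zeta>), so det M
  = 1 means that z is non-zero and \<zeta> = \<tau> z + i / cnj z with \<tau> real. Only log z is
  multivalued, and continuation along paths fixes its branch. The translational part needs no such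
  care: it lives in a vector space, and loops act on it by affine maps common to both
  configurations, which convex combinations respect. The interpolating potentials are built as
  matrix-valued functions only, since the fields see nothing but projections to \<open>SL2\<close>.
  Charts with boundary and the closed parameter interval force one-sided derivatives, so the
  calculus is set up for derivatives within a set.\<close>

lemma k_smooth_imp_continuous_on:
  assumes "k_smooth k S f"
  shows "continuous_on S f"
  using assms
  by (cases k) (auto intro!: differentiable_imp_continuous_on
      simp: differentiable_on_def differentiable_at_withinI)

lemma k_smooth_subset: "k_smooth k S f \<Longrightarrow> T \<subseteq> S \<Longrightarrow> k_smooth k T f"
  by (induction k arbitrary: f) (auto intro: continuous_on_subset)

text \<open>Openness of \<open>S\<close> matters: \<open>frechet_derivative\<close> at a point
  depends on the values in a full neighbourhood, and only then does agreement on \<open>S\<close>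
  pass to the derivatives.\<close>

lemma k_smooth_cong:
  assumes "open S" "\<And>x. x \<in> S \<Longrightarrow> f x = g x" "k_smooth k S f"
  shows "k_smooth k S g"
  using assms
proof (induction k arbitrary: f g)
  case 0
  then show ?case by (auto cong: continuous_on_cong)
next
  case (Suc k)
  have eq: "frechet_derivative f (at x) = frechet_derivative g (at x)" if "x \<in> S" for x
    using frechet_derivative_transform_within_open[of f x S g] Suc.prems that by auto
  have diff: "g differentiable at x" if "x \<in> S" for x
  proof -
    have "(f has_derivative frechet_derivative f (at x)) (at x)"
      using Suc.prems that by (simp add: frechet_derivative_works)
    then have "(g has_derivative frechet_derivative f (at x)) (at x)"
      by (rule has_derivative_transform_within_open[OF _ Suc.prems(1) that]) (rule Suc.prems(2))
    then show ?thesis by (auto simp: differentiable_def)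
  qed
  have "k_smooth k S (\<lambda>x. frechet_derivative g (at x) v)" for v
    by (rule Suc.IH[of "\<lambda>x. frechet_derivative f (at x) v"]) (use Suc.prems eq in auto)
  with diff show ?case by simp
qed

lemma k_smooth_SucD: "k_smooth (Suc k) S f \<Longrightarrow> k_smooth k S f"
proof (induction k arbitrary: f)
  case 0
  then show ?case using k_smooth_imp_continuous_on[of "Suc 0"] by simp
next
  case (Suc k)
  then show ?case by (metis k_smooth.simps(2))
qed

text \<open>\<open>frechet_derivative\<close> is defined by choice; this allows any explicit
  derivative formula in its place and is the induction step of most closure properties of
  \<open>k_smooth\<close>.\<close>

lemma k_smooth_SucI:
  assumes "open S" "\<And>x. x \<in> S \<Longrightarrow> (f has_derivative f' x) (at x)"
    and "\<And>v. k_smooth k S (\<lambda>x. f' x v)"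
  shows "k_smooth (Suc k) S f"
proof -
  have "f' x = frechet_derivative f (at x)" if "x \<in> S" for x
    using frechet_derivative_at[OF assms(2)[OF that]] .
  then have "k_smooth k S (\<lambda>x. frechet_derivative f (at x) v)" for v
    by (intro k_smooth_cong[OF assms(1) _ assms(3)[of v]]) auto
  with assms(2) show ?thesis by (auto simp: differentiable_def)
qed

lemma k_smooth_Suc_has_derivative:
  assumes "k_smooth (Suc k) S f" "x \<in> S"
  shows "(f has_derivative frechet_derivative f (at x)) (at x)"
  using assms by (simp add: frechet_derivative_works)

lemma k_smooth_const: "open S \<Longrightarrow> k_smooth k S (\<lambda>x. c)"
  by (induction k arbitrary: c) (auto intro: continuous_intros)

lemma k_smooth_bounded_linear_comp:
  assumes "bounded_linear L" "open S" "k_smooth k S f"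
  shows "k_smooth k S (\<lambda>x. L (f x))"
  using assms(3)
proof (induction k arbitrary: f)
  case 0
  then show ?case using bounded_linear.continuous_on[OF assms(1)] by auto
next
  case (Suc k)
  show ?case
    by (rule k_smooth_SucI[OF assms(2) bounded_linear.has_derivative[OF assms(1)
            k_smooth_Suc_has_derivative[OF Suc.prems]]])
       (use Suc in auto)
qed

lemma k_smooth_bounded_linear:
  assumes "bounded_linear L" "open S"
  shows "k_smooth k S L"
proof (cases k)
  case 0
  then show ?thesis using assms by (simp add: linear_continuous_on)
next
  case (Suc j)
  show ?thesis unfolding Suc
    by (rule k_smooth_SucI[OF assms(2) bounded_linear_imp_has_derivative[OF assms(1)]])
       (rule k_smooth_const[OF assms(2)])
qed

lemma k_smooth_add:
  assumes "open S" "k_smooth k S f" "k_smooth k S g"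
  shows "k_smooth k S (\<lambda>x. f x + g x)"
  using assms(2,3)
proof (induction k arbitrary: f g)
  case 0
  then show ?case by (auto intro: continuous_intros)
next
  case (Suc k)
  show ?case
    by (rule k_smooth_SucI[OF assms(1)
          has_derivative_add[OF k_smooth_Suc_has_derivative[OF Suc.prems(1)]
            k_smooth_Suc_has_derivative[OF Suc.prems(2)]]])
       (use Suc in auto)
qed

lemma k_smooth_sum:
  assumes "open S" "finite I" "\<And>i. i \<in> I \<Longrightarrow> k_smooth k S (f i)"
  shows "k_smooth k S (\<lambda>x. \<Sum>i\<in>I. f i x)"
  using assms(2,3)
  by (induction I rule: finite_induct)
     (auto intro!: k_smooth_add[OF assms(1)] k_smooth_const[OF assms(1)])

text \<open>The Leibniz rule lowers the order of one factor only; the other is brought down to the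
  same order by \<open>k_smooth_SucD\<close>, and the induction hypothesis applies to each
  term.\<close>

lemma k_smooth_bilinear:
  assumes "bounded_bilinear B" "open S" "k_smooth k S f" "k_smooth k S g"
  shows "k_smooth k S (\<lambda>x. B (f x) (g x))"
  using assms(3,4)
proof (induction k arbitrary: f g)
  case 0
  then show ?case using bounded_bilinear.continuous_on[OF assms(1)] by auto
next
  case (Suc k)
  show ?case
    by (rule k_smooth_SucI[OF assms(2)
          bounded_bilinear.FDERIV[OF assms(1) k_smooth_Suc_has_derivative[OF Suc.prems(1)]
            k_smooth_Suc_has_derivative[OF Suc.prems(2)]]])
       (use Suc.prems Suc.prems[THEN k_smooth_SucD] in
          \<open>auto intro!: k_smooth_add[OF assms(2)] Suc.IH\<close>)
qed

text \<open>In the chain rule the derivative of \<open>g\<close> is taken at a point and on a vector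
  that both depend on \<open>x\<close>. Expanding the vector in the basis leaves scalar coefficients
  times derivatives of \<open>g\<close> in fixed directions, which are compositions of lower
  order.\<close>

lemma k_smooth_compose:
  fixes f :: "'e::euclidean_space \<Rightarrow> 'f::euclidean_space" and g :: "'f \<Rightarrow> 'g::real_normed_vector"
  assumes "open S" "open T" "f ` S \<subseteq> T" "k_smooth k S f" "k_smooth k T g"
  shows "k_smooth k S (\<lambda>x. g (f x))"
  using assms(4,5)
proof (induction k arbitrary: g)
  case 0
  then show ?case using assms(3) by (auto intro: continuous_on_compose2)
next
  case (Suc k)
  let ?df = "\<lambda>x. frechet_derivative f (at x)" and ?dg = "\<lambda>y. frechet_derivative g (at y)"
  show ?case
  proof (rule k_smooth_SucI[OF assms(1)])
    show "((\<lambda>x. g (f x)) has_derivative (\<lambda>v. ?dg (f x) (?df x v))) (at x)" if "x \<in> S" for x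
      using that assms(3) has_derivative_compose[OF k_smooth_Suc_has_derivative[OF Suc.prems(1)]
          k_smooth_Suc_has_derivative[OF Suc.prems(2)]] by blast
    show "k_smooth k S (\<lambda>x. ?dg (f x) (?df x v))" for v
    proof (rule k_smooth_cong[OF assms(1)])
      show "(\<Sum>b\<in>Basis. (?df x v \<bullet> b) *\<^sub>R ?dg (f x) b) = ?dg (f x) (?df x v)" if "x \<in> S" for x
      proof -
        have "linear (?dg (f x))"
          using that assms(3) k_smooth_Suc_has_derivative[OF Suc.prems(2)]
            has_derivative_linear by blast
        then show ?thesis
          using linear_sum[of "?dg (f x)" "\<lambda>b. (?df x v \<bullet> b) *\<^sub>R b" Basis]
          by (simp add: linear_scale euclidean_representation)
      qed
      show "k_smooth k S (\<lambda>x. \<Sum>b\<in>Basis. (?df x v \<bullet> b) *\<^sub>R ?dg (f x) b)"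
        by (intro k_smooth_sum[OF assms(1)] k_smooth_bilinear[OF bounded_bilinear_scaleR assms(1)]
            k_smooth_bounded_linear_comp[OF bounded_linear_inner_left assms(1)] Suc.IH
            k_smooth_SucD[OF Suc.prems(1)])
           (use Suc.prems in auto)
    qed
  qed
qed

lemma k_smooth_exp: "k_smooth k UNIV (\<lambda>z::complex. exp z)"
proof (induction k)
  case 0
  then show ?case by (auto intro: continuous_intros)
next
  case (Suc k)
  show ?case
  proof (rule k_smooth_SucI)
    show "(exp has_derivative (\<lambda>v. exp z * v)) (at z)" for z :: complex
      using DERIV_exp[of z] by (simp add: has_field_derivative_def)
    show "k_smooth k UNIV (\<lambda>z::complex. exp z * v)" for v
      by (rule k_smooth_bounded_linear_comp[OF bounded_linear_mult_left _ Suc]) auto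
  qed auto
qed

lemma k_smooth_Ln: "k_smooth k (- \<real>\<^sub>\<le>\<^sub>0) Ln"
proof (induction k)
  case 0
  then show ?case by (auto intro: continuous_intros)
next
  case (Suc k)
  have o: "open (- \<real>\<^sub>\<le>\<^sub>0 :: complex set)" by auto
  show ?case
  proof (rule k_smooth_SucI[OF o])
    fix z :: complex assume z: "z \<in> - \<real>\<^sub>\<le>\<^sub>0"
    \<comment> \<open>Writing the derivative 1/z as \<open>exp (- Ln z)\<close> closes the
      induction: it composes \<open>exp\<close> with the function whose smoothness of order
      \<open>k\<close> is already known.\<close>
    then have "inverse z = exp (- Ln z)" by (subst exp_minus, subst exp_Ln) auto
    then show "(Ln has_derivative (\<lambda>v. exp (- Ln z) * v)) (at z)"
      using has_field_derivative_Ln[of z] z by (simp add: has_field_derivative_def)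
  next
    fix v :: complex
    have "k_smooth k (- \<real>\<^sub>\<le>\<^sub>0) (\<lambda>z. exp (- Ln z))"
      by (rule k_smooth_compose[OF o open_UNIV _
            k_smooth_bounded_linear_comp[OF bounded_linear_minus[OF bounded_linear_ident] o Suc]
            k_smooth_exp]) auto
    then show "k_smooth k (- \<real>\<^sub>\<le>\<^sub>0) (\<lambda>z. exp (- Ln z) * v)"
      by (rule k_smooth_bounded_linear_comp[OF bounded_linear_mult_left o])
  qed
qed

section \<open>Symmetry of second derivatives\<close>

lemma frechet_derivative_mean_value:
  fixes f :: "'e::euclidean_space \<Rightarrow> real"
  assumes "0 < t" "\<And>s. s \<in> {0..t} \<Longrightarrow> f differentiable (at (x + s *\<^sub>R v))"
  obtains s where "0 < s" "s < t"
    "f (x + t *\<^sub>R v) - f x = t * frechet_derivative f (at (x + s *\<^sub>R v)) v"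
proof -
  have der: "((\<lambda>s. f (x + s *\<^sub>R v)) has_real_derivative
      frechet_derivative f (at (x + s *\<^sub>R v)) v) (at s within T)" if "s \<in> {0..t}" for s T
  proof -
    have "((\<lambda>s. f (x + s *\<^sub>R v)) has_derivative
        (\<lambda>h. frechet_derivative f (at (x + s *\<^sub>R v)) (h *\<^sub>R v))) (at s within T)"
      by (rule has_derivative_compose[of "\<lambda>s. x + s *\<^sub>R v" "\<lambda>h. h *\<^sub>R v"])
         (use assms(2)[OF that] in \<open>auto intro!: derivative_eq_intros simp: frechet_derivative_works\<close>)
    moreover have "linear (frechet_derivative f (at (x + s *\<^sub>R v)))"
      using assms(2)[OF that] linear_frechet_derivative by blast
    ultimately show ?thesis
      by (simp add: has_field_derivative_def linear_scale mult_commute_abs)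
  qed
  have "\<exists>s>0. s < t \<and> f (x + t *\<^sub>R v) - f (x + 0 *\<^sub>R v)
      = (t - 0) * frechet_derivative f (at (x + s *\<^sub>R v)) v"
    by (rule MVT2[OF assms(1), of "\<lambda>s. f (x + s *\<^sub>R v)"]) (use der in auto)
  with that show thesis by auto
qed

text \<open>Two applications of the mean value theorem: along \<open>v\<close> to the increment of
  \<open>f\<close> by \<open>t *\<^sub>R w\<close>, then along \<open>w\<close> to the first
  derivative in direction \<open>v\<close>.\<close>

lemma k_smooth_second_difference:
  fixes f :: "'e::euclidean_space \<Rightarrow> real"
  assumes f: "k_smooth 2 S f" and t: "0 < t"
    and S: "\<And>r s. r \<in> {0..t} \<Longrightarrow> s \<in> {0..t} \<Longrightarrow> x + r *\<^sub>R v + s *\<^sub>R w \<in> S"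
  obtains r s where "r \<in> {0..t}" "s \<in> {0..t}"
    "f (x + t *\<^sub>R v + t *\<^sub>R w) - f (x + t *\<^sub>R v) - f (x + t *\<^sub>R w) + f x
      = t\<^sup>2 * frechet_derivative (\<lambda>y. frechet_derivative f (at y) v)
          (at (x + r *\<^sub>R v + s *\<^sub>R w)) w"
proof -
  let ?g = "\<lambda>y. f (y + t *\<^sub>R w) - f y"
  have d1: "f differentiable at y" if "y \<in> S" for y
    using f that by (auto simp: numeral_2_eq_2)
  have d2: "(\<lambda>y. frechet_derivative f (at y) v) differentiable at y" if "y \<in> S" for y
    using f that by (auto simp: numeral_2_eq_2)
  have der: "(?g has_derivative (\<lambda>h. frechet_derivative f (at (y + t *\<^sub>R w)) h
      - frechet_derivative f (at y) h)) (at y)" if "y \<in> S" "y + t *\<^sub>R w \<in> S" for y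
  proof (rule has_derivative_diff)
    show "((\<lambda>y. f (y + t *\<^sub>R w)) has_derivative frechet_derivative f (at (y + t *\<^sub>R w))) (at y)"
      by (rule has_derivative_compose[of "\<lambda>y. y + t *\<^sub>R w" "\<lambda>h. h"])
         (use d1[OF that(2)] in \<open>auto intro!: derivative_eq_intros simp: frechet_derivative_works\<close>)
    show "(f has_derivative frechet_derivative f (at y)) (at y)"
      using d1[OF that(1)] by (simp add: frechet_derivative_works)
  qed
  obtain r where r: "0 < r" "r < t"
    "?g (x + t *\<^sub>R v) - ?g x = t * frechet_derivative ?g (at (x + r *\<^sub>R v)) v"
  proof (rule frechet_derivative_mean_value[OF t])
    show "?g differentiable at (x + s *\<^sub>R v)" if "s \<in> {0..t}" for s
      using der[of "x + s *\<^sub>R v"] S[OF that, of 0] S[OF that, of t] t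
      unfolding differentiable_def by auto
  qed auto
  have r': "r \<in> {0..t}" using r by auto
  have "frechet_derivative ?g (at (x + r *\<^sub>R v)) v
      = frechet_derivative f (at (x + r *\<^sub>R v + t *\<^sub>R w)) v - frechet_derivative f (at (x + r *\<^sub>R v)) v"
    using frechet_derivative_at[OF der[of "x + r *\<^sub>R v"], symmetric] S[OF r', of 0] S[OF r', of t] t
    by auto
  moreover obtain s where s: "0 < s" "s < t"
    "frechet_derivative f (at (x + r *\<^sub>R v + t *\<^sub>R w)) v - frechet_derivative f (at (x + r *\<^sub>R v)) v
      = t * frechet_derivative (\<lambda>y. frechet_derivative f (at y) v) (at (x + r *\<^sub>R v + s *\<^sub>R w)) w"
    by (rule frechet_derivative_mean_value[OF t,
          of "\<lambda>y. frechet_derivative f (at y) v" "x + r *\<^sub>R v" w]) (use d2 S[OF r'] in auto)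
  ultimately show thesis
    using that[of r s] r s by (auto simp: power2_eq_square algebra_simps)
qed

text \<open>Schwarz's theorem: exchanging \<open>v\<close> and \<open>w\<close> does not change the
  second difference, so the two mixed derivatives agree when each is taken at its own mean value
  point. These points are arbitrarily close to \<open>x\<close>, and continuity does the
  rest.\<close>

lemma second_derivative_symmetric_real:
  fixes f :: "'e::euclidean_space \<Rightarrow> real"
  assumes S: "open S" "x \<in> S" and f: "k_smooth 2 S f"
  shows "frechet_derivative (\<lambda>y. frechet_derivative f (at y) v) (at x) w
       = frechet_derivative (\<lambda>y. frechet_derivative f (at y) w) (at x) v"
proof -
  define P where "P = (\<lambda>v w y. frechet_derivative (\<lambda>y. frechet_derivative f (at y) v) (at y) w)"
  have cont: "continuous (at x) (P v w)" for v w
    using f S unfolding P_def by (auto simp: numeral_2_eq_2 continuous_on_eq_continuous_at)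
  \<comment> \<open>The form \<open>0 + e\<close> is the one that \<open>field_le_epsilon\<close>
    expects.\<close>
  have "\<bar>P v w x - P w v x\<bar> \<le> 0 + e" if e: "0 < e" for e
  proof -
    have e2: "0 < e / 2" using e by simp
    obtain d1 where d1: "0 < d1" "\<And>y. dist y x < d1 \<Longrightarrow> dist (P v w y) (P v w x) < e/2"
      using cont[of v w, unfolded continuous_at_eps_delta, rule_format, OF e2] by blast
    obtain d2 where d2: "0 < d2" "\<And>y. dist y x < d2 \<Longrightarrow> dist (P w v y) (P w v x) < e/2"
      using cont[of w v, unfolded continuous_at_eps_delta, rule_format, OF e2] by blast
    obtain d3 where d3: "0 < d3" "ball x d3 \<subseteq> S" using S open_contains_ball by blast
    define d where "d = min d1 (min d2 d3)"
    \<comment> \<open>Small enough for the whole parallelogram to lie within \<open>d\<close> of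
      \<open>x\<close>; the summand 1 keeps the denominator positive when \<open>v\<close> and
      \<open>w\<close> vanish.\<close>
    define t where "t = d / (2 * (norm v + norm w + 1))"
    have pos: "0 < norm v + norm w + 1"
      by (smt (verit) norm_ge_zero)
    have dpos: "0 < d" using d1 d2 d3 by (simp add: d_def)
    have t: "0 < t" using dpos pos by (simp add: t_def)
    have near: "dist (x + r *\<^sub>R v' + s *\<^sub>R w') x < d"
      if "r \<in> {0..t}" "s \<in> {0..t}" "{v', w'} = {v, w}" for r s v' w'
    proof -
      have "dist (x + r *\<^sub>R v' + s *\<^sub>R w') x = norm (r *\<^sub>R v' + s *\<^sub>R w')"
        by (simp add: dist_norm algebra_simps)
      also have "\<dots> \<le> r * norm v' + s * norm w'"
        using that norm_triangle_ineq[of "r *\<^sub>R v'" "s *\<^sub>R w'"] by auto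
      also have "\<dots> \<le> t * norm v' + t * norm w'"
        using that by (intro add_mono mult_right_mono) auto
      also have "\<dots> = t * (norm v + norm w)"
        using that(3) by (auto simp: doubleton_eq_iff algebra_simps)
      also have "\<dots> \<le> t * (norm v + norm w + 1)" using t by simp
      also have "\<dots> = d / 2" using less_imp_neq[OF pos] by (simp add: t_def divide_simps)
      finally show ?thesis using dpos by simp
    qed
    have inS: "x + r *\<^sub>R v' + s *\<^sub>R w' \<in> S"
      if "r \<in> {0..t}" "s \<in> {0..t}" "{v', w'} = {v, w}" for r s v' w'
      using near[OF that] d3(2) by (auto simp: d_def dist_commute subset_iff)
    obtain r s where 1: "r \<in> {0..t}" "s \<in> {0..t}"
      "f (x + t *\<^sub>R v + t *\<^sub>R w) - f (x + t *\<^sub>R v) - f (x + t *\<^sub>R w) + f x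
        = t\<^sup>2 * P v w (x + r *\<^sub>R v + s *\<^sub>R w)"
      unfolding P_def by (rule k_smooth_second_difference[OF f t, of x v w]) (use inS in auto)
    obtain r' s' where 2: "r' \<in> {0..t}" "s' \<in> {0..t}"
      "f (x + t *\<^sub>R w + t *\<^sub>R v) - f (x + t *\<^sub>R w) - f (x + t *\<^sub>R v) + f x
        = t\<^sup>2 * P w v (x + r' *\<^sub>R w + s' *\<^sub>R v)"
      unfolding P_def
      by (rule k_smooth_second_difference[OF f t, of x w v]) (use inS in \<open>auto simp: insert_commute\<close>)
    have "t\<^sup>2 * P v w (x + r *\<^sub>R v + s *\<^sub>R w) = t\<^sup>2 * P w v (x + r' *\<^sub>R w + s' *\<^sub>R v)"
      unfolding 1(3)[symmetric] 2(3)[symmetric] by (simp add: algebra_simps)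
    then have eq: "P v w (x + r *\<^sub>R v + s *\<^sub>R w) = P w v (x + r' *\<^sub>R w + s' *\<^sub>R v)"
      using t by simp
    have "dist (P v w (x + r *\<^sub>R v + s *\<^sub>R w)) (P v w x) < e/2"
      using near[OF 1(1,2), of v w] by (intro d1) (auto simp: d_def)
    moreover have "dist (P w v (x + r' *\<^sub>R w + s' *\<^sub>R v)) (P w v x) < e/2"
      using near[OF 2(1,2), of w v] by (intro d2) (auto simp: d_def insert_commute)
    ultimately show ?thesis unfolding eq dist_real_def by linarith
  qed
  then have "\<bar>P v w x - P w v x\<bar> \<le> 0" by (rule field_le_epsilon)
  then show ?thesis by (simp add: P_def)
qed

lemma second_derivative_symmetric:
  fixes f :: "'e::euclidean_space \<Rightarrow> 'f::euclidean_space"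
  assumes S: "open S" "x \<in> S" and f: "k_smooth 2 S f"
  shows "frechet_derivative (\<lambda>y. frechet_derivative f (at y) v) (at x) w
       = frechet_derivative (\<lambda>y. frechet_derivative f (at y) w) (at x) v"
proof (rule euclidean_eqI)
  fix b :: 'f assume "b \<in> Basis"
  have comp: "frechet_derivative (\<lambda>y. h y \<bullet> b) (at y) v = frechet_derivative h (at y) v \<bullet> b"
    if "h differentiable at y" for h :: "'e \<Rightarrow> 'f" and y v
  proof -
    have "((\<lambda>y. h y \<bullet> b) has_derivative (\<lambda>v. frechet_derivative h (at y) v \<bullet> b)) (at y)"
      using that by (intro has_derivative_inner_left) (simp add: frechet_derivative_works)
    then show ?thesis by (metis frechet_derivative_at)
  qed
  have d: "f differentiable at y" "(\<lambda>y. frechet_derivative f (at y) v) differentiable at y"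
    if "y \<in> S" for y v
    using f that by (auto simp: numeral_2_eq_2)
  have *: "frechet_derivative (\<lambda>y. frechet_derivative f (at y) v) (at x) w \<bullet> b
      = frechet_derivative (\<lambda>y. frechet_derivative (\<lambda>y. f y \<bullet> b) (at y) v) (at x) w" for v w
  proof -
    have "((\<lambda>y. frechet_derivative f (at y) v \<bullet> b) has_derivative
        (\<lambda>w. frechet_derivative (\<lambda>y. frechet_derivative f (at y) v) (at x) w \<bullet> b)) (at x)"
      using d(2)[OF S(2)] by (intro has_derivative_inner_left) (simp add: frechet_derivative_works)
    then have "((\<lambda>y. frechet_derivative (\<lambda>y. f y \<bullet> b) (at y) v) has_derivative
        (\<lambda>w. frechet_derivative (\<lambda>y. frechet_derivative f (at y) v) (at x) w \<bullet> b)) (at x)"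
      by (rule has_derivative_transform_within_open[OF _ S]) (use comp d in auto)
    then show ?thesis by (metis frechet_derivative_at)
  qed
  have "k_smooth 2 S (\<lambda>y. f y \<bullet> b)"
    by (rule k_smooth_bounded_linear_comp[OF bounded_linear_inner_left S(1) f])
  then show "frechet_derivative (\<lambda>y. frechet_derivative f (at y) v) (at x) w \<bullet> b
      = frechet_derivative (\<lambda>y. frechet_derivative f (at y) w) (at x) v \<bullet> b"
    unfolding * by (rule second_derivative_symmetric_real[OF S])
qed

section \<open>Smoothness on arbitrary sets by local extension\<close>

lemma smooth_on_extend:
  assumes "smooth_on S f" "x \<in> S"
  obtains W h where "open W" "x \<in> W" "\<And>k. k_smooth k W h" "\<And>y. y \<in> S \<Longrightarrow> y \<in> W \<Longrightarrow> h y = f y"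
proof -
  obtain W h where *: "open W \<and> x \<in> W \<and> (\<forall>k. k_smooth k W h) \<and> (\<forall>y\<in>S \<inter> W. h y = f y)"
    using bspec[OF assms(1)[unfolded smooth_on_def] assms(2)] by (elim exE)
  show thesis by (rule that[of W h]) (use * in auto)
qed

lemma smooth_on_localI:
  assumes "\<And>x. x \<in> S \<Longrightarrow> \<exists>W h. open W \<and> x \<in> W \<and> (\<forall>k. k_smooth k W h) \<and> (\<forall>y\<in>S \<inter> W. h y = f y)"
  shows "smooth_on S f"
  unfolding smooth_on_def using assms by (rule ballI)

lemma smooth_on_subset: "smooth_on S f \<Longrightarrow> T \<subseteq> S \<Longrightarrow> smooth_on T f"
  unfolding smooth_on_def by (meson Int_mono order_refl subsetD)

lemma smooth_on_cong:
  assumes "smooth_on S f" "\<And>x. x \<in> S \<Longrightarrow> f x = g x"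
  shows "smooth_on S g"
proof (rule smooth_on_localI)
  fix x assume "x \<in> S"
  with assms(1) obtain W h where "open W" "x \<in> W" "\<And>k. k_smooth k W h"
      "\<And>y. y \<in> S \<Longrightarrow> y \<in> W \<Longrightarrow> h y = f y"
    using smooth_on_extend by metis
  with assms(2) show "\<exists>W h. open W \<and> x \<in> W \<and> (\<forall>k. k_smooth k W h) \<and> (\<forall>y\<in>S \<inter> W. h y = g y)"
    by (intro exI[of _ W] exI[of _ h]) auto
qed

lemma smooth_on_locally:
  assumes "\<And>x. x \<in> S \<Longrightarrow> \<exists>W. open W \<and> x \<in> W \<and> smooth_on (S \<inter> W) f"
  shows "smooth_on S f"
proof (rule smooth_on_localI)
  fix x assume x: "x \<in> S"
  then obtain W where W: "open W" "x \<in> W" "smooth_on (S \<inter> W) f" using assms by blast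
  then obtain V h where V: "open V" "x \<in> V" "\<And>k. k_smooth k V h"
      "\<And>y. y \<in> S \<inter> W \<Longrightarrow> y \<in> V \<Longrightarrow> h y = f y"
    using x smooth_on_extend[OF W(3), of x] by (metis IntI)
  have "k_smooth k (V \<inter> W) h" for k
    using V(3)[of k] by (rule k_smooth_subset) auto
  with V W show "\<exists>W h. open W \<and> x \<in> W \<and> (\<forall>k. k_smooth k W h) \<and> (\<forall>y\<in>S \<inter> W. h y = f y)"
    by (intro exI[of _ "V \<inter> W"] exI[of _ h]) auto
qed

lemma smooth_on_if_k_smooth: "open S \<Longrightarrow> (\<And>k. k_smooth k S f) \<Longrightarrow> smooth_on S f"
  by (rule smooth_on_localI) auto

lemma smooth_on_const: "smooth_on S (\<lambda>x. c)"
  by (rule smooth_on_subset[OF smooth_on_if_k_smooth[OF open_UNIV]]) (auto intro: k_smooth_const)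

lemma smooth_on_bounded_linear: "bounded_linear L \<Longrightarrow> smooth_on S L"
  by (rule smooth_on_subset[OF smooth_on_if_k_smooth[OF open_UNIV]])
     (auto intro: k_smooth_bounded_linear)

lemma smooth_on_bilinear:
  assumes "bounded_bilinear B" "smooth_on S f" "smooth_on S g"
  shows "smooth_on S (\<lambda>x. B (f x) (g x))"
proof (rule smooth_on_localI)
  fix x assume x: "x \<in> S"
  obtain V f' where V: "open V" "x \<in> V" "\<And>k. k_smooth k V f'"
      "\<And>y. y \<in> S \<Longrightarrow> y \<in> V \<Longrightarrow> f' y = f y"
    using smooth_on_extend[OF assms(2) x] by metis
  obtain W g' where W: "open W" "x \<in> W" "\<And>k. k_smooth k W g'"
      "\<And>y. y \<in> S \<Longrightarrow> y \<in> W \<Longrightarrow> g' y = g y"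
    using smooth_on_extend[OF assms(3) x] by metis
  have "k_smooth k (V \<inter> W) (\<lambda>x. B (f' x) (g' x))" for k
    using V(1) W(1) k_smooth_subset[OF V(3), of "V \<inter> W"] k_smooth_subset[OF W(3), of "V \<inter> W"]
    by (intro k_smooth_bilinear[OF assms(1)]) auto
  with V W show "\<exists>W h. open W \<and> x \<in> W \<and> (\<forall>k. k_smooth k W h) \<and> (\<forall>y\<in>S \<inter> W. h y = B (f y) (g y))"
    by (intro exI[of _ "V \<inter> W"] exI[of _ "\<lambda>x. B (f' x) (g' x)"]) auto
qed

lemma smooth_on_add:
  assumes "smooth_on S f" "smooth_on S g"
  shows "smooth_on S (\<lambda>x. f x + g x)"
proof (rule smooth_on_localI)
  fix x assume x: "x \<in> S"
  obtain V f' where V: "open V" "x \<in> V" "\<And>k. k_smooth k V f'"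
      "\<And>y. y \<in> S \<Longrightarrow> y \<in> V \<Longrightarrow> f' y = f y"
    using smooth_on_extend[OF assms(1) x] by metis
  obtain W g' where W: "open W" "x \<in> W" "\<And>k. k_smooth k W g'"
      "\<And>y. y \<in> S \<Longrightarrow> y \<in> W \<Longrightarrow> g' y = g y"
    using smooth_on_extend[OF assms(2) x] by metis
  have "k_smooth k (V \<inter> W) (\<lambda>x. f' x + g' x)" for k
    using V(1) W(1) k_smooth_subset[OF V(3), of "V \<inter> W"] k_smooth_subset[OF W(3), of "V \<inter> W"]
    by (intro k_smooth_add) auto
  with V W show "\<exists>W h. open W \<and> x \<in> W \<and> (\<forall>k. k_smooth k W h) \<and> (\<forall>y\<in>S \<inter> W. h y = f y + g y)"
    by (intro exI[of _ "V \<inter> W"] exI[of _ "\<lambda>x. f' x + g' x"]) auto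
qed

text \<open>The extension of \<open>f\<close> need not map into the domain of the extension of
  \<open>g\<close>, so its domain is cut down to a preimage, which is open by continuity.\<close>

lemma smooth_on_compose:
  fixes f :: "'e::euclidean_space \<Rightarrow> 'f::euclidean_space"
  assumes f: "smooth_on S f" and g: "smooth_on T g" and fST: "\<And>x. x \<in> S \<Longrightarrow> f x \<in> T"
  shows "smooth_on S (\<lambda>x. g (f x))"
proof (rule smooth_on_localI)
  fix x assume x: "x \<in> S"
  obtain V f' where V: "open V" "x \<in> V" "\<And>k. k_smooth k V f'"
      "\<And>y. y \<in> S \<Longrightarrow> y \<in> V \<Longrightarrow> f' y = f y"
    using smooth_on_extend[OF f x] by metis
  obtain W g' where W: "open W" "f x \<in> W" "\<And>k. k_smooth k W g'"
      "\<And>y. y \<in> T \<Longrightarrow> y \<in> W \<Longrightarrow> g' y = g y"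
    using smooth_on_extend[OF g fST[OF x]] by metis
  let ?V = "V \<inter> f' -` W"
  have o: "open ?V"
    using continuous_open_preimage[OF k_smooth_imp_continuous_on[OF V(3)[of 0]] V(1) W(1)]
    by (simp add: vimage_def Int_def)
  have "k_smooth k ?V (\<lambda>x. g' (f' x))" for k
    by (rule k_smooth_compose[OF o W(1) _ k_smooth_subset[OF V(3)] W(3)]) auto
  with V W o x fST show
    "\<exists>W h. open W \<and> x \<in> W \<and> (\<forall>k. k_smooth k W h) \<and> (\<forall>y\<in>S \<inter> W. h y = g (f y))"
    by (intro exI[of _ ?V] exI[of _ "\<lambda>x. g' (f' x)"]) auto
qed

lemma smooth_on_linear_comp:
  fixes f :: "'e::euclidean_space \<Rightarrow> 'f::euclidean_space"
  assumes "bounded_linear L" "smooth_on S f"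
  shows "smooth_on S (\<lambda>x. L (f x))"
  by (rule smooth_on_compose[OF assms(2) smooth_on_bounded_linear[OF assms(1), of UNIV]]) simp

lemma smooth_on_diff:
  fixes f :: "'e::euclidean_space \<Rightarrow> 'f::euclidean_space"
  assumes "smooth_on S f" "smooth_on S g"
  shows "smooth_on S (\<lambda>x. f x - g x)"
  using smooth_on_add[OF assms(1)
      smooth_on_linear_comp[OF bounded_linear_minus[OF bounded_linear_ident] assms(2)]]
  by simp

lemma smooth_on_exp:
  fixes f :: "'e::euclidean_space \<Rightarrow> complex"
  assumes "smooth_on S f"
  shows "smooth_on S (\<lambda>x. exp (f x))"
  by (rule smooth_on_compose[OF assms smooth_on_if_k_smooth[OF open_UNIV k_smooth_exp]]) simp

lemma smooth_on_Ln:
  fixes f :: "'e::euclidean_space \<Rightarrow> complex"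
  assumes "smooth_on S f" "\<And>x. x \<in> S \<Longrightarrow> f x \<notin> \<real>\<^sub>\<le>\<^sub>0"
  shows "smooth_on S (\<lambda>x. Ln (f x))"
  by (rule smooth_on_compose[OF assms(1) smooth_on_if_k_smooth[OF _ k_smooth_Ln]])
     (use assms(2) in auto)

lemma smooth_on_Pair:
  fixes f :: "'e::euclidean_space \<Rightarrow> 'f::euclidean_space" and g :: "'e \<Rightarrow> 'g::euclidean_space"
  assumes "smooth_on S f" "smooth_on S g"
  shows "smooth_on S (\<lambda>x. (f x, g x))"
proof -
  have 1: "bounded_linear (\<lambda>x::'f. (x, 0::'g))" and 2: "bounded_linear (\<lambda>x::'g. (0::'f, x))"
    by (auto intro: bounded_linear_Pair bounded_linear_ident bounded_linear_zero)
  have "smooth_on S (\<lambda>x. (f x, 0) + (0, g x))"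
    by (rule smooth_on_add[OF smooth_on_linear_comp[OF 1 assms(1)] smooth_on_linear_comp[OF 2 assms(2)]])
  then show ?thesis by simp
qed

lemma smooth_on_fst: "smooth_on S (\<lambda>x. fst x)" and smooth_on_snd: "smooth_on S (\<lambda>x. snd x)"
  by (auto intro: smooth_on_bounded_linear bounded_linear_fst bounded_linear_snd)

lemma smooth_on_ident: "smooth_on S (\<lambda>x. x)"
  by (rule smooth_on_bounded_linear[OF bounded_linear_ident])

text \<open>On such sets the derivative within the set is unique at every point.\<close>

definition fat :: "'e::euclidean_space set \<Rightarrow> bool" where
  "fat S \<longleftrightarrow> (\<forall>x\<in>S. \<forall>i\<in>Basis. \<forall>e>0. \<exists>d. 0 < \<bar>d\<bar> \<and> \<bar>d\<bar> < e \<and> x + d *\<^sub>R i \<in> S)"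

lemma fat_Int_open:
  fixes S :: "'e::euclidean_space set"
  assumes "fat S" "open W"
  shows "fat (S \<inter> W)"
  unfolding fat_def
proof (intro ballI allI impI)
  fix x i :: 'e and e :: real assume x: "x \<in> S \<inter> W" and i: "i \<in> Basis" and e: "0 < e"
  obtain r where r: "0 < r" "ball x r \<subseteq> W" using assms(2) x open_contains_ball by blast
  obtain d where d: "0 < \<bar>d\<bar>" "\<bar>d\<bar> < min e r" "x + d *\<^sub>R i \<in> S"
    using assms(1)[unfolded fat_def, rule_format, of x i "min e r"] x i e r(1) by auto
  then have "x + d *\<^sub>R i \<in> ball x r" using i by (simp add: dist_norm)
  with d r show "\<exists>d. 0 < \<bar>d\<bar> \<and> \<bar>d\<bar> < e \<and> x + d *\<^sub>R i \<in> S \<inter> W" by auto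
qed

lemma fat_Times:
  assumes "fat S" "fat T"
  shows "fat (S \<times> T)"
  unfolding fat_def
proof (intro ballI allI impI)
  fix p i and e :: real
  assume p: "p \<in> S \<times> T" and i: "i \<in> (Basis :: ('a \<times> 'b) set)" and e: "0 < e"
  from i consider j where "j \<in> Basis" "i = (j, 0)" | j where "j \<in> Basis" "i = (0, j)"
    by (auto simp: Basis_prod_def)
  then show "\<exists>d. 0 < \<bar>d\<bar> \<and> \<bar>d\<bar> < e \<and> p + d *\<^sub>R i \<in> S \<times> T"
  proof cases
    case 1
    then obtain d where "0 < \<bar>d\<bar>" "\<bar>d\<bar> < e" "fst p + d *\<^sub>R j \<in> S"
      using assms(1)[unfolded fat_def, rule_format, of "fst p" j e] p e by auto
    with 1 p show ?thesis by (intro exI[of _ d]) (auto simp: mem_Times_iff)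
  next
    case 2
    then obtain d where "0 < \<bar>d\<bar>" "\<bar>d\<bar> < e" "snd p + d *\<^sub>R j \<in> T"
      using assms(2)[unfolded fat_def, rule_format, of "snd p" j e] p e by auto
    with 2 p show ?thesis by (intro exI[of _ d]) (auto simp: mem_Times_iff)
  qed
qed

lemma fat_unit_interval: "fat {0..1::real}"
  unfolding fat_def
proof (intro ballI allI impI)
  fix x i e :: real assume x: "x \<in> {0..1}" and i: "i \<in> Basis" and e: "0 < e"
  show "\<exists>d. 0 < \<bar>d\<bar> \<and> \<bar>d\<bar> < e \<and> x + d *\<^sub>R i \<in> {0..1}"
  \<comment> \<open>The step goes towards the farther end of the interval; being at most 1/2 long,
    it cannot leave it.\<close>
  proof (cases "x \<le> 1/2")
    case True
    with x i e show ?thesis by (intro exI[of _ "min (e/2) (1/2)"]) (auto simp: min_def)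
  next
    case False
    with x i e show ?thesis by (intro exI[of _ "- min (e/2) (1/2)"]) (auto simp: min_def)
  qed
qed

lemma fat_half_plane: "fat half_plane"
  unfolding fat_def
proof (intro ballI allI impI)
  fix x i :: "real^2" and e :: real
  assume x: "x \<in> half_plane" and i: "i \<in> Basis" and e: "0 < e"
  \<comment> \<open>Basis vectors have a non-negative first coordinate, so a positive step along any
    of them stays in the half plane.\<close>
  have "0 \<le> i $ 1" using i by (auto simp: Basis_vec_def axis_def)
  with x e show "\<exists>d. 0 < \<bar>d\<bar> \<and> \<bar>d\<bar> < e \<and> x + d *\<^sub>R i \<in> half_plane"
    by (intro exI[of _ "e/2"]) (auto simp: half_plane_def)
qed

section \<open>Derivatives within a set\<close>

definition dwithin ::
  "'e::euclidean_space set \<Rightarrow> ('e \<Rightarrow> 'f::euclidean_space) \<Rightarrow> 'e \<Rightarrow> 'e \<Rightarrow> 'f" where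
  "dwithin S f x = frechet_derivative f (at x within S)"

lemma dwithin_unique:
  assumes "fat S" "x \<in> S" "(f has_derivative f') (at x within S)"
  shows "dwithin S f x = f'"
proof (rule frechet_derivative_unique_within[OF _ assms(3)])
  show "(f has_derivative dwithin S f x) (at x within S)"
    using assms(3) unfolding dwithin_def by (metis differentiableI frechet_derivative_works)
qed (use assms(1,2) in \<open>auto simp: fat_def\<close>)

lemma smooth_on_has_derivative_ext:
  assumes "x \<in> S" "open W" "x \<in> W" "\<And>k. k_smooth k W h" "\<And>y. y \<in> S \<Longrightarrow> y \<in> W \<Longrightarrow> h y = f y"
  shows "(f has_derivative frechet_derivative h (at x)) (at x within S)"
proof -
  have "(h has_derivative frechet_derivative h (at x)) (at x within S)"
    using k_smooth_Suc_has_derivative[OF assms(4) assms(3)] by (rule has_derivative_at_withinI)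
  moreover have "\<forall>\<^sub>F y in at x within S. h y = f y"
    unfolding eventually_at_topological using assms by (intro exI[of _ W]) auto
  ultimately show ?thesis
    by (rule has_derivative_transform_eventually) (use assms in auto)
qed

lemma smooth_on_has_derivative:
  assumes "smooth_on S f" "x \<in> S"
  shows "(f has_derivative dwithin S f x) (at x within S)"
proof -
  obtain W h where "open W" "x \<in> W" "\<And>k. k_smooth k W h" "\<And>y. y \<in> S \<Longrightarrow> y \<in> W \<Longrightarrow> h y = f y"
    using smooth_on_extend[OF assms] by metis
  from smooth_on_has_derivative_ext[OF assms(2) this] show ?thesis
    unfolding dwithin_def by (metis differentiableI frechet_derivative_works)
qed

text \<open>On a fat set the derivative is determined by the values on the set, so it is that of any
  smooth extension. Through this, facts about open sets, such as the symmetry of second derivatives,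
  reach boundary points.\<close>

lemma dwithin_ext:
  assumes "fat S" "open W" "\<And>k. k_smooth k W h" "\<And>y. y \<in> S \<Longrightarrow> y \<in> W \<Longrightarrow> h y = f y"
    "x \<in> S" "x \<in> W"
  shows "dwithin S f x = frechet_derivative h (at x)"
  by (rule dwithin_unique[OF assms(1,5) smooth_on_has_derivative_ext[OF assms(5,2,6,3,4)]])

lemma smooth_on_dwithin:
  assumes S: "fat S" and f: "smooth_on S f"
  shows "smooth_on S (\<lambda>x. dwithin S f x v)"
proof (rule smooth_on_localI)
  fix x assume x: "x \<in> S"
  obtain W h where W: "open W" "x \<in> W" "\<And>k. k_smooth k W h"
      "\<And>y. y \<in> S \<Longrightarrow> y \<in> W \<Longrightarrow> h y = f y"
    using smooth_on_extend[OF f x] by metis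
  have "k_smooth k W (\<lambda>x. frechet_derivative h (at x) v)" for k
    using W(3)[of "Suc k"] by simp
  with W dwithin_ext[OF S W(1,3,4)] show
    "\<exists>W h. open W \<and> x \<in> W \<and> (\<forall>k. k_smooth k W h) \<and> (\<forall>y\<in>S \<inter> W. h y = dwithin S f y v)"
    by (intro exI[of _ W] exI[of _ "\<lambda>x. frechet_derivative h (at x) v"]) auto
qed

lemma dwithin_symmetric:
  assumes S: "fat S" and f: "smooth_on S f" and x: "x \<in> S"
  shows "dwithin S (\<lambda>x. dwithin S f x v) x w = dwithin S (\<lambda>x. dwithin S f x w) x v"
proof -
  obtain W h where W: "open W" "x \<in> W" "\<And>k. k_smooth k W h"
      "\<And>y. y \<in> S \<Longrightarrow> y \<in> W \<Longrightarrow> h y = f y"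
    using smooth_on_extend[OF f x] by metis
  have "k_smooth k W (\<lambda>x. frechet_derivative h (at x) v)" for k v
    using W(3)[of "Suc k"] by simp
  note * = dwithin_ext[OF S W(1) this _ x W(2)]
  have "dwithin S (\<lambda>x. dwithin S f x v) x = frechet_derivative (\<lambda>x. frechet_derivative h (at x) v) (at x)" for v
    by (rule *) (use dwithin_ext[OF S W(1,3,4)] in auto)
  then show ?thesis
    using second_derivative_symmetric[OF W(1,2) W(3)[of 2]] by simp
qed

lemma dwithin_cong:
  assumes "\<And>y. y \<in> S \<Longrightarrow> f y = g y" "x \<in> S"
  shows "dwithin S f x = dwithin S g x"
proof -
  have "(f has_derivative f') (at x within S) \<longleftrightarrow> (g has_derivative f') (at x within S)" for f'
    using has_derivative_transform[of x S g f f'] has_derivative_transform[of x S f g f'] assms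
    by auto
  then show ?thesis unfolding dwithin_def frechet_derivative_def by simp
qed

text \<open>Lets a derivative on the surface at a fixed parameter be read as one on the product with
  the parameter interval, where parameter and coordinate derivatives can be exchanged.\<close>

lemma dwithin_slice_snd:
  assumes ST: "fat T" and Q: "smooth_on (S \<times> T) Q" and s: "s \<in> S" "y \<in> T"
  shows "dwithin T (\<lambda>y. Q (s, y)) y v = dwithin (S \<times> T) Q (s, y) (0, v)"
proof -
  have "((\<lambda>y. Q (s, y)) has_derivative (\<lambda>v. dwithin (S \<times> T) Q (s, y) (0, v))) (at y within T)"
    by (rule has_derivative_in_compose2[of "S \<times> T" Q "\<lambda>p. dwithin (S \<times> T) Q p" "\<lambda>y. (s, y)" T y "\<lambda>v. (0, v)"])
       (use Q s in \<open>auto intro!: smooth_on_has_derivative derivative_eq_intros\<close>)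
  then show ?thesis using dwithin_unique[OF ST s(2)] by metis
qed

section \<open>Matrices and flat connections\<close>

lemma has_derivative_unique_fat:
  fixes f :: "'e::euclidean_space \<Rightarrow> 'f::euclidean_space"
  assumes "fat S" "x \<in> S" "(f has_derivative f') (at x within S)" "(f has_derivative f'') (at x within S)"
  shows "f' = f''"
  using dwithin_unique[OF assms(1,2,3)] dwithin_unique[OF assms(1,2,4)] by simp

lemma dwithin_chain:
  assumes "fat S" "x \<in> S" "(\<phi> has_derivative \<phi>') (at x within S)" "\<And>y. y \<in> S \<Longrightarrow> \<phi> y \<in> T"
    and "smooth_on T h"
  shows "dwithin S (\<lambda>x. h (\<phi> x)) x v = dwithin T h (\<phi> x) (\<phi>' v)"
proof -
  have "((\<lambda>x. h (\<phi> x)) has_derivative (\<lambda>v. dwithin T h (\<phi> x) (\<phi>' v))) (at x within S)"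
    by (rule has_derivative_in_compose2[of T h "dwithin T h"])
       (use assms in \<open>auto intro: smooth_on_has_derivative\<close>)
  then show ?thesis by (simp add: dwithin_unique[OF assms(1,2)])
qed

text \<open>The adjugate of a 2 by 2 matrix. It is the inverse on \<open>SL2\<close> but linear on
  all matrices, so smoothness and derivatives of inverses come for free.\<close>

definition adj :: "mat2 \<Rightarrow> mat2" where
  "adj M = trace M *\<^sub>R mat 1 - M"

lemmas mat2_simps = vec_eq_iff forall_2 sum_2 matrix_matrix_mult_def det_2 trace_def mat_def

lemma bounded_linear_trace: "bounded_linear (trace :: mat2 \<Rightarrow> real)"
  unfolding linear_conv_bounded_linear[symmetric]
  by (rule linearI) (auto simp: trace_def sum_2 algebra_simps)

lemma bounded_linear_adj: "bounded_linear adj"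
  unfolding linear_conv_bounded_linear[symmetric] adj_def
  by (rule linearI) (auto simp: mat2_simps algebra_simps)

lemma bounded_bilinear_matrix_mult: "bounded_bilinear ((**) :: mat2 \<Rightarrow> mat2 \<Rightarrow> mat2)"
  unfolding bilinear_conv_bounded_bilinear[symmetric] bilinear_def
  by (intro conjI allI linearI) (auto simp: mat2_simps algebra_simps)

lemmas matrix_mult_bilinear_simps = bounded_bilinear.zero_left[OF bounded_bilinear_matrix_mult]
  bounded_bilinear.zero_right[OF bounded_bilinear_matrix_mult]
  bounded_bilinear.minus_left[OF bounded_bilinear_matrix_mult]
  bounded_bilinear.minus_right[OF bounded_bilinear_matrix_mult]
  bounded_bilinear.add_left[OF bounded_bilinear_matrix_mult]
  bounded_bilinear.add_right[OF bounded_bilinear_matrix_mult]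
  bounded_bilinear.diff_left[OF bounded_bilinear_matrix_mult]
  bounded_bilinear.diff_right[OF bounded_bilinear_matrix_mult]

lemma adj_mult: "adj (A ** B) = adj B ** adj A"
  by (simp add: adj_def mat2_simps algebra_simps)

lemma adj_adj [simp]: "adj (adj A) = A"
  by (simp add: adj_def mat2_simps)

lemma adj_mult_self: "A \<in> SL2 \<Longrightarrow> adj A ** A = mat 1"
  and self_mult_adj: "A \<in> SL2 \<Longrightarrow> A ** adj A = mat 1"
  by (auto simp: SL2_def adj_def mat2_simps algebra_simps)

lemma matrix_inv_SL2:
  assumes "A \<in> SL2"
  shows "matrix_inv A = adj A"
proof -
  have "A ** matrix_inv A = mat 1"
    unfolding matrix_inv_def
    by (rule someI2[of _ "adj A"]) (use adj_mult_self self_mult_adj assms in auto)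
  then have "adj A ** A ** matrix_inv A = adj A" by (metis matrix_mul_assoc matrix_mul_rid)
  then show ?thesis by (simp add: adj_mult_self[OF assms])
qed

lemma SL2_mult: "A \<in> SL2 \<Longrightarrow> B \<in> SL2 \<Longrightarrow> A ** B \<in> SL2"
  by (simp add: SL2_def det_mul)

lemma SL2_adj: "A \<in> SL2 \<Longrightarrow> adj A \<in> SL2"
  by (simp add: SL2_def adj_def mat2_simps algebra_simps)

lemma sl2_conj: "A \<in> SL2 \<Longrightarrow> X \<in> sl2 \<Longrightarrow> A ** X ** adj A \<in> sl2"
  unfolding SL2_def sl2_def adj_def
  by (simp add: mat2_simps) (algebra)

lemma sl2_conj': "A \<in> SL2 \<Longrightarrow> X \<in> sl2 \<Longrightarrow> adj A ** X ** A \<in> sl2"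
  using sl2_conj[OF SL2_adj] by simp

lemma sl2_add: "X \<in> sl2 \<Longrightarrow> Y \<in> sl2 \<Longrightarrow> X + Y \<in> sl2"
  and sl2_diff: "X \<in> sl2 \<Longrightarrow> Y \<in> sl2 \<Longrightarrow> X - Y \<in> sl2"
  and sl2_scaleR: "X \<in> sl2 \<Longrightarrow> r *\<^sub>R X \<in> sl2"
  using linear_add[OF bounded_linear.linear[OF bounded_linear_trace]]
    linear_diff[OF bounded_linear.linear[OF bounded_linear_trace]]
    linear_scale[OF bounded_linear.linear[OF bounded_linear_trace]]
  by (auto simp: sl2_def)

lemma smooth_on_adj:
  fixes h :: "'e::euclidean_space \<Rightarrow> mat2"
  shows "smooth_on S h \<Longrightarrow> smooth_on S (\<lambda>x. adj (h x))"
  by (rule smooth_on_linear_comp[OF bounded_linear_adj])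

lemmas smooth_on_matrix_mult = smooth_on_bilinear[OF bounded_bilinear_matrix_mult]

text \<open>The Maurer--Cartan form \<open>h\<inverse> \<partial>\<^sub>v h\<close> and its translational part \<open>h\<inverse> (\<partial>\<^sub>v F) h\<close>.\<close>

definition rot_form :: "'e::euclidean_space set \<Rightarrow> ('e \<Rightarrow> mat2) \<Rightarrow> 'e \<Rightarrow> 'e \<Rightarrow> mat2" where
  "rot_form S h v x = adj (h x) ** dwithin S h x v"

definition trans_form ::
  "'e::euclidean_space set \<Rightarrow> ('e \<Rightarrow> mat2) \<Rightarrow> ('e \<Rightarrow> mat2) \<Rightarrow> 'e \<Rightarrow> 'e \<Rightarrow> mat2" where
  "trans_form S h F v x = adj (h x) ** dwithin S F x v ** h x"

section \<open>Maurer-Cartan identities\<close>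

lemma smooth_on_rot_form: "fat S \<Longrightarrow> smooth_on S h \<Longrightarrow> smooth_on S (rot_form S h v)"
  unfolding rot_form_def[abs_def]
  by (intro smooth_on_matrix_mult smooth_on_adj smooth_on_dwithin)

lemma smooth_on_trans_form:
  "fat S \<Longrightarrow> smooth_on S h \<Longrightarrow> smooth_on S F \<Longrightarrow> smooth_on S (trans_form S h F v)"
  unfolding trans_form_def[abs_def]
  by (rule smooth_on_matrix_mult[OF smooth_on_matrix_mult[OF smooth_on_adj smooth_on_dwithin]])

text \<open>Differentiate the constant \<open>adj (h x) ** h x\<close>; solved for the derivative of
  the inverse, this is the usual rule with the derivative of \<open>h\<close> between two
  inverses.\<close>

lemma adj_dwithin:
  assumes S: "fat S" "x \<in> S" and h: "smooth_on S h" "\<And>y. y \<in> S \<Longrightarrow> h y \<in> SL2"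
  shows "adj (dwithin S h x v) ** h x + adj (h x) ** dwithin S h x v = 0"
    and "adj (dwithin S h x v) = - (adj (h x) ** dwithin S h x v ** adj (h x))"
proof -
  note dh = smooth_on_has_derivative[OF h(1) S(2)]
  have "((\<lambda>y. adj (h y) ** h y) has_derivative
      (\<lambda>v. adj (h x) ** dwithin S h x v + adj (dwithin S h x v) ** h x)) (at x within S)"
    by (rule bounded_bilinear.FDERIV[OF bounded_bilinear_matrix_mult
          bounded_linear.has_derivative[OF bounded_linear_adj dh] dh])
  moreover have "((\<lambda>y. adj (h y) ** h y) has_derivative (\<lambda>v. 0)) (at x within S)"
    by (rule has_derivative_transform[OF S(2) _ has_derivative_const[of "mat 1"]])
       (use h(2) adj_mult_self in auto)
  ultimately have "(\<lambda>v. adj (h x) ** dwithin S h x v + adj (dwithin S h x v) ** h x) = (\<lambda>v. 0)"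
    by (rule has_derivative_unique_fat[OF S])
  then show *: "adj (dwithin S h x v) ** h x + adj (h x) ** dwithin S h x v = 0"
    by (auto dest: fun_cong[of _ _ v] simp: add.commute)
  have "adj (dwithin S h x v) = adj (dwithin S h x v) ** (h x ** adj (h x))"
    using self_mult_adj[OF h(2)[OF S(2)]] by simp
  also have "\<dots> = - (adj (h x) ** dwithin S h x v) ** adj (h x)"
    unfolding matrix_mul_assoc eq_neg_iff_add_eq_0[THEN iffD2, OF *] ..
  finally show "adj (dwithin S h x v) = - (adj (h x) ** dwithin S h x v ** adj (h x))"
    by (simp add: matrix_mult_bilinear_simps)
qed

lemma rot_form_sl2:
  assumes "fat S" "x \<in> S" "smooth_on S h" "\<And>y. y \<in> S \<Longrightarrow> h y \<in> SL2"
  shows "rot_form S h v x \<in> sl2"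
proof -
  \<comment> \<open>Polarization of \<open>adj A ** A = det A *\<^sub>R mat 1\<close>. It identifies
    the vanishing sum in \<open>adj_dwithin\<close> with the trace of the form times the unit
    matrix.\<close>
  have "adj B ** A + adj A ** B = trace (adj A ** B) *\<^sub>R mat 1" for A B :: mat2
    by (simp add: adj_def mat2_simps algebra_simps)
  with adj_dwithin(1)[OF assms] have "trace (rot_form S h v x) *\<^sub>R (mat 1 :: mat2) = 0"
    by (metis rot_form_def)
  then show ?thesis by (auto simp: sl2_def mat2_simps)
qed

text \<open>The trace of \<open>F\<close> vanishes identically on \<open>S\<close>, hence so does
  its derivative, and conjugation by \<open>h x\<close> preserves the trace.\<close>

lemma trans_form_sl2:
  assumes S: "fat S" "x \<in> S" and F: "smooth_on S F" "\<And>y. y \<in> S \<Longrightarrow> F y \<in> sl2"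
    and h: "h x \<in> SL2"
  shows "trans_form S h F v x \<in> sl2"
proof -
  have "((\<lambda>y. trace (F y)) has_derivative (\<lambda>v. trace (dwithin S F x v))) (at x within S)"
    by (rule bounded_linear.has_derivative[OF bounded_linear_trace smooth_on_has_derivative[OF F(1) S(2)]])
  moreover have "((\<lambda>y. trace (F y)) has_derivative (\<lambda>v. 0)) (at x within S)"
    by (rule has_derivative_transform[OF S(2) _ has_derivative_const[of "0"]])
       (use F(2) in \<open>auto simp: sl2_def\<close>)
  ultimately have "(\<lambda>v. trace (dwithin S F x v)) = (\<lambda>v. 0)"
    by (rule has_derivative_unique_fat[OF S])
  then have "dwithin S F x v \<in> sl2" by (auto simp: sl2_def dest: fun_cong[of _ _ v])
  with sl2_conj'[OF h] show ?thesis by (simp add: trans_form_def)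
qed

lemma dwithin_rot_form:
  assumes S: "fat S" "x \<in> S" and h: "smooth_on S h" "\<And>y. y \<in> S \<Longrightarrow> h y \<in> SL2"
  shows "dwithin S (rot_form S h w) x v =
    adj (h x) ** dwithin S (\<lambda>y. dwithin S h y w) x v - rot_form S h v x ** rot_form S h w x"
proof -
  have "(rot_form S h w has_derivative (\<lambda>v. adj (h x) ** dwithin S (\<lambda>y. dwithin S h y w) x v
      + adj (dwithin S h x v) ** dwithin S h x w)) (at x within S)"
    unfolding rot_form_def[abs_def]
    by (intro bounded_bilinear.FDERIV[OF bounded_bilinear_matrix_mult]
        bounded_linear.has_derivative[OF bounded_linear_adj] smooth_on_has_derivative
        smooth_on_dwithin S h(1))
  from dwithin_unique[OF S this] show ?thesis
    by (simp add: adj_dwithin(2)[OF S h] rot_form_def matrix_mult_bilinear_simps matrix_mul_assoc)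
qed

lemma dwithin_trans_form:
  assumes S: "fat S" "x \<in> S" and h: "smooth_on S h" "\<And>y. y \<in> S \<Longrightarrow> h y \<in> SL2"
    and F: "smooth_on S F"
  shows "dwithin S (trans_form S h F w) x v =
    adj (h x) ** dwithin S (\<lambda>y. dwithin S F y w) x v ** h x
      + trans_form S h F w x ** rot_form S h v x - rot_form S h v x ** trans_form S h F w x"
proof -
  have "(trans_form S h F w has_derivative (\<lambda>v. adj (h x) ** dwithin S F x w ** dwithin S h x v
      + (adj (h x) ** dwithin S (\<lambda>y. dwithin S F y w) x v
      + adj (dwithin S h x v) ** dwithin S F x w) ** h x)) (at x within S)"
    unfolding trans_form_def[abs_def]
    by (rule bounded_bilinear.FDERIV[OF bounded_bilinear_matrix_mult
          bounded_bilinear.FDERIV[OF bounded_bilinear_matrix_mult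
            bounded_linear.has_derivative[OF bounded_linear_adj] smooth_on_has_derivative]
          smooth_on_has_derivative])
       (simp_all add: smooth_on_has_derivative smooth_on_dwithin S h(1) F)
  moreover have "trans_form S h F w x ** rot_form S h v x = adj (h x) ** dwithin S F x w ** dwithin S h x v"
  proof -
    have "trans_form S h F w x ** rot_form S h v x
        = adj (h x) ** dwithin S F x w ** (h x ** adj (h x)) ** dwithin S h x v"
      by (simp add: trans_form_def rot_form_def matrix_mul_assoc)
    then show ?thesis by (simp add: self_mult_adj[OF h(2)[OF S(2)]])
  qed
  ultimately show ?thesis
    by (simp add: dwithin_unique[OF S] adj_dwithin(2)[OF S h] rot_form_def trans_form_def matrix_mult_bilinear_simps matrix_mul_assoc)
qed

text \<open>Maurer-Cartan equation: the second derivatives cancel by symmetry, and the remaining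
  products are minus the commutator.\<close>

lemma rot_form_flat:
  assumes S: "fat S" "x \<in> S" and h: "smooth_on S h" "\<And>y. y \<in> S \<Longrightarrow> h y \<in> SL2"
  shows "dwithin S (rot_form S h w) x v - dwithin S (rot_form S h v) x w
    + comm (rot_form S h v x) (rot_form S h w x) = 0"
  by (simp add: dwithin_rot_form[OF S h] comm_def dwithin_symmetric[OF S(1) h(1) S(2), of v w])

text \<open>Adding the commutator removes the two terms that stem from differentiating the
  conjugation by \<open>h\<close>. What remains on either side is the conjugate of a second
  derivative of \<open>F\<close>, which is symmetric in \<open>v\<close> and
  \<open>w\<close>.\<close>

lemma trans_form_flat:
  assumes S: "fat S" "x \<in> S" and h: "smooth_on S h" "\<And>y. y \<in> S \<Longrightarrow> h y \<in> SL2"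
    and F: "smooth_on S F"
  shows "dwithin S (trans_form S h F w) x v + comm (rot_form S h v x) (trans_form S h F w x)
    = dwithin S (trans_form S h F v) x w + comm (rot_form S h w x) (trans_form S h F v x)"
  by (simp add: dwithin_trans_form[OF S h F] comm_def dwithin_symmetric[OF S(1) F S(2), of v w])

text \<open>Loops act on the potentials by constant left translations, so this invariance, together
  with \<open>trans_form_left_translate\<close>, lets the forms descend from the cover to the
  surface.\<close>

lemma rot_form_left_translate:
  assumes "fat S" "x \<in> S" "smooth_on S h" "M \<in> SL2"
  shows "rot_form S (\<lambda>y. M ** h y) v x = rot_form S h v x"
proof -
  have "((\<lambda>y. M ** h y) has_derivative (\<lambda>v. M ** dwithin S h x v)) (at x within S)"
    by (rule bounded_linear.has_derivative[OF
          bounded_bilinear.bounded_linear_right[OF bounded_bilinear_matrix_mult]])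
       (rule smooth_on_has_derivative[OF assms(3,2)])
  then have "rot_form S (\<lambda>y. M ** h y) v x = adj (h x) ** (adj M ** M) ** dwithin S h x v"
    by (simp add: rot_form_def dwithin_unique[OF assms(1,2)] adj_mult matrix_mul_assoc)
  then show ?thesis by (simp add: adj_mult_self[OF assms(4)] rot_form_def)
qed

lemma trans_form_left_translate:
  assumes "fat S" "x \<in> S" "smooth_on S F" "M \<in> SL2"
  shows "trans_form S (\<lambda>y. M ** h y) (\<lambda>y. C + M ** F y ** adj M) v x = trans_form S h F v x"
proof -
  have "bounded_linear (\<lambda>X. M ** X ** adj M)"
    by (rule bounded_linear_compose[OF
          bounded_bilinear.bounded_linear_left[OF bounded_bilinear_matrix_mult]
          bounded_bilinear.bounded_linear_right[OF bounded_bilinear_matrix_mult]])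
  then have "((\<lambda>y. C + M ** F y ** adj M) has_derivative (\<lambda>v. 0 + M ** dwithin S F x v ** adj M))
      (at x within S)"
    by (rule has_derivative_add[OF has_derivative_const
          bounded_linear.has_derivative[OF _ smooth_on_has_derivative[OF assms(3,2)]]])
  then have "trans_form S (\<lambda>y. M ** h y) (\<lambda>y. C + M ** F y ** adj M) v x
     = adj (h x) ** (adj M ** M) ** dwithin S F x v ** (adj M ** M) ** h x"
    by (simp add: trans_form_def dwithin_unique[OF assms(1,2)] adj_mult matrix_mul_assoc)
  then show ?thesis by (simp add: adj_mult_self[OF assms(4)] trans_form_def)
qed

section \<open>Path classes and the universal cover\<close>

lemma path_class_self: "path p \<Longrightarrow> path_image p \<subseteq> S \<Longrightarrow> p \<in> path_class S p"
  by (simp add: path_class_def)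

lemma path_class_eq: "homotopic_paths S p q \<Longrightarrow> path_class S p = path_class S q"
  unfolding path_class_def by (auto intro: homotopic_paths_trans homotopic_paths_sym)

lemma path_class_eqD:
  "path_class S p = path_class S q \<Longrightarrow> path q \<Longrightarrow> path_image q \<subseteq> S \<Longrightarrow> homotopic_paths S p q"
  using path_class_self[of q S] by (auto simp: path_class_def)

lemma mem_path_classD:
  assumes "q \<in> path_class S p"
  shows "path q" "path_image q \<subseteq> S" "pathstart q = pathstart p" "pathfinish q = pathfinish p"
    "path_class S q = path_class S p"
  using assms homotopic_paths_imp_path homotopic_paths_imp_subset homotopic_paths_imp_pathstart
    homotopic_paths_imp_pathfinish path_class_eq
  unfolding path_class_def by fastforce+

lemma endpoint_path_class:
  "path p \<Longrightarrow> path_image p \<subseteq> S \<Longrightarrow> endpoint (path_class S p) = pathfinish p"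
  unfolding endpoint_def by (metis mem_path_classD(4) path_class_self someI)

lemma ucoverI: "path p \<Longrightarrow> path_image p \<subseteq> S \<Longrightarrow> pathstart p = b \<Longrightarrow> path_class S p \<in> ucover S b"
  unfolding ucover_def by blast

lemma ucoverE:
  assumes "C \<in> ucover S b"
  obtains p where "path p" "path_image p \<subseteq> S" "pathstart p = b" "C = path_class S p"
    "endpoint C = pathfinish p"
proof -
  from assms obtain p where "C = path_class S p" "path p" "path_image p \<subseteq> S" "pathstart p = b"
    unfolding ucover_def by blast
  with that[of p] show thesis by (simp add: endpoint_path_class)
qed

lemma class_join_path_class:
  assumes "path p" "path_image p \<subseteq> S" "path q" "path_image q \<subseteq> S" "pathfinish p = pathstart q"
  shows "class_join S (path_class S p) (path_class S q) = path_class S (p +++ q)"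
  unfolding class_join_def
proof (intro equalityI subsetI)
  fix r assume "r \<in> {r. \<exists>p\<in>path_class S p. \<exists>q\<in>path_class S q. homotopic_paths S (p +++ q) r}"
  then obtain p' q' where "homotopic_paths S p p'" "homotopic_paths S q q'"
      "homotopic_paths S (p' +++ q') r"
    by (auto simp: path_class_def)
  then show "r \<in> path_class S (p +++ q)"
    using homotopic_paths_join[of S p p' q q'] assms(5) homotopic_paths_trans
    unfolding path_class_def by blast
next
  fix r assume "r \<in> path_class S (p +++ q)"
  then have "homotopic_paths S (p +++ q) r" by (simp add: path_class_def)
  then show "r \<in> {r. \<exists>p\<in>path_class S p. \<exists>q\<in>path_class S q. homotopic_paths S (p +++ q) r}"
    using path_class_self[OF assms(1,2)] path_class_self[OF assms(3,4)] by blast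
qed

lemma path_const: "path (\<lambda>_. x)"
  by (simp add: path_def)

text \<open>The library states the following two facts for normed spaces only, where \<open>linepath\<close> is
  available; they are transported from the interval.\<close>

lemma homotopic_paths_const_right:
  assumes "path p" "path_image p \<subseteq> S"
  shows "homotopic_paths S (p +++ (\<lambda>_. pathfinish p)) p"
proof -
  have "homotopic_paths {0..1} (linepath 0 1 +++ linepath 1 1) (linepath 0 (1::real))"
    using homotopic_paths_rid[of "linepath 0 (1::real)" "{0..1}"]
    by (simp add: closed_segment_eq_real_ivl)
  then have "homotopic_paths S (p \<circ> (linepath 0 1 +++ linepath 1 1)) (p \<circ> linepath 0 1)"
    by (rule homotopic_paths_continuous_image) (use assms in \<open>auto simp: path_def path_image_def\<close>)
  moreover have "p \<circ> linepath 0 1 = p"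
    by (simp add: fun_eq_iff linepath_def)
  moreover have "p \<circ> (linepath 0 1 +++ linepath 1 1) = p +++ (\<lambda>_. pathfinish p)"
    by (simp add: fun_eq_iff joinpaths_def linepath_def pathfinish_def)
  ultimately show ?thesis by simp
qed

lemma homotopic_paths_reversepath_left:
  assumes "path p" "path_image p \<subseteq> S"
  shows "homotopic_paths S (reversepath p +++ p) (\<lambda>_. pathfinish p)"
proof -
  have "homotopic_paths {0..1} (reversepath (linepath 0 1) +++ linepath 0 1) (linepath 1 (1::real))"
    using homotopic_paths_linv[of "linepath 0 (1::real)" "{0..1}"]
    by (simp add: closed_segment_eq_real_ivl del: reversepath_linepath)
  then have "homotopic_paths S (p \<circ> (reversepath (linepath 0 1) +++ linepath 0 1)) (p \<circ> linepath 1 1)"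
    by (rule homotopic_paths_continuous_image) (use assms in \<open>auto simp: path_def path_image_def\<close>)
  moreover have "p \<circ> linepath 1 1 = (\<lambda>_. pathfinish p)"
    by (simp add: fun_eq_iff linepath_def pathfinish_def)
  moreover have "p \<circ> (reversepath (linepath 0 1) +++ linepath 0 1) = reversepath p +++ p"
    by (simp add: fun_eq_iff joinpaths_def linepath_def reversepath_def)
  ultimately show ?thesis by simp
qed

lemma path_class_join_assoc:
  assumes "path p" "path_image p \<subseteq> S" "path q" "path_image q \<subseteq> S" "path r" "path_image r \<subseteq> S"
    "pathfinish p = pathstart q" "pathfinish q = pathstart r"
  shows "path_class S (p +++ (q +++ r)) = path_class S ((p +++ q) +++ r)"
  by (rule path_class_eq[OF homotopic_paths_assoc]) (use assms in auto)

lemma path_class_join_cong: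
  assumes "homotopic_paths S p p'" "homotopic_paths S q q'" "pathfinish p = pathstart q"
  shows "path_class S (p +++ q) = path_class S (p' +++ q')"
  by (rule path_class_eq[OF homotopic_paths_join[OF assms]])

text \<open>The detour \<open>reversepath p +++ p\<close> in the middle contracts. This is the
  computation behind the transitivity of loops on the fibres.\<close>

lemma path_class_cancel:
  assumes "path p" "path_image p \<subseteq> S" "path p'" "path_image p' \<subseteq> S" "path q" "path_image q \<subseteq> S"
    "pathstart q = pathfinish p" "pathfinish p' = pathfinish p" "pathstart p = pathstart p'"
  shows "class_join S (path_class S (p' +++ reversepath p)) (path_class S (p +++ q))
    = path_class S (p' +++ q)"
proof -
  have "class_join S (path_class S (p' +++ reversepath p)) (path_class S (p +++ q))
      = path_class S ((p' +++ reversepath p) +++ (p +++ q))"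
    by (rule class_join_path_class) (use assms in \<open>auto simp: path_image_join\<close>)
  also have "\<dots> = path_class S (((p' +++ reversepath p) +++ p) +++ q)"
    by (rule path_class_join_assoc) (use assms in \<open>auto simp: path_image_join\<close>)
  also have "\<dots> = path_class S (p' +++ q)"
  proof (rule path_class_join_cong)
    have "homotopic_paths S (p' +++ (reversepath p +++ p)) (p' +++ (\<lambda>_. pathfinish p'))"
      using homotopic_paths_join[of S p' p' "reversepath p +++ p"]
        homotopic_paths_reversepath_left[of p S] assms by simp
    moreover have "homotopic_paths S (p' +++ (\<lambda>_. pathfinish p')) p'"
      using assms by (intro homotopic_paths_const_right)
    moreover have "homotopic_paths S (p' +++ (reversepath p +++ p)) ((p' +++ reversepath p) +++ p)"
      by (rule homotopic_paths_assoc) (use assms in auto)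
    ultimately show "homotopic_paths S ((p' +++ reversepath p) +++ p) p'"
      using homotopic_paths_sym homotopic_paths_trans by metis
  qed (use assms in auto)
  finally show ?thesis .
qed

lemma ucover_fibre:
  assumes "C \<in> ucover S b" "D \<in> ucover S b" "endpoint C = endpoint D"
  obtains l where "l \<in> loop_classes S b" "D = class_join S l C"
proof -
  obtain p where p: "path p" "path_image p \<subseteq> S" "pathstart p = b" "C = path_class S p"
    "endpoint C = pathfinish p" using assms(1) by (rule ucoverE)
  obtain p' where p': "path p'" "path_image p' \<subseteq> S" "pathstart p' = b" "D = path_class S p'"
    "endpoint D = pathfinish p'" using assms(2) by (rule ucoverE)
  \<comment> \<open>The loop runs out along \<open>p'\<close> and back along \<open>p\<close>. The
    constant path \<open>?c\<close> brings both classes into the shape that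
    \<open>path_class_cancel\<close> requires.\<close>
  let ?l = "path_class S (p' +++ reversepath p)" and ?c = "\<lambda>_::real. pathfinish p"
  have c: "path ?c" "path_image ?c \<subseteq> S"
    using p(2) pathfinish_in_path_image[of p] by (auto simp: path_const path_image_def[of ?c])
  have "class_join S ?l (path_class S (p +++ ?c)) = path_class S (p' +++ ?c)"
    by (rule path_class_cancel) (use p p' c assms(3) in \<open>auto simp: pathstart_def\<close>)
  moreover have "path_class S (p +++ ?c) = C"
    using p path_class_eq[OF homotopic_paths_const_right[of p S]] by simp
  moreover have "path_class S (p' +++ ?c) = D"
    using p p' assms(3) path_class_eq[OF homotopic_paths_const_right[of p' S]] by simp
  moreover have "?l \<in> loop_classes S b"
  proof -
    have "path (p' +++ reversepath p)" "path_image (p' +++ reversepath p) \<subseteq> S"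
      using p p' assms(3) by (auto simp: path_image_join)
    then show ?thesis
      unfolding loop_classes_def using p p' by (auto simp: endpoint_path_class intro: ucoverI)
  qed
  ultimately show thesis using that[of ?l] by simp
qed

section \<open>Basic neighbourhoods in the cover\<close>

definition continuations :: "'a::topological_space set \<Rightarrow> (real \<Rightarrow> 'a) \<Rightarrow> 'a set \<Rightarrow> 'a path_class set" where
  "continuations S p V =
    {path_class S (p +++ q) | q. path q \<and> path_image q \<subseteq> V \<and> pathstart q = pathfinish p}"

lemma continuationsI:
  "path q \<Longrightarrow> path_image q \<subseteq> V \<Longrightarrow> pathstart q = pathfinish p \<Longrightarrow> path_class S (p +++ q) \<in> continuations S p V"
  unfolding continuations_def by blast

lemma continuationsE:
  assumes "C \<in> continuations S p V"
  obtains q where "path q" "path_image q \<subseteq> V" "pathstart q = pathfinish p" "C = path_class S (p +++ q)"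
  using assms unfolding continuations_def by blast

lemma continuations_self:
  assumes "path p" "path_image p \<subseteq> S" "pathfinish p \<in> V"
  shows "path_class S p \<in> continuations S p V"
proof -
  have "path_class S (p +++ (\<lambda>_. pathfinish p)) \<in> continuations S p V"
    by (rule continuationsI) (use assms in \<open>auto simp: path_const path_image_def pathstart_def\<close>)
  then show ?thesis using path_class_eq[OF homotopic_paths_const_right] assms by metis
qed

lemma continuations_mono: "V \<subseteq> W \<Longrightarrow> continuations S p V \<subseteq> continuations S p W"
  unfolding continuations_def by blast

lemma continuations_cong:
  assumes "homotopic_paths S p p'" "V \<subseteq> S"
  shows "continuations S p V = continuations S p' V"
proof -
  have *: "continuations S p V \<subseteq> continuations S p' V" if h: "homotopic_paths S p p'" for p p'
  proof
    fix C assume "C \<in> continuations S p V"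
    then obtain q where q: "path q" "path_image q \<subseteq> V" "pathstart q = pathfinish p"
        "C = path_class S (p +++ q)" by (rule continuationsE)
    then have "C = path_class S (p' +++ q)"
      using assms(2) h by (simp add: path_class_join_cong[of S p p' q q])
    then show "C \<in> continuations S p' V"
      using q homotopic_paths_imp_pathfinish[OF h] by (simp add: continuationsI)
  qed
  show ?thesis using *[OF assms(1)] *[OF homotopic_paths_sym[OF assms(1)]] by blast
qed

lemma continuations_join:
  assumes "path p" "path_image p \<subseteq> S" "V \<subseteq> S" "path q" "path_image q \<subseteq> V" "pathstart q = pathfinish p"
  shows "continuations S (p +++ q) V \<subseteq> continuations S p V"
proof
  fix C assume "C \<in> continuations S (p +++ q) V"
  then obtain r where r: "path r" "path_image r \<subseteq> V" "pathstart r = pathfinish q"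
      "C = path_class S ((p +++ q) +++ r)" by (auto elim: continuationsE)
  then have "C = path_class S (p +++ (q +++ r))"
    using assms by (simp add: path_class_join_assoc)
  then show "C \<in> continuations S p V"
    using r assms by (auto intro!: continuationsI simp: path_image_join)
qed

lemma openin_continuations:
  assumes "path p" "path_image p \<subseteq> S" "pathstart p = b" "openin (top_of_set S) V" "pathfinish p \<in> V"
  shows "openin (ucover_topology S b) (continuations S p V)"
  unfolding ucover_topology_def openin_topology_generated_by_iff continuations_def
  by (rule generate_topology_on.Basis) (use assms in blast)

text \<open>Open sets can be tested at any representative of any of their points. The induction
  hinges on the generators: there \<open>p\<close> is homotopic to the base path continued inside
  \<open>V\<close>, so continuing \<open>p\<close> inside \<open>V\<close> does not leave the
  generator.\<close>

lemma ucover_topology_nhd: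
  assumes W: "openin (ucover_topology S b) W" and p: "path p" "path_image p \<subseteq> S" "path_class S p \<in> W"
  obtains V where "openin (top_of_set S) V" "pathfinish p \<in> V" "continuations S p V \<subseteq> W"
proof -
  have "\<exists>V. openin (top_of_set S) V \<and> pathfinish p \<in> V \<and> continuations S p V \<subseteq> W"
    using W[unfolded ucover_topology_def openin_topology_generated_by_iff] p
  proof induction
    case Empty
    then show ?case by simp
  next
    case (Int A B)
    then obtain V V' where V: "openin (top_of_set S) V \<and> pathfinish p \<in> V \<and> continuations S p V \<subseteq> A"
      "openin (top_of_set S) V' \<and> pathfinish p \<in> V' \<and> continuations S p V' \<subseteq> B" by blast
    then show ?case
      using continuations_mono[of "V \<inter> V'" V S p] continuations_mono[of "V \<inter> V'" V' S p]
      by (intro exI[of _ "V \<inter> V'"]) auto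
  next
    case (UN K)
    then obtain k where "k \<in> K" "path_class S p \<in> k" by blast
    with UN.IH[OF this(1) UN.prems(1,2)] show ?case by blast
  next
    case (Basis B)
    then obtain p0 V where V: "B = continuations S p0 V" "path p0" "path_image p0 \<subseteq> S"
        "openin (top_of_set S) V" "pathfinish p0 \<in> V"
      unfolding continuations_def by blast
    have VS: "V \<subseteq> S" using V(4) openin_imp_subset by blast
    from Basis V obtain q where q: "path q" "path_image q \<subseteq> V" "pathstart q = pathfinish p0"
        "path_class S p = path_class S (p0 +++ q)" by (auto elim: continuationsE)
    have "path (p0 +++ q)" "path_image (p0 +++ q) \<subseteq> S"
      using q V VS by (auto simp: path_image_join)
    then have h: "homotopic_paths S p (p0 +++ q)" using q by (intro path_class_eqD)
    have "continuations S p V = continuations S (p0 +++ q) V"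
      by (rule continuations_cong[OF h VS])
    also have "\<dots> \<subseteq> B" unfolding V(1) by (rule continuations_join) (use V VS q in auto)
    finally have "continuations S p V \<subseteq> B" .
    moreover have "pathfinish p \<in> V"
      using homotopic_paths_imp_pathfinish[OF h] q(2) pathfinish_in_path_image[of q] by auto
    ultimately show ?case using V by blast
  qed
  then show thesis using that by blast
qed

lemma topspace_ucover_topology: "topspace (ucover_topology S b) = ucover S b"
proof
  show "topspace (ucover_topology S b) \<subseteq> ucover S b"
    unfolding ucover_topology_def topology_generated_by_topspace
  proof clarsimp
    fix p V q
    assume *: "path p" "path_image p \<subseteq> S" "b = pathstart p" "openin (top_of_set S) V"
      "path q" "path_image q \<subseteq> V" "pathstart q = pathfinish p"
    then have "path_image (p +++ q) \<subseteq> S"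
      using openin_imp_subset by (fastforce simp: path_image_join)
    with * show "path_class S (p +++ q) \<in> ucover S (pathstart p)" by (intro ucoverI) auto
  qed
  show "ucover S b \<subseteq> topspace (ucover_topology S b)"
  proof
    fix C assume "C \<in> ucover S b"
    then obtain p where p: "path p" "path_image p \<subseteq> S" "pathstart p = b" "C = path_class S p"
      by (rule ucoverE)
    have f: "pathfinish p \<in> S" using p pathfinish_in_path_image by blast
    have "openin (ucover_topology S b) (continuations S p S)"
      by (rule openin_continuations) (use p f in auto)
    with continuations_self[OF p(1,2) f] p(4) show "C \<in> topspace (ucover_topology S b)"
      using openin_subset by blast
  qed
qed

section \<open>Charts and local sections of the cover\<close>

lemma chart_inv_mem: "y \<in> chart_image c \<Longrightarrow> chart_inv c y \<in> fst c"
  and chart_of_chart_inv: "y \<in> chart_image c \<Longrightarrow> snd c (chart_inv c y) = y"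
  unfolding chart_image_def chart_inv_def by (auto intro: inv_into_into f_inv_into_f)

lemma chart_mem_image: "x \<in> fst c \<Longrightarrow> snd c x \<in> chart_image c"
  by (simp add: chart_image_def)

locale surface =
  fixes N :: "'a::t2_space set" and A :: "'a chart set" and x0 :: 'a
  assumes atlas: "smooth_atlas (top_of_set N) A"
    and connected_N: "connected N"
    and base: "x0 \<in> N"
begin

lemma chart: "c \<in> A \<Longrightarrow> is_chart (top_of_set N) c"
  using atlas by (simp add: smooth_atlas_def)

lemma chart_openin: "c \<in> A \<Longrightarrow> openin (top_of_set N) (fst c)"
  and chart_image_openin: "c \<in> A \<Longrightarrow> openin (top_of_set half_plane) (chart_image c)"
  using chart by (auto simp: is_chart_def)

lemma chart_subset: "c \<in> A \<Longrightarrow> fst c \<subseteq> N"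
  using chart_openin openin_imp_subset by blast

lemma chart_cover:
  assumes "x \<in> N"
  obtains c where "c \<in> A" "x \<in> fst c"
  using assms atlas by (auto simp: smooth_atlas_def)

lemma chart_homeomorphic:
  assumes "c \<in> A"
  shows "homeomorphic_map (top_of_set (fst c)) (top_of_set (chart_image c)) (snd c)"
proof -
  have "subtopology (top_of_set N) (fst c) = top_of_set (fst c)"
    using chart_subset[OF assms] by (simp add: subtopology_subtopology Int_absorb1)
  then show ?thesis using chart[OF assms] by (simp add: is_chart_def)
qed

lemma chart_inj: "c \<in> A \<Longrightarrow> inj_on (snd c) (fst c)"
  using homeomorphic_imp_injective_map[OF chart_homeomorphic] by simp

lemma chart_inv_chart: "c \<in> A \<Longrightarrow> x \<in> fst c \<Longrightarrow> chart_inv c (snd c x) = x"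
  by (simp add: chart_inv_def chart_inj)

lemma continuous_on_chart: "c \<in> A \<Longrightarrow> continuous_on (fst c) (snd c)"
  using homeomorphic_imp_continuous_map[OF chart_homeomorphic] by auto

lemma continuous_on_chart_inv:
  assumes c: "c \<in> A"
  shows "continuous_on (chart_image c) (chart_inv c)"
proof -
  obtain k where k: "homeomorphic_maps (top_of_set (fst c)) (top_of_set (chart_image c)) (snd c) k"
    using chart_homeomorphic[OF c] by (auto simp: homeomorphic_map_maps)
  have "continuous_on (chart_image c) k"
    using k by (auto simp: homeomorphic_maps_def)
  moreover have "k y = chart_inv c y" if "y \<in> chart_image c" for y
  proof -
    have "k (snd c (chart_inv c y)) = chart_inv c y"
      using k chart_inv_mem[OF that] by (auto simp: homeomorphic_maps_def)
    then show ?thesis using chart_of_chart_inv[OF that] by simp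
  qed
  ultimately show ?thesis by (simp cong: continuous_on_cong)
qed

lemma openin_chart_inv_image:
  assumes c: "c \<in> A" and U: "openin (top_of_set half_plane) U" "U \<subseteq> chart_image c"
  shows "openin (top_of_set N) (chart_inv c ` U)"
proof -
  have "chart_inv c ` U = fst c \<inter> snd c -` U"
  proof (intro equalityI subsetI)
    fix x assume "x \<in> chart_inv c ` U"
    with U(2) show "x \<in> fst c \<inter> snd c -` U"
      using chart_inv_mem[of _ c] chart_of_chart_inv[of _ c] by auto
  next
    fix x assume "x \<in> fst c \<inter> snd c -` U"
    then show "x \<in> chart_inv c ` U"
      using chart_inv_chart[OF c, of x] by (intro image_eqI[of _ _ "snd c x"]) auto
  qed
  moreover have "openin (top_of_set (chart_image c)) U"
    using openin_subset_trans[OF U openin_imp_subset[OF chart_image_openin[OF c]]] .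
  then have "openin (top_of_set (fst c)) (fst c \<inter> snd c -` U)"
    by (intro continuous_openin_preimage[OF continuous_on_chart[OF c]]) (auto simp: chart_mem_image)
  ultimately show ?thesis using openin_trans[OF _ chart_openin[OF c]] by simp
qed

lemma chart_neighbourhood:
  assumes c: "c \<in> A" and V: "openin (top_of_set N) V" and x: "x \<in> V" "x \<in> fst c"
  obtains r where "0 < r" "half_plane \<inter> ball (snd c x) r \<subseteq> chart_image c"
    "chart_inv c ` (half_plane \<inter> ball (snd c x) r) \<subseteq> V"
proof -
  let ?W = "chart_image c \<inter> chart_inv c -` (V \<inter> fst c)"
  have "openin (top_of_set (fst c)) (V \<inter> fst c)"
    by (rule openin_subset_trans[OF openin_Int[OF V chart_openin[OF c]] _ chart_subset[OF c]]) auto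
  then have "openin (top_of_set (chart_image c)) ?W"
    using chart_inv_mem[of _ c]
    by (intro continuous_openin_preimage[OF continuous_on_chart_inv[OF c]]) auto
  then have "openin (top_of_set half_plane) ?W"
    by (rule openin_trans[OF _ chart_image_openin[OF c]])
  then obtain T where T: "open T" "?W = half_plane \<inter> T" by (auto simp: openin_open)
  have "snd c x \<in> ?W" using x chart_mem_image[of x c] chart_inv_chart[OF c] by auto
  then obtain r where "0 < r" "ball (snd c x) r \<subseteq> T" using T open_contains_ball by blast
  with T that[of r] show thesis by blast
qed

text \<open>Neighbourhoods that correspond to convex subsets of a chart image are simply connected, so
  the cover is trivial above them.\<close>

definition convex_nhd :: "'a chart \<Rightarrow> 'a set \<Rightarrow> bool" where
  "convex_nhd c V \<longleftrightarrow> c \<in> A \<and>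
    (\<exists>U. convex U \<and> openin (top_of_set half_plane) U \<and> U \<subseteq> chart_image c \<and> V = chart_inv c ` U)"

text \<open>A disc intersected with the half plane is convex, which covers boundary points as
  well.\<close>

lemma convex_nhd_exists:
  assumes c: "c \<in> A" and V: "openin (top_of_set N) V" and x: "x \<in> V" "x \<in> fst c"
  obtains W where "convex_nhd c W" "x \<in> W" "W \<subseteq> V"
proof -
  obtain r where r: "0 < r" "half_plane \<inter> ball (snd c x) r \<subseteq> chart_image c"
    "chart_inv c ` (half_plane \<inter> ball (snd c x) r) \<subseteq> V"
    using chart_neighbourhood[OF assms] .
  have "convex half_plane"
    using convex_halfspace_ge[of 0 "axis 1 1 :: real^2"]
    by (simp add: half_plane_def inner_axis' )
  then have "convex (half_plane \<inter> ball (snd c x) r)" by (intro convex_Int) auto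
  moreover have "openin (top_of_set half_plane) (half_plane \<inter> ball (snd c x) r)"
    by (intro openin_open_Int) auto
  ultimately have "convex_nhd c (chart_inv c ` (half_plane \<inter> ball (snd c x) r))"
    unfolding convex_nhd_def using r c by blast
  moreover have "x \<in> chart_inv c ` (half_plane \<inter> ball (snd c x) r)"
  proof (rule image_eqI)
    show "x = chart_inv c (snd c x)" by (simp add: chart_inv_chart[OF c x(2)])
    show "snd c x \<in> half_plane \<inter> ball (snd c x) r"
      using r chart_mem_image[OF x(2)] openin_imp_subset[OF chart_image_openin[OF c]] by auto
  qed
  ultimately show thesis using that r(3) by blast
qed

lemma convex_nhd_openin: "convex_nhd c V \<Longrightarrow> openin (top_of_set N) V"
  unfolding convex_nhd_def using openin_chart_inv_image by blast

lemma convex_nhd_subset: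
  assumes "convex_nhd c V"
  shows "V \<subseteq> N" "V \<subseteq> fst c"
  using openin_imp_subset[OF convex_nhd_openin[OF assms]] assms chart_inv_mem
  unfolding convex_nhd_def by blast+

lemma convex_nhd_path:
  assumes V: "convex_nhd c V" and "x \<in> V" "y \<in> V"
  obtains q where "path q" "path_image q \<subseteq> V" "pathstart q = x" "pathfinish q = y"
proof -
  obtain U where U: "c \<in> A" "convex U" "U \<subseteq> chart_image c" "V = chart_inv c ` U"
    using V unfolding convex_nhd_def by blast
  obtain a b where ab: "a \<in> U" "b \<in> U" "x = chart_inv c a" "y = chart_inv c b"
    using assms U by blast
  have seg: "path_image (linepath a b) \<subseteq> U"
    using U(2) ab(1,2) by (simp add: closed_segment_subset)
  let ?q = "chart_inv c \<circ> linepath a b"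
  have "path ?q"
    using continuous_on_chart_inv[OF U(1)] seg U(3)
    by (intro path_continuous_image) (auto intro: continuous_on_subset)
  moreover have "path_image ?q \<subseteq> V" using seg U(4) by (auto simp: path_image_compose)
  ultimately show thesis using that[of ?q] ab by (simp add: pathstart_compose pathfinish_compose)
qed

text \<open>The straight-line homotopy in the convex coordinate set is carried back by the inverse
  chart.\<close>

lemma convex_nhd_homotopic:
  assumes V: "convex_nhd c V" and p: "path p" "path_image p \<subseteq> V" and q: "path q" "path_image q \<subseteq> V"
    and ends: "pathstart p = pathstart q" "pathfinish p = pathfinish q"
  shows "homotopic_paths N p q"
proof -
  obtain U where U: "c \<in> A" "convex U" "U \<subseteq> chart_image c" "V = chart_inv c ` U"
    using V unfolding convex_nhd_def by blast
  note Vc = convex_nhd_subset(2)[OF V] and VN = convex_nhd_subset(1)[OF V]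
  have snd_U: "snd c z \<in> U" if "z \<in> V" for z
    using that U chart_of_chart_inv[of _ c] by auto
  have path_snd: "path (snd c \<circ> r)" if "path r" "path_image r \<subseteq> V" for r
    using that continuous_on_chart[OF U(1)] Vc
    by (intro path_continuous_image) (auto intro: continuous_on_subset)
  have inU: "snd c (r t) \<in> U" if "path_image r \<subseteq> V" "t \<in> {0..1}" for r t
    using that snd_U[of "r t"] unfolding path_image_def by blast
  have "homotopic_paths U (snd c \<circ> p) (snd c \<circ> q)"
  proof (rule homotopic_paths_linear)
    show "closed_segment ((snd c \<circ> p) t) ((snd c \<circ> q) t) \<subseteq> U" if "t \<in> {0..1}" for t
      using inU[OF p(2) that] inU[OF q(2) that] U(2) by (simp add: closed_segment_subset)
  qed (use path_snd p q ends in \<open>auto simp: pathstart_compose pathfinish_compose\<close>)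
  then have h: "homotopic_paths N (chart_inv c \<circ> (snd c \<circ> p)) (chart_inv c \<circ> (snd c \<circ> q))"
    by (rule homotopic_paths_continuous_image)
       (use continuous_on_chart_inv[OF U(1)] U(3,4) VN in \<open>auto intro: continuous_on_subset\<close>)
  \<comment> \<open>Paths are functions on the whole real line, and the round trip through the chart
    returns \<open>r\<close> only on the unit interval; hence a homotopy instead of an
    equation.\<close>
  have eq: "homotopic_paths N r (chart_inv c \<circ> (snd c \<circ> r))" if "path r" "path_image r \<subseteq> V" for r
  proof (rule homotopic_paths_eq)
    show "r t = (chart_inv c \<circ> (snd c \<circ> r)) t" if "t \<in> {0..1}" for t
    proof -
      have "r t \<in> fst c" using that \<open>path_image r \<subseteq> V\<close> Vc unfolding path_image_def by blast
      then show ?thesis by (simp add: chart_inv_chart[OF U(1)])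
    qed
  qed (use that VN in auto)
  show ?thesis
    using homotopic_paths_trans[OF homotopic_paths_trans[OF eq[OF p] h]
        homotopic_paths_sym[OF eq[OF q]]] .
qed

lemma ucover_endpoint: "C \<in> ucover N x0 \<Longrightarrow> endpoint C \<in> N"
  using pathfinish_in_path_image by (auto elim!: ucoverE simp: subset_iff)

text \<open>Joinability by paths is an equivalence relation, and convex neighbourhoods make its
  classes open; connectedness leaves a single class.\<close>

lemma ucover_surj:
  assumes "x \<in> N"
  obtains C where "C \<in> ucover N x0" "endpoint C = x"
proof -
  let ?R = "\<lambda>x y. \<exists>p. path p \<and> path_image p \<subseteq> N \<and> pathstart p = x \<and> pathfinish p = y"
  have "?R x0 x"
  proof (rule connected_equivalence_relation[OF connected_N base assms, of ?R])
    fix x y assume "?R x y"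
    then obtain p where "path p \<and> path_image p \<subseteq> N \<and> pathstart p = x \<and> pathfinish p = y" ..
    then show "?R y x" by (intro exI[of _ "reversepath p"]) auto
  next
    fix x y z assume "?R x y" "?R y z"
    then obtain p q where
      "path p \<and> path_image p \<subseteq> N \<and> pathstart p = x \<and> pathfinish p = y"
      "path q \<and> path_image q \<subseteq> N \<and> pathstart q = y \<and> pathfinish q = z" by (elim exE)
    then show "?R x z" by (intro exI[of _ "p +++ q"]) (auto simp: path_image_join)
  next
    fix a assume a: "a \<in> N"
    then obtain c where c: "c \<in> A" "a \<in> fst c" by (rule chart_cover)
    obtain V where V: "convex_nhd c V" "a \<in> V" "V \<subseteq> fst c"
      using convex_nhd_exists[OF c(1) chart_openin[OF c(1)] c(2) c(2)] .
    have "?R a y" if y: "y \<in> V" for y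
    proof -
      obtain q where "path q" "path_image q \<subseteq> V" "pathstart q = a" "pathfinish q = y"
        using convex_nhd_path[OF V(1,2) y] .
      with convex_nhd_subset(1)[OF V(1)] show ?thesis by (intro exI[of _ q]) auto
    qed
    then show "\<exists>T. openin (top_of_set N) T \<and> a \<in> T \<and> (\<forall>y\<in>T. ?R a y)"
      using V(2) convex_nhd_openin[OF V(1)] by (intro exI[of _ V] conjI ballI)
  qed
  then obtain p where "path p" "path_image p \<subseteq> N" "pathstart p = x0" "pathfinish p = x"
    by (elim exE conjE)
  then show thesis using that[of "path_class N p"] by (simp add: ucoverI endpoint_path_class)
qed

lemma point_above: "x \<in> N \<Longrightarrow> point_above N x0 x \<in> ucover N x0 \<and> endpoint (point_above N x0 x) = x"
  unfolding point_above_def by (rule someI_ex) (elim ucover_surj, blast)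

text \<open>The sheet of the cover above \<open>V\<close> through the class of \<open>p\<close>. For
  a convex neighbourhood the choice of the path is immaterial by
  \<open>nhd_section_eq\<close>.\<close>

definition nhd_section :: "(real \<Rightarrow> 'a) \<Rightarrow> 'a set \<Rightarrow> 'a \<Rightarrow> 'a path_class" where
  "nhd_section p V y = path_class N (p +++ (SOME q. path q \<and> path_image q \<subseteq> V \<and>
     pathstart q = pathfinish p \<and> pathfinish q = y))"

lemma nhd_section_eq:
  assumes V: "convex_nhd c V" and p: "path p" "path_image p \<subseteq> N"
    and q: "path q" "path_image q \<subseteq> V" "pathstart q = pathfinish p"
  shows "nhd_section p V (pathfinish q) = path_class N (p +++ q)"
  unfolding nhd_section_def
proof (rule someI2[of _ q])
  fix r assume r: "path r \<and> path_image r \<subseteq> V \<and> pathstart r = pathfinish p \<and> pathfinish r = pathfinish q"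
  show "path_class N (p +++ r) = path_class N (p +++ q)"
    by (rule path_class_join_cong) (use convex_nhd_homotopic[OF V] p q r in auto)
qed (use q in auto)

lemma nhd_sectionE:
  assumes V: "convex_nhd c V" and p: "path p" "path_image p \<subseteq> N" "pathfinish p \<in> V" and y: "y \<in> V"
  obtains q where "path q" "path_image q \<subseteq> V" "pathstart q = pathfinish p" "pathfinish q = y"
    "nhd_section p V y = path_class N (p +++ q)"
    "path (p +++ q)" "path_image (p +++ q) \<subseteq> N" "pathfinish (p +++ q) = y"
proof -
  obtain q where q: "path q" "path_image q \<subseteq> V" "pathstart q = pathfinish p" "pathfinish q = y"
    using convex_nhd_path[OF V p(3) y] .
  show thesis
    by (rule that[of q])
       (use q p nhd_section_eq[OF V p(1,2) q(1-3)] convex_nhd_subset(1)[OF V] in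
        \<open>auto simp: path_image_join\<close>)
qed

lemma nhd_section_image:
  assumes V: "convex_nhd c V" and p: "path p" "path_image p \<subseteq> N" "pathfinish p \<in> V"
  shows "nhd_section p V ` V = continuations N p V"
proof
  show "nhd_section p V ` V \<subseteq> continuations N p V"
    by (auto elim!: nhd_sectionE[OF V p] intro: continuationsI)
  show "continuations N p V \<subseteq> nhd_section p V ` V"
  proof
    fix C assume "C \<in> continuations N p V"
    then obtain q where q: "path q" "path_image q \<subseteq> V" "pathstart q = pathfinish p"
      "C = path_class N (p +++ q)" by (rule continuationsE)
    then have "C = nhd_section p V (pathfinish q)" using nhd_section_eq[OF V p(1,2) q(1-3)] by simp
    moreover have "pathfinish q \<in> V" using q(2) pathfinish_in_path_image by blast
    ultimately show "C \<in> nhd_section p V ` V" by blast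
  qed
qed

lemma endpoint_nhd_section:
  assumes V: "convex_nhd c V" and p: "path p" "path_image p \<subseteq> N" "pathfinish p \<in> V" and y: "y \<in> V"
  shows "endpoint (nhd_section p V y) = y"
  by (rule nhd_sectionE[OF V p y]) (metis endpoint_path_class)

lemma nhd_section_ucover:
  assumes V: "convex_nhd c V" and p: "path p" "path_image p \<subseteq> N" "pathfinish p \<in> V"
    "pathstart p = x0" and y: "y \<in> V"
  shows "nhd_section p V y \<in> ucover N x0"
  by (rule nhd_sectionE[OF V p(1-3) y]) (simp add: ucoverI p(4))

lemma nhd_section_start:
  assumes V: "convex_nhd c V" and p: "path p" "path_image p \<subseteq> N" "pathfinish p \<in> V"
  shows "nhd_section p V (pathfinish p) = path_class N p"
proof -
  let ?q = "\<lambda>_::real. pathfinish p"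
  have "nhd_section p V (pathfinish ?q) = path_class N (p +++ ?q)"
    by (rule nhd_section_eq[OF V p(1,2)]) (use p(3) in \<open>auto simp: path_const path_image_def pathstart_def\<close>)
  also have "\<dots> = path_class N p" by (rule path_class_eq[OF homotopic_paths_const_right[OF p(1,2)]])
  finally show ?thesis by (simp add: pathfinish_def)
qed

text \<open>A neighbourhood of the value at \<open>y\<close> contains all continuations of
  \<open>p +++ q\<close> inside some \<open>V'\<close>. On a convex neighbourhood of
  \<open>y\<close> in \<open>V\<close> and \<open>V'\<close> the section takes only such values,
  because its points are reached from \<open>y\<close> without leaving it.\<close>

lemma continuous_nhd_section:
  assumes V: "convex_nhd c V" and p: "path p" "path_image p \<subseteq> N" "pathfinish p \<in> V"
    "pathstart p = x0"
  shows "continuous_map (top_of_set V) (ucover_topology N x0) (nhd_section p V)"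
  unfolding continuous_map_def topspace_ucover_topology
proof (intro conjI allI impI)
  show "nhd_section p V \<in> topspace (top_of_set V) \<rightarrow> ucover N x0"
    using nhd_section_ucover[OF V p] by auto
  fix W assume W: "openin (ucover_topology N x0) W"
  show "openin (top_of_set V) {y \<in> topspace (top_of_set V). nhd_section p V y \<in> W}"
  proof (subst openin_subopen, intro ballI)
    fix y assume "y \<in> {y \<in> topspace (top_of_set V). nhd_section p V y \<in> W}"
    then have y: "y \<in> V" "nhd_section p V y \<in> W" by auto
    obtain q where q: "path q" "path_image q \<subseteq> V" "pathstart q = pathfinish p" "pathfinish q = y"
      "nhd_section p V y = path_class N (p +++ q)"
      "path (p +++ q)" "path_image (p +++ q) \<subseteq> N" "pathfinish (p +++ q) = y"
      using nhd_sectionE[OF V p(1-3) y(1)] .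
    obtain V' where V': "openin (top_of_set N) V'" "y \<in> V'" "continuations N (p +++ q) V' \<subseteq> W"
      using ucover_topology_nhd[OF W q(6,7)] y(2) q by auto
    have c: "c \<in> A" using V by (simp add: convex_nhd_def)
    obtain V'' where V'': "convex_nhd c V''" "y \<in> V''" "V'' \<subseteq> V \<inter> V'"
      using convex_nhd_exists[OF c openin_Int[OF convex_nhd_openin[OF V] V'(1)], of y] y V'
        convex_nhd_subset(2)[OF V] by blast
    have "nhd_section p V z \<in> W" if z: "z \<in> V''" for z
    proof -
      obtain r where r: "path r" "path_image r \<subseteq> V''" "pathstart r = y" "pathfinish r = z"
        using convex_nhd_path[OF V''(1,2) z] .
      have rN: "path_image r \<subseteq> N" "path_image q \<subseteq> N"
        using r(2) q(2) V'' convex_nhd_subset(1)[OF V] by auto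
      have "nhd_section p V (pathfinish (q +++ r)) = path_class N (p +++ (q +++ r))"
        by (rule nhd_section_eq[OF V p(1,2)]) (use q r V'' in \<open>auto simp: path_image_join\<close>)
      also have "\<dots> = path_class N ((p +++ q) +++ r)"
        by (rule path_class_join_assoc) (use p q r rN in auto)
      also have "\<dots> \<in> continuations N (p +++ q) V'"
        by (rule continuationsI) (use r q V'' in auto)
      finally show ?thesis using V'(3) r(4) by auto
    qed
    moreover have "openin (top_of_set V) V''"
      using convex_nhd_openin[OF V''(1)] V''(3) convex_nhd_subset(1)[OF V] openin_subset_trans by blast
    ultimately show "\<exists>T. openin (top_of_set V) T \<and> y \<in> T \<and>
        T \<subseteq> {y \<in> topspace (top_of_set V). nhd_section p V y \<in> W}"
      using V'' by (intro exI[of _ V'']) auto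
  qed
qed

text \<open>Deck transformations carry sheets to sheets, by associativity of concatenation.\<close>

lemma class_join_nhd_section:
  assumes V: "convex_nhd c V" and p: "path p" "path_image p \<subseteq> N" "pathfinish p \<in> V"
    and l: "path l" "path_image l \<subseteq> N" "pathfinish l = pathstart p" and y: "y \<in> V"
  shows "class_join N (path_class N l) (nhd_section p V y) = nhd_section (l +++ p) V y"
proof -
  obtain q where q: "path q" "path_image q \<subseteq> V" "pathstart q = pathfinish p" "pathfinish q = y"
    "nhd_section p V y = path_class N (p +++ q)"
    "path (p +++ q)" "path_image (p +++ q) \<subseteq> N" "pathfinish (p +++ q) = y"
    using nhd_sectionE[OF V p y] .
  have "class_join N (path_class N l) (nhd_section p V y) = path_class N (l +++ (p +++ q))"
    unfolding q(5) by (rule class_join_path_class) (use l q in auto)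
  also have "\<dots> = path_class N ((l +++ p) +++ q)"
    by (rule path_class_join_assoc) (use l q p convex_nhd_subset(1)[OF V] in auto)
  also have "\<dots> = nhd_section (l +++ p) V (pathfinish q)"
    by (rule nhd_section_eq[OF V, symmetric]) (use l q p in \<open>auto simp: path_image_join\<close>)
  finally show ?thesis by (simp add: q)
qed

text \<open>The inverse of a lifted chart, on a coordinate set that may be smaller than the chart
  image. Openness of the image of \<open>s\<close> makes it the domain of such a chart, see
  \<open>local_section_chart\<close>.\<close>

definition local_section :: "'a chart \<Rightarrow> (real^2) set \<Rightarrow> (real^2 \<Rightarrow> 'a path_class) \<Rightarrow> bool" where
  "local_section c U s \<longleftrightarrow> c \<in> A \<and> openin (top_of_set half_plane) U \<and> U \<subseteq> chart_image c \<and>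
     (\<forall>y\<in>U. s y \<in> ucover N x0 \<and> endpoint (s y) = chart_inv c y) \<and>
     openin (ucover_topology N x0) (s ` U) \<and>
     continuous_map (top_of_set U) (ucover_topology N x0) s"

lemma local_section_cong:
  assumes s: "local_section c U s" and eq: "\<And>y. y \<in> U \<Longrightarrow> s' y = s y"
  shows "local_section c U s'"
proof -
  have "continuous_map (top_of_set U) (ucover_topology N x0) s'"
    using s eq unfolding local_section_def
    by (intro continuous_map_eq[of "top_of_set U" _ s s']) auto
  moreover have "s' ` U = s ` U" using eq by (rule image_cong[OF refl])
  ultimately show ?thesis using s eq unfolding local_section_def by simp
qed

lemma local_section_nhd_section:
  assumes c: "c \<in> A" and U: "convex U" "openin (top_of_set half_plane) U" "U \<subseteq> chart_image c"
    and p: "path p" "path_image p \<subseteq> N" "pathstart p = x0" "pathfinish p \<in> chart_inv c ` U"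
  shows "local_section c U (nhd_section p (chart_inv c ` U) \<circ> chart_inv c)"
proof -
  let ?V = "chart_inv c ` U"
  have V: "convex_nhd c ?V" unfolding convex_nhd_def using c U by blast
  show ?thesis
    unfolding local_section_def
  proof (intro conjI ballI)
    show "openin (ucover_topology N x0) ((nhd_section p ?V \<circ> chart_inv c) ` U)"
      unfolding image_comp[symmetric] nhd_section_image[OF V p(1,2,4)]
      by (rule openin_continuations[OF p(1-3) convex_nhd_openin[OF V] p(4)])
    show "continuous_map (top_of_set U) (ucover_topology N x0) (nhd_section p ?V \<circ> chart_inv c)"
      by (rule continuous_map_compose[OF _ continuous_nhd_section[OF V p(1,2,4,3)]])
         (use continuous_on_chart_inv[OF c] U(3) in \<open>auto intro: continuous_on_subset\<close>)
  qed (use c U nhd_section_ucover[OF V p(1,2,4,3)] endpoint_nhd_section[OF V p(1,2,4)] in auto)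
qed

text \<open>The section through \<open>C\<close> is the sheet of a representing path
  \<open>p\<close>; its translate by the class of a loop \<open>k\<close> is the sheet of
  \<open>k +++ p\<close> over the same \<open>U\<close>.\<close>

lemma local_section_exists:
  assumes C: "C \<in> ucover N x0" and c: "c \<in> A" "endpoint C \<in> fst c"
  obtains U s where "local_section c U s" "snd c (endpoint C) \<in> U" "s (snd c (endpoint C)) = C"
    "\<And>l. l \<in> loop_classes N x0 \<Longrightarrow> local_section c U (\<lambda>y. class_join N l (s y))"
proof -
  obtain p where p: "path p" "path_image p \<subseteq> N" "pathstart p = x0" "C = path_class N p"
    "endpoint C = pathfinish p" using C by (rule ucoverE)
  obtain V where V: "convex_nhd c V" "endpoint C \<in> V"
    using convex_nhd_exists[OF c(1) chart_openin[OF c(1)] c(2) c(2)] .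
  obtain U where U: "convex U" "openin (top_of_set half_plane) U" "U \<subseteq> chart_image c" "V = chart_inv c ` U"
    using V(1) unfolding convex_nhd_def by blast
  let ?s = "nhd_section p V \<circ> chart_inv c"
  show thesis
  proof (rule that[of U ?s])
    show "local_section c U ?s"
      unfolding U(4) by (rule local_section_nhd_section[OF c(1) U(1-3) p(1-3)]) (use p V U in auto)
    show "snd c (endpoint C) \<in> U" using V U chart_of_chart_inv[of _ c] by auto
    show "?s (snd c (endpoint C)) = C"
      using nhd_section_start[OF V(1) p(1,2)] V(2) p c chart_inv_chart by simp
  next
    fix l assume "l \<in> loop_classes N x0"
    then have l: "l \<in> ucover N x0" "endpoint l = x0" by (auto simp: loop_classes_def)
    obtain k where k: "path k" "path_image k \<subseteq> N" "pathstart k = x0" "l = path_class N k"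
      "endpoint l = pathfinish k" using l(1) by (rule ucoverE)
    have "local_section c U (nhd_section (k +++ p) V \<circ> chart_inv c)"
      unfolding U(4) by (rule local_section_nhd_section[OF c(1) U(1-3)])
        (use p V U k l in \<open>auto simp: path_image_join\<close>)
    moreover have "class_join N l (?s y) = (nhd_section (k +++ p) V \<circ> chart_inv c) y" if "y \<in> U" for y
      using class_join_nhd_section[OF V(1) p(1,2) _ k(1,2), of "chart_inv c y"] p k l V that U by auto
    ultimately show "local_section c U (\<lambda>y. class_join N l (?s y))"
      by (rule local_section_cong) simp
  qed
qed

end

text \<open>Derivatives within a chart image can therefore be computed within any smaller coordinate
  set around the point, one-sided derivatives at the boundary included.\<close>

lemma at_within_half_plane:
  assumes "openin (top_of_set half_plane) U" "U \<subseteq> M" "M \<subseteq> half_plane" "y \<in> U"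
  shows "at y within M = at y within U"
proof -
  obtain T where T: "open T" "U = half_plane \<inter> T" using assms(1) by (auto simp: openin_open)
  show ?thesis by (rule at_within_nhd[of y T]) (use assms T in auto)
qed

lemma fat_openin_half_plane: "openin (top_of_set half_plane) U \<Longrightarrow> fat U"
  using fat_Int_open[OF fat_half_plane] by (auto simp: openin_open)

text \<open>Loops act freely on the cover: appending the reverse of a representative of
  \<open>C\<close> recovers the loop.\<close>

lemma class_join_cancel:
  assumes l: "l \<in> loop_classes S b" and m: "m \<in> loop_classes S b" and C: "C \<in> ucover S b"
    and eq: "class_join S l C = class_join S m C"
  shows "l = m"
proof -
  obtain p where p: "path p" "path_image p \<subseteq> S" "pathstart p = b" "C = path_class S p"
    "endpoint C = pathfinish p" using C by (rule ucoverE)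
  let ?rp = "path_class S (reversepath p)"
  have *: "class_join S (class_join S l C) ?rp = l" if l: "l \<in> loop_classes S b" for l
  proof -
    from l have l': "l \<in> ucover S b" "endpoint l = b" by (auto simp: loop_classes_def)
    obtain k where k: "path k" "path_image k \<subseteq> S" "pathstart k = b" "l = path_class S k"
      "endpoint l = pathfinish k" using l'(1) by (rule ucoverE)
    have kb: "pathfinish k = b" using k l' by simp
    have "class_join S (class_join S l C) ?rp = path_class S ((k +++ p) +++ reversepath p)"
      using k p kb by (simp add: class_join_path_class path_image_join)
    also have "\<dots> = path_class S (k +++ (p +++ reversepath p))"
      by (rule path_class_join_assoc[symmetric]) (use k p kb in auto)
    also have "\<dots> = path_class S (k +++ (\<lambda>_. pathfinish k))"
      using homotopic_paths_reversepath_left[of "reversepath p" S] k p kb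
      by (intro path_class_join_cong) auto
    also have "\<dots> = l"
      using path_class_eq[OF homotopic_paths_const_right[OF k(1,2)]] k(4) by simp
    finally show ?thesis .
  qed
  have "l = class_join S (class_join S m C) ?rp" by (rule *[OF l, unfolded eq, symmetric])
  also have "\<dots> = m" by (rule *[OF m])
  finally show ?thesis .
qed

lemma dwithin_axis_expansion:
  fixes f :: "real^2 \<Rightarrow> 'f::euclidean_space"
  assumes "smooth_on S f" "x \<in> S"
  shows "dwithin S f x v = (\<Sum>i\<in>UNIV. v $ i *\<^sub>R dwithin S f x (axis i 1))"
proof -
  have lin: "linear (dwithin S f x)"
    using smooth_on_has_derivative[OF assms] has_derivative_linear by blast
  have "v = (\<Sum>i\<in>UNIV. v $ i *\<^sub>R axis i 1)"
    using basis_expansion[of v] by (simp add: scalar_mult_eq_scaleR)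
  then have "dwithin S f x v = dwithin S f x (\<Sum>i\<in>UNIV. v $ i *\<^sub>R axis i 1)" by simp
  also have "\<dots> = (\<Sum>i\<in>UNIV. v $ i *\<^sub>R dwithin S f x (axis i 1))"
    by (simp add: linear_sum[OF lin] linear_scale[OF lin])
  finally show ?thesis .
qed

context surface
begin

lemma chart_image_half_plane: "c \<in> A \<Longrightarrow> chart_image c \<subseteq> half_plane"
  using chart_image_openin openin_imp_subset by blast

section \<open>Derivatives along local sections\<close>

lemma local_sectionD:
  assumes "local_section c U s"
  shows "c \<in> A" "openin (top_of_set half_plane) U" "U \<subseteq> chart_image c"
    "\<And>y. y \<in> U \<Longrightarrow> s y \<in> ucover N x0" "\<And>y. y \<in> U \<Longrightarrow> endpoint (s y) = chart_inv c y"
    "openin (ucover_topology N x0) (s ` U)"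
    "continuous_map (top_of_set U) (ucover_topology N x0) s"
    "fat U" "U \<subseteq> half_plane" "\<And>y. y \<in> U \<Longrightarrow> snd c (endpoint (s y)) = y"
    "\<And>y. y \<in> U \<Longrightarrow> chart_inv c y \<in> fst c"
proof -
  note * = assms[unfolded local_section_def]
  show "c \<in> A" "openin (top_of_set half_plane) U" "U \<subseteq> chart_image c"
    "\<And>y. y \<in> U \<Longrightarrow> s y \<in> ucover N x0" "\<And>y. y \<in> U \<Longrightarrow> endpoint (s y) = chart_inv c y"
    "openin (ucover_topology N x0) (s ` U)"
    "continuous_map (top_of_set U) (ucover_topology N x0) s" using * by auto
  then show "fat U" "U \<subseteq> half_plane"
    using fat_openin_half_plane openin_imp_subset by blast+
  show "snd c (endpoint (s y)) = y" "chart_inv c y \<in> fst c" if "y \<in> U" for y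
    using * that chart_of_chart_inv[of y c] chart_inv_mem[of y c] by auto
qed

lemma local_section_chart:
  assumes s: "local_section c U s"
  defines "d \<equiv> (s ` U, snd c \<circ> endpoint)"
  shows "d \<in> lifted_charts N x0 c" "chart_image d = U" "\<And>y. y \<in> U \<Longrightarrow> chart_inv d y = s y"
proof -
  note sD = local_sectionD[OF s]
  have inj: "inj_on endpoint (s ` U)"
  proof (rule inj_onI)
    fix C D assume C: "C \<in> s ` U" and D: "D \<in> s ` U" and eq: "endpoint C = endpoint D"
    obtain y z where "y \<in> U" "C = s y" "z \<in> U" "D = s z" using C D by blast
    with sD(10)[of y] sD(10)[of z] eq show "C = D" by metis
  qed
  have "endpoint ` s ` U \<subseteq> fst c" using sD(5,11) by auto
  then show "d \<in> lifted_charts N x0 c" unfolding lifted_charts_def d_def using sD(6) inj by blast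
  show "chart_image d = U" unfolding chart_image_def d_def using sD(10) by (auto simp: image_iff)
  show "chart_inv d y = s y" if "y \<in> U" for y
    unfolding chart_inv_def d_def
    by (rule inv_into_f_eq) (use that sD(10) in \<open>auto intro!: inj_onI\<close>)
qed

text \<open>Smoothness on the cover tested on local sections. They invert charts of
  \<open>ucover_atlas\<close>, so \<open>smooth_fun\<close> implies it, and later arguments stay in
  coordinates.\<close>

definition section_smooth :: "('a path_class \<Rightarrow> 'f::real_normed_vector) \<Rightarrow> bool" where
  "section_smooth F \<longleftrightarrow> (\<forall>c U s. local_section c U s \<longrightarrow> smooth_on U (\<lambda>y. F (s y)))"

lemma smooth_on_section: "local_section c U s \<Longrightarrow> section_smooth F \<Longrightarrow> smooth_on U (\<lambda>y. F (s y))"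
  unfolding section_smooth_def by blast

lemma section_smooth_if_smooth_fun:
  assumes F: "smooth_fun (ucover_atlas N x0 A) F"
  shows "section_smooth F"
  unfolding section_smooth_def
proof (intro allI impI)
  fix c U s assume s: "local_section c U s"
  let ?d = "(s ` U, snd c \<circ> endpoint)"
  note sD = local_sectionD[OF s] and ch = local_section_chart[OF s]
  have "?d \<in> ucover_atlas N x0 A"
    unfolding ucover_atlas_def using ch(1) sD(1) by blast
  then have "smooth_on U (F \<circ> chart_inv ?d)"
    using F ch(2) unfolding smooth_fun_def by metis
  then show "smooth_on U (\<lambda>y. F (s y))" by (rule smooth_on_cong) (simp add: ch(3))
qed

lemma pderiv_chart_section:
  fixes F :: "'a \<Rightarrow> 'f::euclidean_space"
  assumes U: "c \<in> A" "openin (top_of_set half_plane) U" "U \<subseteq> chart_image c" "y \<in> U"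
    and F: "\<And>z. z \<in> U \<Longrightarrow> F (chart_inv c z) = f z"
  shows "pderiv_chart c i F (chart_inv c y) = dwithin U f y (axis i 1)"
proof -
  have "at y within chart_image c = at y within U"
    by (rule at_within_half_plane[OF U(2,3) chart_image_half_plane[OF U(1)] U(4)])
  then have "pderiv_chart c i F (chart_inv c y) = dwithin U (F \<circ> chart_inv c) y (axis i 1)"
    using U by (simp add: pderiv_chart_def dwithin_def chart_of_chart_inv subsetD)
  also have "dwithin U (F \<circ> chart_inv c) y = dwithin U f y"
    by (rule dwithin_cong) (use F U in auto)
  finally show ?thesis .
qed

text \<open>The definition picks some lifted chart around the point. Its inverse agrees with
  \<open>s\<close> wherever \<open>s\<close> takes values in the domain of that chart, as both
  invert the same coordinates; by continuity of \<open>s\<close> this is a neighbourhood of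
  \<open>y\<close>, which is all a derivative needs.\<close>

lemma pderiv_ucover_section:
  fixes F :: "'a path_class \<Rightarrow> 'f::euclidean_space"
  assumes s: "local_section c U s" and y: "y \<in> U"
  shows "pderiv_ucover N x0 c i F (s y) = dwithin U (\<lambda>z. F (s z)) y (axis i 1)"
proof -
  note sD = local_sectionD[OF s]
  define d where "d = (SOME d. d \<in> lifted_charts N x0 c \<and> s y \<in> fst d)"
  have "\<exists>d. d \<in> lifted_charts N x0 c \<and> s y \<in> fst d"
    using local_section_chart(1)[OF s] y by (intro exI[of _ "(s ` U, snd c \<circ> endpoint)"]) auto
  then have "d \<in> lifted_charts N x0 c \<and> s y \<in> fst d" unfolding d_def by (rule someI_ex)
  then obtain W where W: "d = (W, snd c \<circ> endpoint)" "openin (ucover_topology N x0) W"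
      "endpoint ` W \<subseteq> fst c" "inj_on endpoint W" "s y \<in> W"
    unfolding lifted_charts_def by auto
  let ?U = "{z \<in> U. s z \<in> W}"
  have U': "openin (top_of_set U) ?U"
    using sD(7) W(2) unfolding continuous_map_def by simp
  then have U'h: "openin (top_of_set half_plane) ?U" using openin_trans sD(2) by blast
  have sub: "?U \<subseteq> chart_image d"
    unfolding chart_image_def W(1) using sD(10) by (auto simp: image_iff) metis
  have "chart_image d \<subseteq> chart_image c"
    unfolding chart_image_def W(1) using W(3) by auto
  then have sub': "chart_image d \<subseteq> half_plane" using chart_image_half_plane[OF sD(1)] by blast
  have yU': "y \<in> ?U" using y W by simp
  have inj: "inj_on (snd c \<circ> endpoint) W"
    using W(3,4) chart_inj[OF sD(1)] by (auto intro: comp_inj_on inj_on_subset)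
  have inv: "chart_inv d z = s z" if "z \<in> ?U" for z
    unfolding chart_inv_def W(1) by (rule inv_into_f_eq) (use that sD(10) inj in auto)
  have "at y within chart_image d = at y within ?U"
    by (rule at_within_half_plane[OF U'h sub sub' yU'])
  moreover have "at y within U = at y within ?U"
    by (rule at_within_half_plane[OF U'h _ sD(9) yU']) auto
  ultimately have at: "at y within chart_image d = at y within U" by simp
  have "pderiv_ucover N x0 c i F (s y)
      = frechet_derivative (F \<circ> chart_inv d) (at y within chart_image d) (axis i 1)"
    unfolding pderiv_ucover_def d_def[symmetric] pderiv_chart_def using W(1) sD(10)[OF y] by simp
  also have "frechet_derivative (F \<circ> chart_inv d) (at y within chart_image d)
      = dwithin ?U (F \<circ> chart_inv d) y"
    unfolding dwithin_def using at_within_half_plane[OF U'h sub sub' yU'] by simp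
  also have "\<dots> = dwithin ?U (\<lambda>z. F (s z)) y"
    by (rule dwithin_cong[OF _ yU']) (simp add: inv)
  also have "\<dots> = dwithin U (\<lambda>z. F (s z)) y"
    unfolding dwithin_def using at_within_half_plane[OF U'h _ sD(9) yU'] by simp
  finally show ?thesis .
qed

text \<open>Fields are evaluated at \<open>point_above\<close>, an arbitrary point of the fibre.
  Closure under loops provides a section through that point over the same \<open>U\<close>.\<close>

definition regular_section :: "'a chart \<Rightarrow> (real^2) set \<Rightarrow> (real^2 \<Rightarrow> 'a path_class) \<Rightarrow> bool" where
  "regular_section c U s \<longleftrightarrow>
     local_section c U s \<and> (\<forall>l\<in>loop_classes N x0. local_section c U (\<lambda>y. class_join N l (s y)))"

lemma regular_section_exists:
  assumes "C \<in> ucover N x0" "c \<in> A" "endpoint C \<in> fst c"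
  obtains U s y where "regular_section c U s" "y = snd c (endpoint C)" "y \<in> U" "s y = C"
  using local_section_exists[OF assms] unfolding regular_section_def by metis

lemma section_over:
  assumes "c \<in> A" "x \<in> fst c"
  obtains U s where "regular_section c U s" "snd c x \<in> U" "s (snd c x) = point_above N x0 x"
proof -
  have "x \<in> N" using assms chart_subset by blast
  then have "point_above N x0 x \<in> ucover N x0" "endpoint (point_above N x0 x) = x"
    using point_above by auto
  with regular_section_exists[OF this(1) assms(1)] assms(2) that show thesis by metis
qed

lemma section_factor:
  assumes s: "local_section c U s" and C: "C \<in> s ` U"
  shows "snd c (endpoint C) \<in> U" "s (snd c (endpoint C)) = C"
  using C local_sectionD(10)[OF s] by auto

lemma jacobian_section:
  assumes c: "c \<in> A" and d: "d \<in> A"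
    and U: "openin (top_of_set half_plane) U" "U \<subseteq> snd c ` (fst c \<inter> fst d)" "y \<in> U"
  shows "jacobian c d (chart_inv c y) $ j $ i = dwithin U (\<lambda>z. snd d (chart_inv c z)) y (axis i 1) $ j"
proof -
  have sub: "U \<subseteq> chart_image c" using U(2) by (auto simp: chart_image_def)
  have fat: "fat U" by (rule fat_openin_half_plane[OF U(1)])
  have sm: "smooth_on U (\<lambda>z. snd d (chart_inv c z))"
    using atlas c d U(2) unfolding smooth_atlas_def comp_def by (blast intro: smooth_on_subset)
  have "jacobian c d (chart_inv c y) $ j $ i
      = dwithin U (\<lambda>z. snd d (chart_inv c z) $ j) y (axis i 1)"
    unfolding jacobian_def by (simp add: pderiv_chart_section[OF c U(1) sub U(3)])
  also have "dwithin U (\<lambda>z. snd d (chart_inv c z) $ j) y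
      = (\<lambda>v. dwithin U (\<lambda>z. snd d (chart_inv c z)) y v $ j)"
    by (rule dwithin_unique[OF fat U(3)
          bounded_linear.has_derivative[OF bounded_linear_vec_nth smooth_on_has_derivative[OF sm U(3)]]])
  finally show ?thesis by simp
qed

text \<open>Chain rule for a change of coordinates: near the point the two sections lie on one
  sheet, so one is the other composed with the transition map of the base charts.\<close>

lemma pderiv_ucover_change:
  fixes H :: "'a path_class \<Rightarrow> 'f::euclidean_space"
  assumes H: "section_smooth H" and c: "c \<in> A" and d: "d \<in> A"
    and C: "C \<in> ucover N x0" "endpoint C \<in> fst c" "endpoint C \<in> fst d"
  shows "pderiv_ucover N x0 c i H C
    = (\<Sum>j\<in>UNIV. (jacobian c d (endpoint C) $ j $ i) *\<^sub>R pderiv_ucover N x0 d j H C)"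
proof -
  obtain U s y where s: "regular_section c U s" "y = snd c (endpoint C)" "y \<in> U" "s y = C"
    using regular_section_exists[OF C(1) c C(2)] .
  obtain V t z where t: "regular_section d V t" "z = snd d (endpoint C)" "z \<in> V" "t z = C"
    using regular_section_exists[OF C(1) d C(3)] .
  have sl: "local_section c U s" and tl: "local_section d V t"
    using s t by (auto simp: regular_section_def)
  note sD = local_sectionD[OF sl] and tD = local_sectionD[OF tl]
  let ?U = "{x \<in> U. s x \<in> t ` V}" and ?\<phi> = "\<lambda>x. snd d (chart_inv c x)"
  have "openin (top_of_set U) ?U"
    using sD(7) tD(6) unfolding continuous_map_def by simp
  then have U': "openin (top_of_set half_plane) ?U" using openin_trans sD(2) by blast
  have yU: "y \<in> ?U" using s t by auto
  have chi: "chart_inv c x \<in> fst c \<inter> fst d" "snd c (chart_inv c x) = x" if x: "x \<in> ?U" for x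
  proof -
    obtain w where w: "w \<in> V" "s x = t w" using x by blast
    then show "chart_inv c x \<in> fst c \<inter> fst d"
      using x sD(5,11)[of x] tD(5,11)[OF w(1)] by auto
    show "snd c (chart_inv c x) = x" using x sD(5,10)[of x] by simp
  qed
  then have sub: "?U \<subseteq> snd c ` (fst c \<inter> fst d)" by (metis (no_types, lifting) image_eqI subsetI)
  have fat: "fat ?U" by (rule fat_openin_half_plane[OF U'])
  have sm: "smooth_on ?U ?\<phi>"
    using atlas c d sub unfolding smooth_atlas_def comp_def by (blast intro: smooth_on_subset)
  have \<phi>: "?\<phi> x \<in> V" "t (?\<phi> x) = s x" if "x \<in> ?U" for x
    using section_factor[OF tl, of "s x"] that sD(5)[of x] by auto
  have "pderiv_ucover N x0 c i H C = dwithin U (\<lambda>x. H (s x)) y (axis i 1)"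
    using pderiv_ucover_section[OF sl s(3)] s(4) by metis
  also have "dwithin U (\<lambda>x. H (s x)) y = dwithin ?U (\<lambda>x. H (s x)) y"
    unfolding dwithin_def using at_within_half_plane[OF U' _ sD(9) yU] by auto
  also have "\<dots> = dwithin ?U (\<lambda>x. H (t (?\<phi> x))) y"
    by (rule dwithin_cong[OF _ yU]) (use \<phi> in auto)
  also have "\<dots> (axis i 1) = dwithin V (\<lambda>x. H (t x)) (?\<phi> y) (dwithin ?U ?\<phi> y (axis i 1))"
    by (rule dwithin_chain[OF fat yU smooth_on_has_derivative[OF sm yU] \<phi>(1)
          smooth_on_section[OF tl H]])
  also have "?\<phi> y = z"
    using t(2) s(2) chart_inv_chart[OF c C(2)] by simp
  also have "dwithin V (\<lambda>x. H (t x)) z (dwithin ?U ?\<phi> y (axis i 1))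
      = (\<Sum>j\<in>UNIV. (dwithin ?U ?\<phi> y (axis i 1) $ j) *\<^sub>R dwithin V (\<lambda>x. H (t x)) z (axis j 1))"
    by (rule dwithin_axis_expansion[OF smooth_on_section[OF tl H] t(3)])
  also have "\<dots> = (\<Sum>j\<in>UNIV. (jacobian c d (endpoint C) $ j $ i) *\<^sub>R pderiv_ucover N x0 d j H C)"
  proof (rule sum.cong[OF refl])
    fix j
    have "pderiv_ucover N x0 d j H C = dwithin V (\<lambda>x. H (t x)) z (axis j 1)"
      using pderiv_ucover_section[OF tl t(3)] t(4) by metis
    moreover have "jacobian c d (endpoint C) $ j $ i = dwithin ?U ?\<phi> y (axis i 1) $ j"
      using jacobian_section[OF c d U' sub yU, of j i] s(2) chart_inv_chart[OF c C(2)] by simp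
    ultimately show "(dwithin ?U ?\<phi> y (axis i 1) $ j) *\<^sub>R dwithin V (\<lambda>x. H (t x)) z (axis j 1)
      = (jacobian c d (endpoint C) $ j $ i) *\<^sub>R pderiv_ucover N x0 d j H C" by simp
  qed
  finally show ?thesis .
qed

end

locale bordered_surface = surface N A x0
  for N :: "'a::t2_space set" and A :: "'a chart set" and x0 :: 'a +
  fixes L :: "'l set" and \<sigma> :: "'l \<Rightarrow> real \<Rightarrow> 'a" and \<alpha> :: "'l \<Rightarrow> real \<Rightarrow> 'a path_class"
  assumes circles: "boundary_circles A L \<sigma>" and families: "boundary_families N x0 L \<sigma> \<alpha>"
begin

lemma family:
  assumes "l \<in> L"
  shows "continuous_map euclideanreal (ucover_topology N x0) (\<alpha> l)" "endpoint (\<alpha> l t) = \<sigma> l t"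
    "\<alpha> l t \<in> ucover N x0"
proof -
  show *: "continuous_map euclideanreal (ucover_topology N x0) (\<alpha> l)" "endpoint (\<alpha> l t) = \<sigma> l t"
    using families assms by (auto simp: boundary_families_def)
  then show "\<alpha> l t \<in> ucover N x0"
    using topspace_ucover_topology[of N x0] by (auto simp: continuous_map_def)
qed

lemma open_family_preimage:
  assumes "l \<in> L" "openin (ucover_topology N x0) W"
  shows "open {t. \<alpha> l t \<in> W}"
  using family(1)[OF assms(1)] assms(2) by (simp add: continuous_map_def)

text \<open>The image of a section is open in the cover and the family is continuous, so near
  \<open>t0\<close> the family stays on one sheet and is determined by its projection to the
  circle.\<close>

lemma boundary_section:
  assumes l: "l \<in> L" and c: "c \<in> A" "\<sigma> l t0 \<in> fst c"
  obtains U s W where "regular_section c U s" "open W" "t0 \<in> W"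
    "\<And>t. t \<in> W \<Longrightarrow> snd c (\<sigma> l t) \<in> U" "\<And>t. t \<in> W \<Longrightarrow> \<alpha> l t = s (snd c (\<sigma> l t))"
    "smooth_on W (\<lambda>t. snd c (\<sigma> l t))"
proof -
  obtain U s y where s: "regular_section c U s" "y = snd c (endpoint (\<alpha> l t0))" "y \<in> U" "s y = \<alpha> l t0"
    using regular_section_exists[OF family(3)[OF l] c(1)] c(2) family(2)[OF l] by metis
  then have sl: "local_section c U s" by (simp add: regular_section_def)
  let ?W = "{t. \<alpha> l t \<in> s ` U}"
  have W: "snd c (\<sigma> l t) \<in> U" "\<alpha> l t = s (snd c (\<sigma> l t))" "\<sigma> l t \<in> fst c" if "t \<in> ?W" for t
    using section_factor[OF sl, of "\<alpha> l t"] that family(2)[OF l]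
      local_sectionD(5,11)[OF sl, of "snd c (\<sigma> l t)"] by auto
  have "smooth_on {t. \<sigma> l t \<in> fst c} (snd c \<circ> \<sigma> l)"
    using circles l c(1) unfolding boundary_circles_def by blast
  moreover have "?W \<subseteq> {t. \<sigma> l t \<in> fst c}" using W(3) by blast
  ultimately have sm: "smooth_on ?W (\<lambda>t. snd c (\<sigma> l t))"
    unfolding comp_def by (rule smooth_on_subset)
  have "t0 \<in> ?W" using s(3,4) by auto
  then show thesis
    by (rule that[OF s(1) open_family_preimage[OF l local_sectionD(6)[OF sl]] _ W(1,2) sm])
qed

text \<open>Both points lie in one fibre, so a loop depending on \<open>t\<close> relates them. It
  is locally constant, since translated sheets are open and loops act freely, and hence constant on
  the connected real line.\<close>

lemma family_periodic:
  assumes l: "l \<in> L"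
  obtains m where "m \<in> loop_classes N x0" "\<And>t. \<alpha> l (t + 2 * pi) = class_join N m (\<alpha> l t)"
proof -
  have per: "\<sigma> l (t + 2 * pi) = \<sigma> l t" for t
    using circles l unfolding boundary_circles_def by blast
  have ex: "\<exists>m. m \<in> loop_classes N x0 \<and> \<alpha> l (t + 2 * pi) = class_join N m (\<alpha> l t)" for t
    by (rule ucover_fibre[OF family(3)[OF l, of t] family(3)[OF l, of "t + 2 * pi"]])
       (use per family(2)[OF l] in auto)
  define m where "m = (\<lambda>t. SOME m. m \<in> loop_classes N x0 \<and> \<alpha> l (t + 2 * pi) = class_join N m (\<alpha> l t))"
  have m: "m t \<in> loop_classes N x0" "\<alpha> l (t + 2 * pi) = class_join N (m t) (\<alpha> l t)" for t
    using someI_ex[OF ex[of t]] unfolding m_def by auto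
  have loc: "\<forall>\<^sub>F t in at t0. m t0 = m t" for t0
  proof -
    have "\<sigma> l t0 \<in> N" using family(2)[OF l, of t0] ucover_endpoint[OF family(3)[OF l]] by metis
    then obtain c where c: "c \<in> A" "\<sigma> l t0 \<in> fst c" by (rule chart_cover)
    obtain U s W where s: "regular_section c U s" "open W" "t0 \<in> W"
      "\<And>t. t \<in> W \<Longrightarrow> snd c (\<sigma> l t) \<in> U" "\<And>t. t \<in> W \<Longrightarrow> \<alpha> l t = s (snd c (\<sigma> l t))"
      using boundary_section[OF l c] by metis
    let ?s = "\<lambda>y. class_join N (m t0) (s y)"
    have s': "local_section c U ?s" using s(1) m(1) by (simp add: regular_section_def)
    let ?V = "W \<inter> (\<lambda>t. t + 2 * pi) -` {t. \<alpha> l t \<in> ?s ` U}"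
    have "open ?V"
      by (intro open_Int s(2) continuous_open_vimage
          open_family_preimage[OF l local_sectionD(6)[OF s']] continuous_intros)
    moreover have "t0 \<in> ?V" using s(3,4,5) m(2)[of t0] by auto
    moreover have "m t0 = m t" if t: "t \<in> ?V" for t
    proof -
      have "\<alpha> l (t + 2 * pi) = ?s (snd c (\<sigma> l t))"
        using section_factor(2)[OF s', of "\<alpha> l (t + 2 * pi)"] t family(2)[OF l] per by auto
      also have "\<dots> = class_join N (m t0) (\<alpha> l t)" using s(5) t by auto
      finally show ?thesis
        using class_join_cancel[OF m(1) m(1) family(3)[OF l], of t0 t] m(2)[of t] by simp
    qed
    ultimately show ?thesis unfolding eventually_at_topological by blast
  qed
  have const: "m t = m 0" for t
    by (rule connected_local_const[of UNIV]) (use loc in auto)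
  show thesis
    by (rule that[of "m 0"]) (use m const in metis)+
qed

end

section \<open>Fields of a pair of potentials\<close>

lemma rot_form_cong:
  assumes "\<And>y. y \<in> S \<Longrightarrow> h y = k y" "x \<in> S"
  shows "rot_form S h v x = rot_form S k v x"
  using assms dwithin_cong[of S h k x] by (simp add: rot_form_def)

lemma trans_form_cong:
  assumes "\<And>y. y \<in> S \<Longrightarrow> h y = k y" "\<And>y. y \<in> S \<Longrightarrow> F y = E y" "x \<in> S"
  shows "trans_form S h F v x = trans_form S k E v x"
  using assms dwithin_cong[of S F E x] by (simp add: trans_form_def)

lemma matrix_sum_scaleR_right:
  fixes A :: mat2 and B :: "'i \<Rightarrow> mat2"
  shows "A ** (\<Sum>j\<in>I. r j *\<^sub>R B j) = (\<Sum>j\<in>I. r j *\<^sub>R (A ** B j))"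
  using bounded_bilinear.sum_right[OF bounded_bilinear_matrix_mult, of A "\<lambda>j. r j *\<^sub>R B j" I]
  by (simp add: bounded_bilinear.scaleR_right[OF bounded_bilinear_matrix_mult])

lemma matrix_sum_scaleR_left:
  fixes A :: mat2 and B :: "'i \<Rightarrow> mat2"
  shows "(\<Sum>j\<in>I. r j *\<^sub>R B j) ** A = (\<Sum>j\<in>I. r j *\<^sub>R (B j ** A))"
  using bounded_bilinear.sum_left[OF bounded_bilinear_matrix_mult, of "\<lambda>j. r j *\<^sub>R B j" I A]
  by (simp add: bounded_bilinear.scaleR_left[OF bounded_bilinear_matrix_mult])

lemma rot_form_axis_expansion:
  fixes h :: "real^2 \<Rightarrow> mat2"
  assumes "smooth_on S h" "x \<in> S"
  shows "rot_form S h v x = (\<Sum>i\<in>UNIV. v $ i *\<^sub>R rot_form S h (axis i 1) x)"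
  unfolding rot_form_def
  by (subst dwithin_axis_expansion[OF assms]) (simp_all add: matrix_sum_scaleR_right)

lemma trans_form_axis_expansion:
  fixes h :: "real^2 \<Rightarrow> mat2"
  assumes "smooth_on S F" "x \<in> S"
  shows "trans_form S h F v x = (\<Sum>i\<in>UNIV. v $ i *\<^sub>R trans_form S h F (axis i 1) x)"
  unfolding trans_form_def
  by (subst dwithin_axis_expansion[OF assms])
     (simp_all add: matrix_sum_scaleR_right matrix_sum_scaleR_left)

context bordered_surface
begin

text \<open>The fields of a configuration in terms of matrix-valued potentials. The interpolating
  family is constructed only at this level, without lifts to the covering group.\<close>

definition potential_fields ::
  "('a path_class \<Rightarrow> mat2) \<Rightarrow> ('a path_class \<Rightarrow> mat2) \<Rightarrow> ('l \<Rightarrow> mat2) \<Rightarrow> ('l \<Rightarrow> mat2) \<Rightarrow>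
   ('a, 'l) fields" where
  "potential_fields G F b c =
     \<lparr>om = (\<lambda>k i x. let C = point_above N x0 x in
         matrix_inv (G C) ** pderiv_ucover N x0 k i G C),
      ga = (\<lambda>k i x. let C = point_above N x0 x in
         matrix_inv (G C) ** pderiv_ucover N x0 k i F C ** G C),
      bu = (\<lambda>l t. matrix_inv (b l) ** G (\<alpha> l t)),
      bv = (\<lambda>l t. matrix_inv (b l) ** (F (\<alpha> l t) - c l) ** b l)\<rparr>"

text \<open>\<open>M\<close> and \<open>X\<close> are the two components of the quasiperiodicity factors.\<close>

definition potential ::
  "('a path_class \<Rightarrow> mat2) \<Rightarrow> ('a path_class \<Rightarrow> mat2) \<Rightarrow>
   ('a path_class \<Rightarrow> mat2) \<Rightarrow> ('a path_class \<Rightarrow> mat2) \<Rightarrow> bool" where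
  "potential M X G F \<longleftrightarrow>
     section_smooth G \<and> section_smooth F \<and>
     (\<forall>C\<in>ucover N x0. G C \<in> SL2 \<and> F C \<in> sl2) \<and>
     (\<forall>l\<in>loop_classes N x0. M l \<in> SL2 \<and> X l \<in> sl2 \<and>
        (\<forall>C\<in>ucover N x0. G (class_join N l C) = M l ** G C \<and>
           F (class_join N l C) = X l + M l ** F C ** adj (M l)))"

lemma potentialD:
  assumes "potential M X G F"
  shows "section_smooth G" "section_smooth F"
    "\<And>C. C \<in> ucover N x0 \<Longrightarrow> G C \<in> SL2" "\<And>C. C \<in> ucover N x0 \<Longrightarrow> F C \<in> sl2"
    "\<And>l. l \<in> loop_classes N x0 \<Longrightarrow> M l \<in> SL2" "\<And>l. l \<in> loop_classes N x0 \<Longrightarrow> X l \<in> sl2"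
    "\<And>l C. l \<in> loop_classes N x0 \<Longrightarrow> C \<in> ucover N x0 \<Longrightarrow> G (class_join N l C) = M l ** G C"
    "\<And>l C. l \<in> loop_classes N x0 \<Longrightarrow> C \<in> ucover N x0 \<Longrightarrow>
       F (class_join N l C) = X l + M l ** F C ** adj (M l)"
  using assms unfolding potential_def by blast+

lemma potential_fields_above:
  assumes P: "potential M X G F" and s: "local_section k U s" and y: "y \<in> U"
    and C: "point_above N x0 (chart_inv k y) = s y"
  shows "om (potential_fields G F b c) k i (chart_inv k y) = rot_form U (\<lambda>z. G (s z)) (axis i 1) y"
    and "ga (potential_fields G F b c) k i (chart_inv k y)
      = trans_form U (\<lambda>z. G (s z)) (\<lambda>z. F (s z)) (axis i 1) y"
  using matrix_inv_SL2[OF potentialD(3)[OF P local_sectionD(4)[OF s y]]]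
  by (simp_all add: potential_fields_def Let_def C pderiv_ucover_section[OF s y] rot_form_def trans_form_def)

text \<open>The point chosen by \<open>point_above\<close> differs from \<open>s y\<close> by a
  loop. The section translated by this loop passes through the chosen point, and the forms do not
  change, because the loop acts on the potentials by a left translation.\<close>

lemma potential_fields_section:
  assumes P: "potential M X G F" and s: "regular_section k U s" and y: "y \<in> U"
  shows "om (potential_fields G F b c) k i (chart_inv k y) = rot_form U (\<lambda>z. G (s z)) (axis i 1) y"
    and "ga (potential_fields G F b c) k i (chart_inv k y)
      = trans_form U (\<lambda>z. G (s z)) (\<lambda>z. F (s z)) (axis i 1) y"
proof -
  note PD = potentialD[OF P]
  have sl: "local_section k U s" using s by (simp add: regular_section_def)
  note sD = local_sectionD[OF sl]
  have "chart_inv k y \<in> N" using sD(1) sD(11)[OF y] chart_subset by blast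
  note C = point_above[OF this]
  obtain l where l: "l \<in> loop_classes N x0" "point_above N x0 (chart_inv k y) = class_join N l (s y)"
    using ucover_fibre[OF sD(4)[OF y], of "point_above N x0 (chart_inv k y)"] C sD(5)[OF y] by metis
  have s': "local_section k U (\<lambda>z. class_join N l (s z))"
    using s l(1) by (simp add: regular_section_def)
  note above = potential_fields_above[OF P s' y l(2)]
  have "rot_form U (\<lambda>z. G (class_join N l (s z))) v y = rot_form U (\<lambda>z. M l ** G (s z)) v y" for v
    by (rule rot_form_cong[OF _ y]) (simp add: PD(7)[OF l(1)] sD(4))
  then show "om (potential_fields G F b c) k i (chart_inv k y) = rot_form U (\<lambda>z. G (s z)) (axis i 1) y"
    by (simp add: above rot_form_left_translate[OF sD(8) y smooth_on_section[OF sl PD(1)] PD(5)[OF l(1)]])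
  have "trans_form U (\<lambda>z. G (class_join N l (s z))) (\<lambda>z. F (class_join N l (s z))) v y
     = trans_form U (\<lambda>z. M l ** G (s z)) (\<lambda>z. X l + M l ** F (s z) ** adj (M l)) v y" for v
    by (rule trans_form_cong[OF _ _ y]) (simp_all add: PD(7,8)[OF l(1)] sD(4))
  then show "ga (potential_fields G F b c) k i (chart_inv k y)
      = trans_form U (\<lambda>z. G (s z)) (\<lambda>z. F (s z)) (axis i 1) y"
    by (simp add: above trans_form_left_translate[OF sD(8) y smooth_on_section[OF sl PD(2)] PD(5)[OF l(1)]])
qed

lemma chart_smooth_onI:
  assumes k: "k \<in> A"
    and "\<And>U s. regular_section k U s \<Longrightarrow> smooth_on U f"
  shows "smooth_on (chart_image k) f"
proof (rule smooth_on_locally)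
  fix y assume y: "y \<in> chart_image k"
  obtain U s where s: "regular_section k U s" "snd k (chart_inv k y) \<in> U"
    using section_over[OF k chart_inv_mem[OF y]] by metis
  have "local_section k U s" using s(1) by (simp add: regular_section_def)
  from local_sectionD(2)[OF this] obtain T where T: "open T" "U = half_plane \<inter> T"
    by (auto simp: openin_open)
  have "smooth_on (chart_image k \<inter> T) f"
    by (rule smooth_on_subset[OF assms(2)[OF s(1)]]) (use T chart_image_half_plane[OF k] in auto)
  then show "\<exists>W. open W \<and> y \<in> W \<and> smooth_on (chart_image k \<inter> W) f"
    using T s(2) y by (auto simp: chart_of_chart_inv)
qed

lemma section_smooth_forms:
  assumes P: "potential M X G F" and s: "regular_section k U s"
  shows "smooth_on U (\<lambda>y. om (potential_fields G F b c) k i (chart_inv k y))"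
    and "smooth_on U (\<lambda>y. ga (potential_fields G F b c) k i (chart_inv k y))"
proof -
  note PD = potentialD[OF P]
  have sl: "local_section k U s" using s by (simp add: regular_section_def)
  note fat = local_sectionD(8)[OF sl] and sm = PD(1,2)[THEN smooth_on_section[OF sl]]
  show "smooth_on U (\<lambda>y. om (potential_fields G F b c) k i (chart_inv k y))"
    by (rule smooth_on_cong[OF smooth_on_rot_form[OF fat sm(1)]])
       (simp add: potential_fields_section[OF P s])
  show "smooth_on U (\<lambda>y. ga (potential_fields G F b c) k i (chart_inv k y))"
    by (rule smooth_on_cong[OF smooth_on_trans_form[OF fat sm]])
       (simp add: potential_fields_section[OF P s])
qed

lemma chart_section_point:
  assumes "k \<in> A" "x \<in> fst k"
  obtains U s y where "regular_section k U s" "local_section k U s" "y \<in> U" "x = chart_inv k y"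
  using section_over[OF assms] chart_inv_chart[OF assms] unfolding regular_section_def by metis

lemma smooth_one_forms:
  assumes P: "potential M X G F"
  shows "smooth_one_form A (om (potential_fields G F b c))"
    and "smooth_one_form A (ga (potential_fields G F b c))"
proof -
  note PD = potentialD[OF P]
  have sl2: "om (potential_fields G F b c) k i x \<in> sl2 \<and> ga (potential_fields G F b c) k i x \<in> sl2"
    if k: "k \<in> A" "x \<in> fst k" for k i x
  proof -
    obtain U s y where s: "regular_section k U s" "local_section k U s" "y \<in> U" "x = chart_inv k y"
      using chart_section_point[OF k] .
    note sD = local_sectionD[OF s(2)]
    show ?thesis
      unfolding s(4) potential_fields_section[OF P s(1,3)]
      by (intro conjI rot_form_sl2 trans_form_sl2 sD(8) s(3) smooth_on_section[OF s(2)] PD sD(4))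
  qed
  have law: "om (potential_fields G F b c) k i x
        = (\<Sum>j\<in>UNIV. (jacobian k d x $ j $ i) *\<^sub>R om (potential_fields G F b c) d j x) \<and>
      ga (potential_fields G F b c) k i x
        = (\<Sum>j\<in>UNIV. (jacobian k d x $ j $ i) *\<^sub>R ga (potential_fields G F b c) d j x)"
    if "k \<in> A" "d \<in> A" "x \<in> fst k \<inter> fst d" for k d i x
  proof -
    have "x \<in> N" using that chart_subset by blast
    note C = point_above[OF this]
    show ?thesis
      unfolding potential_fields_def Let_def fields.simps
      using pderiv_ucover_change[OF PD(1) that(1,2), of "point_above N x0 x" i]
        pderiv_ucover_change[OF PD(2) that(1,2), of "point_above N x0 x" i] C that(3)
      by (simp add: matrix_sum_scaleR_right matrix_sum_scaleR_left)
  qed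
  show "smooth_one_form A (om (potential_fields G F b c))"
    unfolding smooth_one_form_def comp_def
    using chart_smooth_onI section_smooth_forms(1)[OF P] sl2 law by blast
  show "smooth_one_form A (ga (potential_fields G F b c))"
    unfolding smooth_one_form_def comp_def
    using chart_smooth_onI section_smooth_forms(2)[OF P] sl2 law by blast
qed

lemma smooth_on_boundaryI:
  assumes l: "l \<in> L"
    and "\<And>k U s W. regular_section k U s \<Longrightarrow> open W \<Longrightarrow>
      (\<And>t. t \<in> W \<Longrightarrow> snd k (\<sigma> l t) \<in> U) \<Longrightarrow> (\<And>t. t \<in> W \<Longrightarrow> \<alpha> l t = s (snd k (\<sigma> l t))) \<Longrightarrow>
      smooth_on W (\<lambda>t. snd k (\<sigma> l t)) \<Longrightarrow> smooth_on W f"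
  shows "smooth_on UNIV f"
proof (rule smooth_on_locally)
  fix t0 :: real
  have "\<sigma> l t0 \<in> N" using family(2)[OF l, of t0] ucover_endpoint[OF family(3)[OF l]] by metis
  then obtain k where k: "k \<in> A" "\<sigma> l t0 \<in> fst k" by (rule chart_cover)
  obtain U s W where s: "regular_section k U s" "open W" "t0 \<in> W"
    "\<And>t. t \<in> W \<Longrightarrow> snd k (\<sigma> l t) \<in> U" "\<And>t. t \<in> W \<Longrightarrow> \<alpha> l t = s (snd k (\<sigma> l t))"
    "smooth_on W (\<lambda>t. snd k (\<sigma> l t))"
    using boundary_section[OF l k] by metis
  have "smooth_on W f" by (rule assms(2)[OF s(1,2,4,5,6)])
  with s(2,3) show "\<exists>W. open W \<and> t0 \<in> W \<and> smooth_on (UNIV \<inter> W) f" by auto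
qed

lemma smooth_on_family:
  fixes H :: "'a path_class \<Rightarrow> mat2"
  assumes l: "l \<in> L" and H: "section_smooth H"
  shows "smooth_on UNIV (\<lambda>t. H (\<alpha> l t))"
proof (rule smooth_on_boundaryI[OF l])
  fix k U s W
  assume s: "regular_section k U s" and "open W" and W: "\<And>t. t \<in> W \<Longrightarrow> snd k (\<sigma> l t) \<in> U"
    "\<And>t. t \<in> W \<Longrightarrow> \<alpha> l t = s (snd k (\<sigma> l t))" "smooth_on W (\<lambda>t. snd k (\<sigma> l t))"
  have "local_section k U s" using s by (simp add: regular_section_def)
  from smooth_on_compose[OF W(3) smooth_on_section[OF this H] W(1)]
  show "smooth_on W (\<lambda>t. H (\<alpha> l t))" by (rule smooth_on_cong) (use W in auto)
qed

text \<open>Chain rule for the factorization of the family through a section. It expresses a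
  tangential derivative by the derivative within \<open>U\<close>, although the boundary curve runs
  along the edge of \<open>U\<close>.\<close>

lemma family_has_derivative:
  fixes H :: "'a path_class \<Rightarrow> mat2"
  assumes H: "section_smooth H"
    and s: "local_section k U s" and W: "open W" "t0 \<in> W" "\<And>t. t \<in> W \<Longrightarrow> snd k (\<sigma> l t) \<in> U"
    "\<And>t. t \<in> W \<Longrightarrow> \<alpha> l t = s (snd k (\<sigma> l t))" "smooth_on W (\<lambda>t. snd k (\<sigma> l t))"
  shows "((\<lambda>t. H (\<alpha> l t)) has_vector_derivative
    dwithin U (\<lambda>y. H (s y)) (snd k (\<sigma> l t0)) (vector_derivative (snd k \<circ> \<sigma> l) (at t0))) (at t0)"
proof -
  let ?\<kappa> = "\<lambda>t. snd k (\<sigma> l t)"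
  have "(?\<kappa> has_derivative dwithin W ?\<kappa> t0) (at t0)"
    using smooth_on_has_derivative[OF W(5,2)] unfolding at_within_open[OF W(2,1)] .
  then have "?\<kappa> differentiable at t0" by (auto simp: differentiable_def)
  then have \<kappa>: "(?\<kappa> has_vector_derivative vector_derivative (snd k \<circ> \<sigma> l) (at t0)) (at t0)"
    by (simp add: vector_derivative_works comp_def)
  let ?v = "vector_derivative (snd k \<circ> \<sigma> l) (at t0)"
  let ?D = "dwithin U (\<lambda>y. H (s y)) (?\<kappa> t0)"
  note D = smooth_on_has_derivative[OF smooth_on_section[OF s H] W(3)[OF W(2)]]
  have \<kappa>': "(?\<kappa> has_derivative (\<lambda>h. h *\<^sub>R ?v)) (at t0 within W)"
    using \<kappa> unfolding has_vector_derivative_def by (rule has_derivative_at_withinI)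
  have "((\<lambda>t. H (s (?\<kappa> t))) has_derivative (\<lambda>h. ?D (h *\<^sub>R ?v))) (at t0 within W)"
    using has_derivative_in_compose2[OF smooth_on_has_derivative[OF smooth_on_section[OF s H]]
        image_subsetI[OF W(3)] W(2) \<kappa>'] .
  then have "((\<lambda>t. H (\<alpha> l t)) has_derivative (\<lambda>h. ?D (h *\<^sub>R ?v))) (at t0 within W)"
    by (rule has_derivative_transform[OF W(2), rotated]) (simp add: W(4))
  then show ?thesis
    unfolding at_within_open[OF W(2,1)] has_vector_derivative_def
    by (simp add: linear_scale[OF has_derivative_linear[OF D]])
qed

text \<open>Such fields are pure gauge: the bulk equations are identities of \<open>rot_form\<close>
  and \<open>trans_form\<close>. The boundary equations hold because the boundary functions are the
  same potentials up to the constants \<open>b\<close> and \<open>c\<close>.\<close>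

lemma physical_potential_fields:
  assumes P: "potential M X G F" and bc: "\<And>l. l \<in> L \<Longrightarrow> b l \<in> SL2 \<and> c l \<in> sl2"
  shows "physical A L \<sigma> (potential_fields G F b c)"
proof -
  let ?\<Phi> = "potential_fields G F b c"
  note PD = potentialD[OF P]
  have bu: "bu ?\<Phi> l t = adj (b l) ** G (\<alpha> l t)" "bv ?\<Phi> l t = adj (b l) ** (F (\<alpha> l t) - c l) ** b l"
    if "l \<in> L" for l t
    using matrix_inv_SL2[of "b l"] bc[OF that] by (simp_all add: potential_fields_def)
  have "smooth_on UNIV (bu ?\<Phi> l)" "smooth_on UNIV (bv ?\<Phi> l)" if l: "l \<in> L" for l
  proof -
    show "smooth_on UNIV (bu ?\<Phi> l)"
      by (rule smooth_on_cong[OF smooth_on_matrix_mult[OF smooth_on_const smooth_on_family[OF l PD(1)]]])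
         (simp add: bu[OF l])
    show "smooth_on UNIV (bv ?\<Phi> l)"
      by (rule smooth_on_cong[OF smooth_on_matrix_mult[OF smooth_on_matrix_mult[OF smooth_on_const
                smooth_on_diff[OF smooth_on_family[OF l PD(2)] smooth_on_const]] smooth_on_const]])
         (simp add: bu[OF l])
  qed
  moreover have "range (bu ?\<Phi> l) \<subseteq> SL2" "range (bv ?\<Phi> l) \<subseteq> sl2" if l: "l \<in> L" for l
    using bc[OF l] PD(3,4)[OF family(3)[OF l]]
    by (auto simp: bu[OF l] intro!: SL2_mult SL2_adj sl2_conj' sl2_diff)
  moreover have "\<exists>u\<^sub>0\<in>SL2. \<exists>v\<^sub>0\<in>sl2. \<forall>t. bu ?\<Phi> l (t + 2 * pi) = u\<^sub>0 ** bu ?\<Phi> l t \<and>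
      bv ?\<Phi> l (t + 2 * pi) = v\<^sub>0 + u\<^sub>0 ** bv ?\<Phi> l t ** matrix_inv u\<^sub>0" if l: "l \<in> L" for l
  proof -
    obtain m where m: "m \<in> loop_classes N x0" "\<And>t. \<alpha> l (t + 2 * pi) = class_join N m (\<alpha> l t)"
      using family_periodic[OF l] by blast
    note PD' = PD(5,6)[OF m(1)] PD(7,8)[OF m(1) family(3)[OF l]]
    \<comment> \<open>The loop \<open>m\<close> acts on the potentials by \<open>M m\<close> and
      \<open>X m\<close>. Conjugating by \<open>b l\<close> and rewriting the affine law for
      \<open>F\<close> in terms of \<open>F - c l\<close> yields these constants.\<close>
    define u\<^sub>0 where "u\<^sub>0 = adj (b l) ** M m ** b l"
    define v\<^sub>0 where "v\<^sub>0 = adj (b l) ** (X m - c l + M m ** c l ** adj (M m)) ** b l"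
    have u: "u\<^sub>0 \<in> SL2" using bc[OF l] PD' by (simp add: u\<^sub>0_def SL2_mult SL2_adj)
    have v: "v\<^sub>0 \<in> sl2"
      unfolding v\<^sub>0_def using bc[OF l] PD' by (intro sl2_conj' sl2_add sl2_diff sl2_conj) auto
    have bb: "Z ** b l ** adj (b l) = Z" for Z
      using self_mult_adj[of "b l"] bc[OF l] by (simp add: matrix_mul_assoc[symmetric])
    have "bu ?\<Phi> l (t + 2 * pi) = u\<^sub>0 ** bu ?\<Phi> l t" for t
      by (simp add: bu[OF l] m(2) PD' u\<^sub>0_def matrix_mul_assoc bb)
    moreover have "bv ?\<Phi> l (t + 2 * pi) = v\<^sub>0 + u\<^sub>0 ** bv ?\<Phi> l t ** adj u\<^sub>0" for t
      by (simp add: bu[OF l] m(2) PD' u\<^sub>0_def v\<^sub>0_def adj_mult matrix_mul_assoc bb matrix_mult_bilinear_simps)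
    ultimately show ?thesis using u v matrix_inv_SL2[OF u] by metis
  qed
  ultimately have conf: "field_configuration A L ?\<Phi>"
    unfolding field_configuration_def using smooth_one_forms[OF P, of b c] by blast
  have flat: "(\<forall>i j. pderiv_chart k i (om ?\<Phi> k j) x - pderiv_chart k j (om ?\<Phi> k i) x
               + comm (om ?\<Phi> k i x) (om ?\<Phi> k j x) = 0) \<and>
        (\<Sum>i\<in>UNIV. \<Sum>j\<in>UNIV. levi_civita i j *\<^sub>R
           (pderiv_chart k i (ga ?\<Phi> k j) x + comm (om ?\<Phi> k i x) (ga ?\<Phi> k j x))) = 0"
    if k: "k \<in> A" "x \<in> fst k" for k x
  proof -
    obtain U s y where s: "regular_section k U s" "local_section k U s" "y \<in> U" "x = chart_inv k y"
      using chart_section_point[OF k] .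
    note sD = local_sectionD[OF s(2)]
    note sec = potential_fields_section[OF P s(1)]
    note sm = PD(1,2)[THEN smooth_on_section[OF s(2)]]
    have SL: "G (s z) \<in> SL2" if "z \<in> U" for z using PD(3) sD(4)[OF that] .
    have 1: "pderiv_chart k i (om ?\<Phi> k j) x
        = dwithin U (rot_form U (\<lambda>z. G (s z)) (axis j 1)) y (axis i 1)" for i j
      unfolding s(4) by (rule pderiv_chart_section[OF sD(1-3) s(3)]) (rule sec(1))
    have 2: "pderiv_chart k i (ga ?\<Phi> k j) x
        = dwithin U (trans_form U (\<lambda>z. G (s z)) (\<lambda>z. F (s z)) (axis j 1)) y (axis i 1)" for i j
      unfolding s(4) by (rule pderiv_chart_section[OF sD(1-3) s(3)]) (rule sec(2))
    note f = rot_form_flat[OF sD(8) s(3) sm(1) SL] trans_form_flat[OF sD(8) s(3) sm(1) SL sm(2)]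
    \<comment> \<open>In two dimensions the contraction with the antisymmetric symbol amounts to
      this single equation.\<close>
    have "pderiv_chart k 1 (ga ?\<Phi> k 2) x + comm (om ?\<Phi> k 1 x) (ga ?\<Phi> k 2 x)
      = pderiv_chart k 2 (ga ?\<Phi> k 1) x + comm (om ?\<Phi> k 2 x) (ga ?\<Phi> k 1 x)"
      unfolding 2 unfolding s(4) sec[OF s(3)] by (rule f(2))
    then have "(\<Sum>i\<in>UNIV. \<Sum>j\<in>UNIV. levi_civita i j *\<^sub>R
           (pderiv_chart k i (ga ?\<Phi> k j) x + comm (om ?\<Phi> k i x) (ga ?\<Phi> k j x))) = 0"
      by (simp add: sum_2 levi_civita_def)
    moreover have "pderiv_chart k i (om ?\<Phi> k j) x - pderiv_chart k j (om ?\<Phi> k i) x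
               + comm (om ?\<Phi> k i x) (om ?\<Phi> k j x) = 0" for i j
      unfolding 1 unfolding s(4) sec[OF s(3)] by (rule f(1))
    ultimately show ?thesis by blast
  qed
  have bnd: "matrix_inv (bu ?\<Phi> l t) ** vector_derivative (bu ?\<Phi> l) (at t)
          = tangential k (\<sigma> l) (om ?\<Phi>) t \<and>
        matrix_inv (bu ?\<Phi> l t) ** vector_derivative (bv ?\<Phi> l) (at t) ** bu ?\<Phi> l t
          = tangential k (\<sigma> l) (ga ?\<Phi>) t"
    if l: "l \<in> L" and k: "k \<in> A" "\<sigma> l t \<in> fst k" for l k t
  proof -
    obtain U s W where s: "regular_section k U s" and W: "open W" "t \<in> W"
      "\<And>t. t \<in> W \<Longrightarrow> snd k (\<sigma> l t) \<in> U" "\<And>t. t \<in> W \<Longrightarrow> \<alpha> l t = s (snd k (\<sigma> l t))"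
      "smooth_on W (\<lambda>t. snd k (\<sigma> l t))"
      using boundary_section[OF l k] by metis
    have sl: "local_section k U s" using s by (simp add: regular_section_def)
    note sD = local_sectionD[OF sl]
    let ?v = "vector_derivative (snd k \<circ> \<sigma> l) (at t)" and ?y = "snd k (\<sigma> l t)"
    let ?G = "\<lambda>z. G (s z)" and ?F = "\<lambda>z. F (s z)"
    have y: "?y \<in> U" using W by auto
    have xy: "\<sigma> l t = chart_inv k ?y" using chart_inv_chart[OF k] by simp
    note sec = potential_fields_section[OF P s y, folded xy]
    note sm = PD(1,2)[THEN smooth_on_section[OF sl]]
    have tang: "tangential k (\<sigma> l) (om ?\<Phi>) t = rot_form U ?G ?v ?y"
      "tangential k (\<sigma> l) (ga ?\<Phi>) t = trans_form U ?G ?F ?v ?y"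
      unfolding tangential_def sec
      using rot_form_axis_expansion[OF sm(1) y, of ?v]
        trans_form_axis_expansion[OF sm(2) y, of ?G ?v] by simp_all
    have "((\<lambda>t. adj (b l) ** G (\<alpha> l t)) has_vector_derivative
        adj (b l) ** dwithin U ?G ?y ?v) (at t)"
      by (rule bounded_linear.has_vector_derivative[OF
            bounded_bilinear.bounded_linear_right[OF bounded_bilinear_matrix_mult]
            family_has_derivative[OF PD(1) sl W]])
    moreover have "bu ?\<Phi> l = (\<lambda>t. adj (b l) ** G (\<alpha> l t))" by (rule ext) (rule bu[OF l])
    ultimately have du: "vector_derivative (bu ?\<Phi> l) (at t) = adj (b l) ** dwithin U ?G ?y ?v"
      by (simp add: vector_derivative_at)
    \<comment> \<open>The map in question is affine; subtracting its value at 0 makes it linear, and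
      the constant is added back afterwards.\<close>
    have lin: "bounded_linear (\<lambda>Z. adj (b l) ** (Z - c l) ** b l - adj (b l) ** (0 - c l) ** b l)"
      unfolding linear_conv_bounded_linear[symmetric]
      by (rule linearI) (simp_all add: matrix_mult_bilinear_simps
        bounded_bilinear.scaleR_left[OF bounded_bilinear_matrix_mult]
        bounded_bilinear.scaleR_right[OF bounded_bilinear_matrix_mult])
    have "((\<lambda>t. adj (b l) ** (F (\<alpha> l t) - c l) ** b l - adj (b l) ** (0 - c l) ** b l
          + adj (b l) ** (0 - c l) ** b l) has_vector_derivative
        adj (b l) ** (dwithin U ?F ?y ?v - c l) ** b l - adj (b l) ** (0 - c l) ** b l + 0) (at t)"
      by (rule has_vector_derivative_add[OF bounded_linear.has_vector_derivative[OF lin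
            family_has_derivative[OF PD(2) sl W]] has_vector_derivative_const])
    moreover have "bv ?\<Phi> l = (\<lambda>t. adj (b l) ** (F (\<alpha> l t) - c l) ** b l)" by (rule ext) (rule bu[OF l])
    ultimately have dv: "vector_derivative (bv ?\<Phi> l) (at t) = adj (b l) ** dwithin U ?F ?y ?v ** b l"
      by (simp add: vector_derivative_at matrix_mult_bilinear_simps)
    have bb: "Z ** b l ** adj (b l) = Z" for Z
      using self_mult_adj[of "b l"] bc[OF l] by (simp add: matrix_mul_assoc[symmetric])
    have Gy: "G (\<alpha> l t) = ?G ?y" using W(2,4) by simp
    have "bu ?\<Phi> l t \<in> SL2"
      using bc[OF l] PD(3)[OF family(3)[OF l]] by (simp add: bu[OF l] SL2_mult SL2_adj)
    then show ?thesis
      unfolding tang du dv by (simp add: matrix_inv_SL2 bu[OF l] adj_mult matrix_mul_assoc bb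
          Gy rot_form_def trans_form_def)
  qed
  show ?thesis unfolding physical_def using conf flat bnd by blast
qed

end

section \<open>Gauge flow of a family of potentials\<close>

lemma slice_has_vector_derivative:
  assumes "smooth_on (I \<times> U) Q" "r \<in> I" "y \<in> U"
  shows "((\<lambda>r. Q (r, y)) has_vector_derivative dwithin (I \<times> U) Q (r, y) (1, 0)) (at r within I)"
proof -
  have y: "((\<lambda>r. (r, y)) has_derivative (\<lambda>h. (h, 0))) (at r within I)"
    by (auto intro!: derivative_eq_intros)
  have sub: "(\<lambda>r. (r, y)) ` I \<subseteq> I \<times> U" using assms(3) by auto
  have D: "(Q has_derivative dwithin (I \<times> U) Q (r, y)) (at (r, y) within I \<times> U)"
    by (rule smooth_on_has_derivative) (use assms in auto)
  have "((\<lambda>r. Q (r, y)) has_derivative (\<lambda>h. dwithin (I \<times> U) Q (r, y) (h, 0))) (at r within I)"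
    using has_derivative_in_compose2[OF smooth_on_has_derivative[OF assms(1)] sub assms(2) y] .
  moreover have "dwithin (I \<times> U) Q (r, y) (h, 0) = h *\<^sub>R dwithin (I \<times> U) Q (r, y) (1, 0)" for h
    using linear_scale[OF has_derivative_linear[OF D], of h "(1, 0)"]
    unfolding scaleR_Pair real_scaleR_def mult_1_right scaleR_zero_right .
  then have "(\<lambda>h. dwithin (I \<times> U) Q (r, y) (h, 0)) = (\<lambda>h. h *\<^sub>R dwithin (I \<times> U) Q (r, y) (1, 0))"
    by (rule ext)
  ultimately show ?thesis unfolding has_vector_derivative_def by (rule back_subst)
qed

lemma vector_derivative_unit_interval:
  fixes f :: "real \<Rightarrow> 'f::euclidean_space"
  assumes "(f has_vector_derivative f') (at r within {0..1})" "r \<in> {0..1}"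
  shows "vector_derivative f (at r within {0..1}) = f'"
  using vector_derivative_within_closed_interval[of 0 1 r f f'] assms by simp

lemma bounded_linear_matrix_left:
  fixes B :: mat2
  shows "bounded_linear (\<lambda>Z::mat2. B ** Z)"
  by (rule bounded_bilinear.bounded_linear_right[OF bounded_bilinear_matrix_mult])

lemma bounded_linear_matrix_both:
  fixes B D :: mat2
  shows "bounded_linear (\<lambda>Z::mat2. B ** Z ** D)"
  by (rule bounded_linear_compose[OF
        bounded_bilinear.bounded_linear_left[OF bounded_bilinear_matrix_mult] bounded_linear_matrix_left])

context bordered_surface
begin

text \<open>Joint smoothness, and not just that of each member, is what allows parameter and
  coordinate derivatives to be exchanged.\<close>

definition potential_family ::
  "('a path_class \<Rightarrow> mat2) \<Rightarrow> ('a path_class \<Rightarrow> mat2) \<Rightarrow>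
   (real \<Rightarrow> 'a path_class \<Rightarrow> mat2) \<Rightarrow> (real \<Rightarrow> 'a path_class \<Rightarrow> mat2) \<Rightarrow> bool" where
  "potential_family M X G F \<longleftrightarrow>
     (\<forall>r\<in>{0..1}. potential M X (G r) (F r)) \<and>
     (\<forall>k U s. local_section k U s \<longrightarrow>
        smooth_on ({0..1} \<times> U) (\<lambda>p. G (fst p) (s (snd p))) \<and>
        smooth_on ({0..1} \<times> U) (\<lambda>p. F (fst p) (s (snd p))))"

lemma potential_familyD:
  assumes "potential_family M X G F"
  shows "\<And>r. r \<in> {0..1} \<Longrightarrow> potential M X (G r) (F r)"
    "\<And>k U s. local_section k U s \<Longrightarrow> smooth_on ({0..1} \<times> U) (\<lambda>p. G (fst p) (s (snd p)))"
    "\<And>k U s. local_section k U s \<Longrightarrow> smooth_on ({0..1} \<times> U) (\<lambda>p. F (fst p) (s (snd p)))"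
  using assms unfolding potential_family_def by blast+

definition gauge_rot :: "(real \<Rightarrow> 'a path_class \<Rightarrow> mat2) \<Rightarrow> real \<Rightarrow> 'a \<Rightarrow> mat2" where
  "gauge_rot G r x = (let C = point_above N x0 x in
     adj (G r C) ** vector_derivative (\<lambda>r. G r C) (at r within {0..1}))"

definition gauge_trans ::
  "(real \<Rightarrow> 'a path_class \<Rightarrow> mat2) \<Rightarrow> (real \<Rightarrow> 'a path_class \<Rightarrow> mat2) \<Rightarrow> real \<Rightarrow> 'a \<Rightarrow> mat2" where
  "gauge_trans G F r x = (let C = point_above N x0 x in
     adj (G r C) ** vector_derivative (\<lambda>r. F r C) (at r within {0..1}) ** G r C)"

lemma section_through:
  assumes "C \<in> ucover N x0"
  obtains k U s y where "regular_section k U s" "local_section k U s" "y \<in> U" "s y = C"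
proof -
  obtain k where "k \<in> A" "endpoint C \<in> fst k" using chart_cover[OF ucover_endpoint[OF assms]] .
  with regular_section_exists[OF assms this] that show thesis
    unfolding regular_section_def by metis
qed

lemma family_param_derivative:
  assumes fam: "potential_family M X G F" and r: "r \<in> {0..1}" and C: "C \<in> ucover N x0"
  shows "((\<lambda>r. G r C) has_vector_derivative vector_derivative (\<lambda>r. G r C) (at r within {0..1}))
      (at r within {0..1})"
    and "((\<lambda>r. F r C) has_vector_derivative vector_derivative (\<lambda>r. F r C) (at r within {0..1}))
      (at r within {0..1})"
proof -
  obtain k U s y where s: "local_section k U s" "y \<in> U" "s y = C"
    using section_through[OF C] by metis
  show "((\<lambda>r. G r C) has_vector_derivative vector_derivative (\<lambda>r. G r C) (at r within {0..1}))
      (at r within {0..1})"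
    using slice_has_vector_derivative[OF potential_familyD(2)[OF fam s(1)] r s(2)] s(3)
      vector_derivative_unit_interval[OF _ r] by force
  show "((\<lambda>r. F r C) has_vector_derivative vector_derivative (\<lambda>r. F r C) (at r within {0..1}))
      (at r within {0..1})"
    using slice_has_vector_derivative[OF potential_familyD(3)[OF fam s(1)] r s(2)] s(3)
      vector_derivative_unit_interval[OF _ r] by force
qed

text \<open>The gauge parameters are well defined on the surface because the quasiperiodicity factors do
  not depend on the parameter of the family.\<close>

lemma gauge_parameters:
  assumes fam: "potential_family M X G F" and r: "r \<in> {0..1}" and C: "C \<in> ucover N x0"
  shows "gauge_rot G r (endpoint C) = adj (G r C) ** vector_derivative (\<lambda>r. G r C) (at r within {0..1})"
    and "gauge_trans G F r (endpoint C)
      = adj (G r C) ** vector_derivative (\<lambda>r. F r C) (at r within {0..1}) ** G r C"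
proof -
  let ?P = "point_above N x0 (endpoint C)"
  have P: "?P \<in> ucover N x0" "endpoint ?P = endpoint C"
    using point_above[OF ucover_endpoint[OF C]] by auto
  obtain l where l: "l \<in> loop_classes N x0" "?P = class_join N l C"
    using ucover_fibre[OF C P(1)] P(2) by metis
  have law: "G r ?P = M l ** G r C" "F r ?P = X l + M l ** F r C ** adj (M l)" if "r \<in> {0..1}" for r
    unfolding l(2) using potentialD(7,8)[OF potential_familyD(1)[OF fam that] l(1) C] by auto
  have Ml: "M l \<in> SL2" using potentialD(5)[OF potential_familyD(1)[OF fam r] l(1)] .
  have "((\<lambda>r. G r ?P) has_vector_derivative
      M l ** vector_derivative (\<lambda>r. G r C) (at r within {0..1})) (at r within {0..1})"
    by (rule has_vector_derivative_transform[OF r _ bounded_linear.has_vector_derivative[OF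
          bounded_linear_matrix_left family_param_derivative(1)[OF fam r C]]])
       (simp add: law)
  from vector_derivative_unit_interval[OF this r]
  have dG: "vector_derivative (\<lambda>r. G r ?P) (at r within {0..1})
      = M l ** vector_derivative (\<lambda>r. G r C) (at r within {0..1})" .
  have "((\<lambda>r. X l + M l ** F r C ** adj (M l)) has_vector_derivative
      0 + M l ** vector_derivative (\<lambda>r. F r C) (at r within {0..1}) ** adj (M l)) (at r within {0..1})"
    by (rule has_vector_derivative_add[OF has_vector_derivative_const
          bounded_linear.has_vector_derivative[OF
          bounded_linear_matrix_both family_param_derivative(2)[OF fam r C]]])
  then have "((\<lambda>r. F r ?P) has_vector_derivative
      0 + M l ** vector_derivative (\<lambda>r. F r C) (at r within {0..1}) ** adj (M l)) (at r within {0..1})"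
    by (rule has_vector_derivative_transform[OF r, rotated]) (simp add: law)
  from vector_derivative_unit_interval[OF this r]
  have dF: "vector_derivative (\<lambda>r. F r ?P) (at r within {0..1})
      = M l ** vector_derivative (\<lambda>r. F r C) (at r within {0..1}) ** adj (M l)" by simp
  have mm: "Z ** adj (M l) ** M l = Z" for Z
    using adj_mult_self[OF Ml] by (simp add: matrix_mul_assoc[symmetric])
  show "gauge_rot G r (endpoint C) = adj (G r C) ** vector_derivative (\<lambda>r. G r C) (at r within {0..1})"
    unfolding gauge_rot_def Let_def dG law[OF r] by (simp add: adj_mult matrix_mul_assoc mm)
  show "gauge_trans G F r (endpoint C)
      = adj (G r C) ** vector_derivative (\<lambda>r. F r C) (at r within {0..1}) ** G r C"
    unfolding gauge_trans_def Let_def dF law[OF r] by (simp add: adj_mult matrix_mul_assoc mm)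
qed

text \<open>Parameters and fields are components of one pair of forms on the product of the interval
  with \<open>U\<close>: along the parameter axis here, along the coordinate axes in
  \<open>fields_family_section\<close>.\<close>

lemma gauge_parameters_section:
  assumes fam: "potential_family M X G F" and r: "r \<in> {0..1}"
    and s: "local_section k U s" and y: "y \<in> U"
  shows "gauge_rot G r (chart_inv k y)
      = rot_form ({0..1} \<times> U) (\<lambda>p. G (fst p) (s (snd p))) (1, 0) (r, y)"
    and "gauge_trans G F r (chart_inv k y)
      = trans_form ({0..1} \<times> U) (\<lambda>p. G (fst p) (s (snd p))) (\<lambda>p. F (fst p) (s (snd p))) (1, 0) (r, y)"
  using gauge_parameters[OF fam r local_sectionD(4)[OF s y]] local_sectionD(5)[OF s y]
    vector_derivative_unit_interval[OF
      slice_has_vector_derivative[OF potential_familyD(2)[OF fam s] r y] r]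
    vector_derivative_unit_interval[OF
      slice_has_vector_derivative[OF potential_familyD(3)[OF fam s] r y] r]
  by (simp_all add: rot_form_def trans_form_def)

lemma fields_family_section:
  assumes fam: "potential_family M X G F" and r: "r \<in> {0..1}"
    and s: "regular_section k U s" and y: "y \<in> U"
  shows "om (potential_fields (G r) (F r) b c) k i (chart_inv k y)
      = rot_form ({0..1} \<times> U) (\<lambda>p. G (fst p) (s (snd p))) (0, axis i 1) (r, y)"
    and "ga (potential_fields (G r) (F r) b c) k i (chart_inv k y)
      = trans_form ({0..1} \<times> U) (\<lambda>p. G (fst p) (s (snd p))) (\<lambda>p. F (fst p) (s (snd p)))
          (0, axis i 1) (r, y)"
proof -
  have sl: "local_section k U s" using s by (simp add: regular_section_def)
  note fat = local_sectionD(8)[OF sl]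
  show "om (potential_fields (G r) (F r) b c) k i (chart_inv k y)
      = rot_form ({0..1} \<times> U) (\<lambda>p. G (fst p) (s (snd p))) (0, axis i 1) (r, y)"
    using dwithin_slice_snd[OF fat potential_familyD(2)[OF fam sl] r y]
    by (simp add: potential_fields_section[OF potential_familyD(1)[OF fam r] s y] rot_form_def)
  show "ga (potential_fields (G r) (F r) b c) k i (chart_inv k y)
      = trans_form ({0..1} \<times> U) (\<lambda>p. G (fst p) (s (snd p))) (\<lambda>p. F (fst p) (s (snd p)))
          (0, axis i 1) (r, y)"
    using dwithin_slice_snd[OF fat potential_familyD(3)[OF fam sl] r y]
    by (simp add: potential_fields_section[OF potential_familyD(1)[OF fam r] s y] trans_form_def)
qed

lemma chart_smooth_on_timesI:
  assumes k: "k \<in> A"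
    and "\<And>U s. regular_section k U s \<Longrightarrow> smooth_on ({0..1} \<times> U) f"
  shows "smooth_on ({0..1::real} \<times> chart_image k) f"
proof (rule smooth_on_locally)
  fix p assume p: "p \<in> {0..1::real} \<times> chart_image k"
  then have y: "snd p \<in> chart_image k" by auto
  obtain U s where s: "regular_section k U s" "snd k (chart_inv k (snd p)) \<in> U"
    using section_over[OF k chart_inv_mem[OF y]] by metis
  have "local_section k U s" using s(1) by (simp add: regular_section_def)
  from local_sectionD(2)[OF this] obtain T where T: "open T" "U = half_plane \<inter> T"
    by (auto simp: openin_open)
  have "smooth_on (({0..1} \<times> chart_image k) \<inter> (UNIV \<times> T)) f"
    by (rule smooth_on_subset[OF assms(2)[OF s(1)]]) (use T chart_image_half_plane[OF k] in auto)
  moreover have "open (UNIV \<times> T :: (real \<times> (real^2)) set)" using T(1) by (simp add: open_Times)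
  moreover have "p \<in> UNIV \<times> T" using T s(2) y by (auto simp: chart_of_chart_inv mem_Times_iff)
  ultimately show "\<exists>W. open W \<and> p \<in> W \<and> smooth_on (({0..1} \<times> chart_image k) \<inter> W) f" by blast
qed

lemma smooth_on_family_times:
  fixes H :: "real \<Rightarrow> 'a path_class \<Rightarrow> mat2"
  assumes l: "l \<in> L"
    and H: "\<And>k U s. local_section k U s \<Longrightarrow> smooth_on ({0..1} \<times> U) (\<lambda>p. H (fst p) (s (snd p)))"
  shows "smooth_on ({0..1} \<times> UNIV) (\<lambda>p. H (fst p) (\<alpha> l (snd p)))"
proof (rule smooth_on_locally)
  fix p :: "real \<times> real" assume p: "p \<in> {0..1} \<times> UNIV"
  have "\<sigma> l (snd p) \<in> N"
    using family(2)[OF l, of "snd p"] ucover_endpoint[OF family(3)[OF l]] by metis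
  then obtain k where k: "k \<in> A" "\<sigma> l (snd p) \<in> fst k" by (rule chart_cover)
  obtain U s W where s: "regular_section k U s" "open W" "snd p \<in> W"
    "\<And>t. t \<in> W \<Longrightarrow> snd k (\<sigma> l t) \<in> U" "\<And>t. t \<in> W \<Longrightarrow> \<alpha> l t = s (snd k (\<sigma> l t))"
    "smooth_on W (\<lambda>t. snd k (\<sigma> l t))"
    using boundary_section[OF l k] by metis
  have sl: "local_section k U s" using s by (simp add: regular_section_def)
  have 1: "smooth_on ({0..1} \<times> W) (\<lambda>q. snd k (\<sigma> l (snd q)))"
    by (rule smooth_on_compose[OF smooth_on_snd s(6)]) auto
  \<comment> \<open>The redundant pairs display the function as the composition to which
    \<open>smooth_on_compose\<close> applies.\<close>
  have "smooth_on ({0..1} \<times> W) (\<lambda>q. H (fst (fst q, snd k (\<sigma> l (snd q)))) (s (snd (fst q, snd k (\<sigma> l (snd q))))))"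
    by (rule smooth_on_compose[OF smooth_on_Pair[OF smooth_on_fst 1] H[OF sl]]) (use s(4) in auto)
  then have "smooth_on ({0..1} \<times> W) (\<lambda>q. H (fst q) (\<alpha> l (snd q)))"
    by (rule smooth_on_cong) (use s(5) in auto)
  then have "smooth_on (({0..1} \<times> UNIV) \<inter> (UNIV \<times> W)) (\<lambda>q. H (fst q) (\<alpha> l (snd q)))"
    by (rule smooth_on_subset) auto
  moreover have "open (UNIV \<times> W :: (real \<times> real) set)" using s(2) by (simp add: open_Times)
  moreover have "p \<in> UNIV \<times> W" using s(3) by (simp add: mem_Times_iff)
  ultimately show "\<exists>W. open W \<and> p \<in> W \<and>
      smooth_on (({0..1} \<times> UNIV) \<inter> W) (\<lambda>q. H (fst q) (\<alpha> l (snd q)))" by blast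
qed

lemma smooth_family_potential_fields:
  assumes fam: "potential_family M X G F"
  shows "smooth_family_fields A L (\<lambda>r. potential_fields (G r) (F r) b c)"
    and "smooth_family_fun A (gauge_rot G)" and "smooth_family_fun A (gauge_trans G F)"
proof -
  let ?I = "{0..1::real}"
  have fat: "fat (?I \<times> U)" if "regular_section k U s" for k U s
    using that fat_Times[OF fat_unit_interval local_sectionD(8)[of k U s]]
    by (simp add: regular_section_def)
  have rot: "smooth_on (?I \<times> U) (rot_form (?I \<times> U) (\<lambda>p. G (fst p) (s (snd p))) v)"
    and trans: "smooth_on (?I \<times> U)
      (trans_form (?I \<times> U) (\<lambda>p. G (fst p) (s (snd p))) (\<lambda>p. F (fst p) (s (snd p))) v)"
    if "regular_section k U s" for k U s v
    using that potential_familyD(2,3)[OF fam, of k U s]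
    by (auto simp: regular_section_def intro!: smooth_on_rot_form smooth_on_trans_form fat[OF that])
  have "smooth_on (?I \<times> chart_image k) (\<lambda>(r, y). om (potential_fields (G r) (F r) b c) k i (chart_inv k y))"
    if k: "k \<in> A" for k i
    by (rule chart_smooth_on_timesI[OF k], rule smooth_on_cong[OF rot])
       (auto simp: fields_family_section[OF fam])
  moreover have "smooth_on (?I \<times> chart_image k) (\<lambda>(r, y). ga (potential_fields (G r) (F r) b c) k i (chart_inv k y))"
    if k: "k \<in> A" for k i
    by (rule chart_smooth_on_timesI[OF k], rule smooth_on_cong[OF trans])
       (auto simp: fields_family_section[OF fam])
  moreover have "smooth_on (?I \<times> UNIV) (\<lambda>(r, t). bu (potential_fields (G r) (F r) b c) l t)"
    if l: "l \<in> L" for l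
    by (rule smooth_on_cong[OF smooth_on_matrix_mult[OF smooth_on_const
            smooth_on_family_times[OF l potential_familyD(2)[OF fam]]]])
       (auto simp: potential_fields_def)
  moreover have "smooth_on (?I \<times> UNIV) (\<lambda>(r, t). bv (potential_fields (G r) (F r) b c) l t)"
    if l: "l \<in> L" for l
    by (rule smooth_on_cong[OF smooth_on_matrix_mult[OF smooth_on_matrix_mult[OF smooth_on_const
              smooth_on_diff[OF smooth_on_family_times[OF l potential_familyD(3)[OF fam]]
                smooth_on_const]] smooth_on_const]])
       (auto simp: potential_fields_def)
  ultimately show "smooth_family_fields A L (\<lambda>r. potential_fields (G r) (F r) b c)"
    unfolding smooth_family_fields_def by blast
  have "smooth_on (?I \<times> chart_image k) (\<lambda>(r, y). gauge_rot G r (chart_inv k y))" if k: "k \<in> A" for k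
    by (rule chart_smooth_on_timesI[OF k], rule smooth_on_cong[OF rot])
       (auto simp: gauge_parameters_section[OF fam] regular_section_def)
  then show "smooth_family_fun A (gauge_rot G)" unfolding smooth_family_fun_def by blast
  have "smooth_on (?I \<times> chart_image k) (\<lambda>(r, y). gauge_trans G F r (chart_inv k y))" if k: "k \<in> A" for k
    by (rule chart_smooth_on_timesI[OF k], rule smooth_on_cong[OF trans])
       (auto simp: gauge_parameters_section[OF fam] regular_section_def)
  then show "smooth_family_fun A (gauge_trans G F)" unfolding smooth_family_fun_def by blast
qed

lemma gauge_flow_potential_fields:
  assumes fam: "potential_family M X G F" and bc: "\<And>l. l \<in> L \<Longrightarrow> b l \<in> SL2 \<and> c l \<in> sl2"
  shows "gauge_flow A L \<sigma> (\<lambda>r. potential_fields (G r) (F r) b c) (gauge_rot G) (gauge_trans G F)"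
proof -
  let ?I = "{0..1::real}" and ?\<Phi> = "\<lambda>r. potential_fields (G r) (F r) b c"
  have bulk: "((\<lambda>r. om (?\<Phi> r) k i x) has_vector_derivative
              pderiv_chart k i (gauge_rot G r) x + comm (om (?\<Phi> r) k i x) (gauge_rot G r x)) (at r within ?I) \<and>
           ((\<lambda>r. ga (?\<Phi> r) k i x) has_vector_derivative
              comm (ga (?\<Phi> r) k i x) (gauge_rot G r x) + pderiv_chart k i (gauge_trans G F r) x
                + comm (om (?\<Phi> r) k i x) (gauge_trans G F r x)) (at r within ?I)"
    if r: "r \<in> ?I" and k: "k \<in> A" "x \<in> fst k" for r k x i
  proof -
    obtain U s y where s: "regular_section k U s" "local_section k U s" "y \<in> U" "x = chart_inv k y"
      using chart_section_point[OF k] .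
    note sD = local_sectionD[OF s(2)]
    let ?S = "?I \<times> U" and ?Q = "\<lambda>p. G (fst p) (s (snd p))" and ?E = "\<lambda>p. F (fst p) (s (snd p))"
    have fat: "fat ?S" by (rule fat_Times[OF fat_unit_interval sD(8)])
    note sm = potential_familyD(2,3)[OF fam s(2)]
    have p: "(r, y) \<in> ?S" using r s(3) by simp
    have SL: "?Q p \<in> SL2" if "p \<in> ?S" for p
      using that potentialD(3)[OF potential_familyD(1)[OF fam] sD(4)] by auto
    let ?R = "rot_form ?S ?Q" and ?T = "trans_form ?S ?Q ?E"
    have smR: "smooth_on ?S (?R v)" and smT: "smooth_on ?S (?T v)" for v
      by (rule smooth_on_rot_form[OF fat sm(1)], rule smooth_on_trans_form[OF fat sm])
    note sec = fields_family_section[OF fam _ s(1,3), of _ b c] gauge_parameters_section[OF fam r s(2,3)]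
    have "((\<lambda>r. om (?\<Phi> r) k i x) has_vector_derivative dwithin ?S (?R (0, axis i 1)) (r, y) (1, 0))
        (at r within ?I)"
      by (rule has_vector_derivative_transform[OF r _ slice_has_vector_derivative[OF smR r s(3)]])
         (simp add: s(4) sec)
    moreover have "((\<lambda>r. ga (?\<Phi> r) k i x) has_vector_derivative dwithin ?S (?T (0, axis i 1)) (r, y) (1, 0))
        (at r within ?I)"
      by (rule has_vector_derivative_transform[OF r _ slice_has_vector_derivative[OF smT r s(3)]])
         (simp add: s(4) sec)
    moreover have "pderiv_chart k i (gauge_rot G r) x = dwithin ?S (?R (1, 0)) (r, y) (0, axis i 1)"
      unfolding s(4) dwithin_slice_snd[OF sD(8) smR r s(3), symmetric]
      by (rule pderiv_chart_section[OF sD(1-3) s(3)]) (rule gauge_parameters_section(1)[OF fam r s(2)])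
    moreover have "pderiv_chart k i (gauge_trans G F r) x = dwithin ?S (?T (1, 0)) (r, y) (0, axis i 1)"
      unfolding s(4) dwithin_slice_snd[OF sD(8) smT r s(3), symmetric]
      by (rule pderiv_chart_section[OF sD(1-3) s(3)]) (rule gauge_parameters_section(2)[OF fam r s(2)])
    moreover have "dwithin ?S (?R (0, axis i 1)) (r, y) (1, 0)
      = dwithin ?S (?R (1, 0)) (r, y) (0, axis i 1) + comm (om (?\<Phi> r) k i x) (gauge_rot G r x)"
      unfolding s(4) sec sec(1)[OF r]
      using rot_form_flat[OF fat p sm(1) SL, of "(0, axis i 1)" "(1, 0)"]
      by (simp add: comm_def algebra_simps)
    moreover have "dwithin ?S (?T (0, axis i 1)) (r, y) (1, 0)
      = comm (ga (?\<Phi> r) k i x) (gauge_rot G r x) + dwithin ?S (?T (1, 0)) (r, y) (0, axis i 1)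
          + comm (om (?\<Phi> r) k i x) (gauge_trans G F r x)"
      unfolding s(4) sec sec(1,2)[OF r]
      using trans_form_flat[OF fat p sm(1) SL sm(2), of "(0, axis i 1)" "(1, 0)"]
      by (simp add: comm_def algebra_simps)
    ultimately show ?thesis by simp
  qed
  \<comment> \<open>The boundary equations hold by the choice of the parameters: \<open>b\<close>
    and \<open>c\<close> do not vary with \<open>r\<close>, so only the potentials are
    differentiated, and cancelling the potential against its inverse on the right-hand sides leaves
    their derivatives.\<close>
  have bdry: "((\<lambda>r. bu (?\<Phi> r) l t) has_vector_derivative
              bu (?\<Phi> r) l t ** gauge_rot G r (\<sigma> l t)) (at r within ?I) \<and>
           ((\<lambda>r. bv (?\<Phi> r) l t) has_vector_derivative
              bu (?\<Phi> r) l t ** gauge_trans G F r (\<sigma> l t) ** matrix_inv (bu (?\<Phi> r) l t)) (at r within ?I)"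
    if r: "r \<in> ?I" and l: "l \<in> L" for r l t
  proof -
    let ?C = "\<alpha> l t"
    note C = family(3)[OF l, of t]
    note D = family_param_derivative[OF fam r C]
    let ?dG = "vector_derivative (\<lambda>r. G r ?C) (at r within ?I)"
    let ?dF = "vector_derivative (\<lambda>r. F r ?C) (at r within ?I)"
    have bl: "b l \<in> SL2" using bc[OF l] by simp
    have bu: "bu (?\<Phi> r) l t = adj (b l) ** G r ?C"
      and bv: "bv (?\<Phi> r) l t = adj (b l) ** F r ?C ** b l + - (adj (b l) ** c l ** b l)" for r
      by (simp_all add: potential_fields_def matrix_inv_SL2[OF bl] matrix_mult_bilinear_simps)
    have GS: "G r ?C \<in> SL2" using potentialD(3)[OF potential_familyD(1)[OF fam r] C] .
    have gg: "Z ** G r ?C ** adj (G r ?C) = Z" for Z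
      using self_mult_adj[OF GS] by (simp add: matrix_mul_assoc[symmetric])
    note par = gauge_parameters[OF fam r C, unfolded family(2)[OF l]]
    have "((\<lambda>r. adj (b l) ** G r ?C) has_vector_derivative adj (b l) ** ?dG) (at r within ?I)"
      by (rule bounded_linear.has_vector_derivative[OF bounded_linear_matrix_left D(1)])
    moreover have "((\<lambda>r. adj (b l) ** F r ?C ** b l + - (adj (b l) ** c l ** b l))
        has_vector_derivative adj (b l) ** ?dF ** b l + 0) (at r within ?I)"
      by (rule has_vector_derivative_add[OF bounded_linear.has_vector_derivative[OF
              bounded_linear_matrix_both D(2)] has_vector_derivative_const])
    moreover have "matrix_inv (adj (b l) ** G r ?C) = adj (G r ?C) ** b l"
      using matrix_inv_SL2[OF SL2_mult[OF SL2_adj[OF bl] GS]] by (simp add: adj_mult)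
    ultimately show ?thesis
      unfolding bu bv par by (simp add: matrix_mul_assoc gg)
  qed
  show ?thesis unfolding gauge_flow_def using bulk bdry by blast
qed

text \<open>The potentials agree only on the cover and may differ elsewhere as functions, so their
  derivatives are compared along local sections, whose values stay in the cover.\<close>

lemma potential_fields_agree:
  assumes P: "potential M X G F" and P': "potential M' X' G' F'"
    and GF: "\<And>C. C \<in> ucover N x0 \<Longrightarrow> G C = G' C \<and> F C = F' C"
    and bc: "\<And>l. l \<in> L \<Longrightarrow> b l = b' l \<and> c l = c' l"
  shows "same_fields A L (potential_fields G F b c) (potential_fields G' F' b' c')"
proof -
  have "om (potential_fields G F b c) k i x = om (potential_fields G' F' b' c') k i x \<and>
      ga (potential_fields G F b c) k i x = ga (potential_fields G' F' b' c') k i x"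
    if k: "k \<in> A" "x \<in> fst k" for k x i
  proof -
    obtain U s y where s: "regular_section k U s" "local_section k U s" "y \<in> U" "x = chart_inv k y"
      using chart_section_point[OF k] .
    note eq = GF[OF local_sectionD(4)[OF s(2)]]
    show ?thesis
      unfolding s(4) potential_fields_section[OF P s(1,3)] potential_fields_section[OF P' s(1,3)]
      using rot_form_cong[of U "\<lambda>z. G (s z)" "\<lambda>z. G' (s z)", OF _ s(3)]
        trans_form_cong[of U "\<lambda>z. G (s z)" "\<lambda>z. G' (s z)" "\<lambda>z. F (s z)" "\<lambda>z. F' (s z)", OF _ _ s(3)] eq
      by simp
  qed
  moreover have "bu (potential_fields G F b c) l = bu (potential_fields G' F' b' c') l \<and>
      bv (potential_fields G F b c) l = bv (potential_fields G' F' b' c') l" if l: "l \<in> L" for l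
    using GF[OF family(3)[OF l]] bc[OF l] by (simp add: potential_fields_def fun_eq_iff)
  ultimately show ?thesis unfolding same_fields_def by blast
qed

lemma gauge_parameters_sl2:
  assumes fam: "potential_family M X G F" and r: "r \<in> {0..1}" and x: "x \<in> N"
  shows "gauge_rot G r x \<in> sl2" "gauge_trans G F r x \<in> sl2"
proof -
  obtain k where k: "k \<in> A" "x \<in> fst k" using chart_cover[OF x] .
  obtain U s y where s: "regular_section k U s" "local_section k U s" "y \<in> U" "x = chart_inv k y"
    using chart_section_point[OF k] .
  note sD = local_sectionD[OF s(2)]
  let ?S = "{0..1::real} \<times> U"
  have fat: "fat ?S" by (rule fat_Times[OF fat_unit_interval sD(8)])
  have p: "(r, y) \<in> ?S" using r s(3) by simp
  have SL: "G (fst p) (s (snd p)) \<in> SL2" "F (fst p) (s (snd p)) \<in> sl2" if "p \<in> ?S" for p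
    using that potentialD(3,4)[OF potential_familyD(1)[OF fam] sD(4)] by auto
  show "gauge_rot G r x \<in> sl2"
    unfolding s(4) gauge_parameters_section[OF fam r s(2,3)]
    by (rule rot_form_sl2[OF fat p potential_familyD(2)[OF fam s(2)]]) (rule SL(1))
  show "gauge_trans G F r x \<in> sl2"
    unfolding s(4) gauge_parameters_section[OF fam r s(2,3)]
    by (rule trans_form_sl2[OF fat p potential_familyD(3)[OF fam s(2)]]) (rule SL(2), assumption, rule SL(1)[OF p])
qed

lemma gauge_related_potential_family:
  assumes fam: "potential_family M X G F" and bc: "\<And>l. l \<in> L \<Longrightarrow> b l \<in> SL2 \<and> c l \<in> sl2"
    and P0: "potential M X G\<^sub>0 F\<^sub>0" "\<And>C. C \<in> ucover N x0 \<Longrightarrow> G 0 C = G\<^sub>0 C \<and> F 0 C = F\<^sub>0 C"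
    and P1: "potential M X G\<^sub>1 F\<^sub>1" "\<And>C. C \<in> ucover N x0 \<Longrightarrow> G 1 C = G\<^sub>1 C \<and> F 1 C = F\<^sub>1 C"
    and bc': "\<And>l. l \<in> L \<Longrightarrow> b l = b' l \<and> c l = c' l"
  shows "gauge_related N A L \<sigma> (potential_fields G\<^sub>0 F\<^sub>0 b c) (potential_fields G\<^sub>1 F\<^sub>1 b' c')"
proof -
  have bc1: "\<And>l. l \<in> L \<Longrightarrow> b' l \<in> SL2 \<and> c' l \<in> sl2" using bc bc' by fastforce
  note famD = potential_familyD(1)[OF fam]
  show ?thesis
    unfolding gauge_related_def
  proof (intro conjI exI)
    show "physical A L \<sigma> (potential_fields G\<^sub>0 F\<^sub>0 b c)" "physical A L \<sigma> (potential_fields G\<^sub>1 F\<^sub>1 b' c')"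
      using physical_potential_fields[OF P0(1) bc] physical_potential_fields[OF P1(1) bc1] by auto
    show "same_fields A L ((\<lambda>r. potential_fields (G r) (F r) b c) 0) (potential_fields G\<^sub>0 F\<^sub>0 b c)"
      using potential_fields_agree[OF famD P0] by simp
    show "same_fields A L ((\<lambda>r. potential_fields (G r) (F r) b c) 1) (potential_fields G\<^sub>1 F\<^sub>1 b' c')"
      using potential_fields_agree[OF famD P1 bc'] by simp
    show "\<forall>r\<in>{0..1}. physical A L \<sigma> ((\<lambda>r. potential_fields (G r) (F r) b c) r)"
      using physical_potential_fields[OF famD bc] by simp
    show "\<forall>r\<in>{0..1}. \<forall>x\<in>N. gauge_rot G r x \<in> sl2 \<and> gauge_trans G F r x \<in> sl2"
      using gauge_parameters_sl2[OF fam] by blast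
  qed (use smooth_family_potential_fields[OF fam] gauge_flow_potential_fields[OF fam bc] in auto)
qed

end

section \<open>Contraction of the covering group\<close>

text \<open>Two homotopies are combined pointwise. Products of paths in \<open>SL2\<close> and the
  quotient columns of two paths are both of this kind.\<close>

lemma homotopic_paths_map2:
  assumes p: "homotopic_paths S p p'" and q: "homotopic_paths T q q'"
    and f: "continuous_on (S \<times> T) (\<lambda>x. f (fst x) (snd x))" "\<And>x y. x \<in> S \<Longrightarrow> y \<in> T \<Longrightarrow> f x y \<in> R"
  shows "homotopic_paths R (\<lambda>t. f (p t) (q t)) (\<lambda>t. f (p' t) (q' t))"
proof -
  obtain h where h: "continuous_on ({0..1} \<times> {0..1}) h" "h \<in> ({0..1} \<times> {0..1}) \<rightarrow> S"
      "\<And>x. x \<in> {0..1} \<Longrightarrow> h (0, x) = p x" "\<And>x. x \<in> {0..1} \<Longrightarrow> h (1, x) = p' x"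
      "\<And>t. t \<in> {0..1::real} \<Longrightarrow> h (t, 0) = p 0 \<and> h (t, 1) = p 1"
    using p unfolding homotopic_paths by (auto simp: pathstart_def pathfinish_def)
  obtain k where k: "continuous_on ({0..1} \<times> {0..1}) k" "k \<in> ({0..1} \<times> {0..1}) \<rightarrow> T"
      "\<And>x. x \<in> {0..1} \<Longrightarrow> k (0, x) = q x" "\<And>x. x \<in> {0..1} \<Longrightarrow> k (1, x) = q' x"
      "\<And>t. t \<in> {0..1::real} \<Longrightarrow> k (t, 0) = q 0 \<and> k (t, 1) = q 1"
    using q unfolding homotopic_paths by (auto simp: pathstart_def pathfinish_def)
  have "continuous_on ({0..1} \<times> {0..1}) (\<lambda>z. (h z, k z))"
    using h(1) k(1) by (rule continuous_on_Pair)
  then have "continuous_on ({0..1} \<times> {0..1}) (\<lambda>z. f (fst (h z, k z)) (snd (h z, k z)))"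
    by (rule continuous_on_compose2[OF f(1)]) (use h(2) k(2) in auto)
  then show ?thesis
    unfolding homotopic_paths
    by (intro exI[of _ "\<lambda>z. f (h z) (k z)"])
       (use h(2-5) k(2-5) f(2) in \<open>auto simp: pathstart_def pathfinish_def Pi_iff\<close>)
qed

text \<open>Read as complex numbers, the columns turn the determinant into the imaginary part in
  \<open>det_of_columns\<close>, and the first column of a matrix in \<open>SL2\<close> becomes a
  non-zero number that has a logarithm.\<close>

definition complex_column :: "2 \<Rightarrow> mat2 \<Rightarrow> complex" where
  "complex_column j M = Complex (M $ 1 $ j) (M $ 2 $ j)"

definition of_columns :: "complex \<Rightarrow> complex \<Rightarrow> mat2" where
  "of_columns z w = (\<chi> i j. if j = 1 then (if i = 1 then Re z else Im z) else (if i = 1 then Re w else Im w))"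

lemma bounded_linear_complex_column: "bounded_linear (complex_column j)"
  unfolding linear_conv_bounded_linear[symmetric]
  by (rule linearI) (auto simp: complex_column_def complex_eq_iff)

lemma of_columns_complex_column: "of_columns (complex_column 1 M) (complex_column 2 M) = M"
  by (simp add: of_columns_def complex_column_def vec_eq_iff forall_2)

lemma smooth_on_of_columns:
  fixes z w :: "'e::euclidean_space \<Rightarrow> complex"
  assumes "smooth_on S z" "smooth_on S w"
  shows "smooth_on S (\<lambda>x. of_columns (z x) (w x))"
proof -
  have 1: "bounded_linear (\<lambda>z. of_columns z 0)" and 2: "bounded_linear (of_columns 0)"
    unfolding linear_conv_bounded_linear[symmetric]
    by (auto intro!: linearI simp: of_columns_def vec_eq_iff)
  have "of_columns a 0 + of_columns 0 b = of_columns a b" for a b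
    by (simp add: of_columns_def vec_eq_iff)
  with smooth_on_add[OF smooth_on_linear_comp[OF 1 assms(1)] smooth_on_linear_comp[OF 2 assms(2)]]
  show ?thesis by simp
qed

lemma det_of_columns: "det (of_columns z w) = Im (cnj z * w)"
  by (simp add: det_2 of_columns_def)

lemma complex_column_SL2:
  assumes "M \<in> SL2"
  shows "Im (cnj (complex_column 1 M) * complex_column 2 M) = 1" "complex_column 1 M \<noteq> 0"
proof -
  show "Im (cnj (complex_column 1 M) * complex_column 2 M) = 1"
    using assms det_of_columns[of "complex_column 1 M" "complex_column 2 M"] by (simp add: of_columns_complex_column SL2_def)
  then show "complex_column 1 M \<noteq> 0" by auto
qed

text \<open>The homotopy parameter \<open>r\<close> scales the coordinates \<open>w\<close>, \<open>\<tau>\<close> in which the universal cover of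
  \<open>SL(2)\<close> is \<open>\<complex> \<times> \<real>\<close>: the columns of a matrix are \<open>e\<^sup>w\<close> and \<open>\<tau> e\<^sup>w + i / cnj (e\<^sup>w)\<close>.\<close>

definition contraction :: "complex \<Rightarrow> real \<Rightarrow> real \<Rightarrow> mat2" where
  "contraction w \<tau> r = of_columns (exp (r *\<^sub>R w))
     ((r * \<tau>) *\<^sub>R exp (r *\<^sub>R w) + \<i> * exp (- (r *\<^sub>R cnj w)))"

text \<open>Multiplied by the conjugate of the first column, the first summand of the second column
  becomes real and the second summand becomes exactly i; by \<open>det_of_columns\<close> the
  determinant is 1.\<close>

lemma contraction_SL2: "contraction w \<tau> r \<in> SL2"
proof -
  have "cnj (exp (r *\<^sub>R w)) * (\<i> * exp (- (r *\<^sub>R cnj w))) = \<i> * (exp (r *\<^sub>R cnj w) * exp (- (r *\<^sub>R cnj w)))"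
    by (simp add: exp_cnj)
  also have "\<dots> = \<i>" by (simp add: exp_minus)
  finally have 1: "cnj (exp (r *\<^sub>R w)) * (\<i> * exp (- (r *\<^sub>R cnj w))) = \<i>" .
  have "cnj (exp (r *\<^sub>R w)) * ((r * \<tau>) *\<^sub>R exp (r *\<^sub>R w)) = (r * \<tau>) *\<^sub>R (exp (r *\<^sub>R w) * cnj (exp (r *\<^sub>R w)))"
    by (simp add: mult.commute)
  then have 2: "Im (cnj (exp (r *\<^sub>R w)) * ((r * \<tau>) *\<^sub>R exp (r *\<^sub>R w))) = 0"
    by (simp add: complex_mult_cnj)
  show ?thesis
    unfolding contraction_def SL2_def mem_Collect_eq det_of_columns distrib_left plus_complex.sel 1 2
    by simp
qed

lemma contraction_0: "contraction w \<tau> 0 = mat 1"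
  by (simp add: contraction_def of_columns_def vec_eq_iff forall_2 mat_def)

text \<open>In the ratio of the second column to the first, determinant 1 forces the imaginary part
  to be the inverse square of the modulus of the first column; the real part is the free coordinate
  \<open>\<tau>\<close>. Multiplying back by the first column gives the decomposition in
  \<open>contraction\<close>.\<close>

lemma contraction_1:
  assumes M: "M \<in> SL2" and w: "exp w = complex_column 1 M"
  shows "contraction w (Re (complex_column 2 M * exp (- w))) 1 = M"
proof -
  let ?z = "complex_column 1 M" and ?\<zeta> = "complex_column 2 M"
  have z: "?z \<noteq> 0" and im: "Im (cnj ?z * ?\<zeta>) = 1" using complex_column_SL2[OF M] by auto
  have "?\<zeta> * exp (- w) = (cnj ?z * ?\<zeta>) / (?z * cnj ?z)"
    using z by (simp add: exp_minus w divide_simps)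
  also have "?z * cnj ?z = complex_of_real ((cmod ?z)\<^sup>2)" by (rule complex_norm_square[symmetric])
  finally have q: "?\<zeta> * exp (- w) = (cnj ?z * ?\<zeta>) / complex_of_real ((cmod ?z)\<^sup>2)" .
  have "Im (?\<zeta> * exp (- w)) = 1 / (cmod ?z)\<^sup>2"
    unfolding q Im_divide_of_real im ..
  then have "?\<zeta> * exp (- w) = complex_of_real (Re (?\<zeta> * exp (- w))) + \<i> * complex_of_real (1 / (cmod ?z)\<^sup>2)"
    by (simp add: complex_eq_iff)
  from arg_cong[OF this, of "\<lambda>x. x * ?z"]
  have a: "?\<zeta> * exp (- w) * ?z = Re (?\<zeta> * exp (- w)) *\<^sub>R ?z + \<i> * (?z / complex_of_real ((cmod ?z)\<^sup>2))"
    unfolding distrib_right scaleR_conv_of_real by simp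
  have b: "?\<zeta> * exp (- w) * ?z = ?\<zeta>" using z by (simp add: exp_minus w)
  have c: "?z / complex_of_real ((cmod ?z)\<^sup>2) = exp (- cnj w)"
  proof -
    have "exp (cnj w) = cnj ?z" by (simp add: exp_cnj[symmetric] w)
    then show ?thesis using z unfolding complex_norm_square exp_minus by (simp add: divide_simps)
  qed
  show ?thesis
    unfolding contraction_def mult_1 scaleR_one w a[unfolded b c, symmetric]
    by (rule of_columns_complex_column)
qed

lemma smooth_on_contraction:
  fixes w :: "'e::euclidean_space \<Rightarrow> complex" and \<tau> r :: "'e \<Rightarrow> real"
  assumes "smooth_on S w" "smooth_on S \<tau>" "smooth_on S r"
  shows "smooth_on S (\<lambda>x. contraction (w x) (\<tau> x) (r x))"
  unfolding contraction_def
  by (intro smooth_on_of_columns smooth_on_exp smooth_on_add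
      smooth_on_bilinear[OF bounded_bilinear_scaleR] smooth_on_bilinear[OF bounded_bilinear_mult]
      smooth_on_const smooth_on_linear_comp[OF bounded_linear_minus[OF bounded_linear_ident]]
      smooth_on_linear_comp[OF bounded_linear_cnj] assms)

section \<open>Logarithms along paths in the punctured plane\<close>

definition path_log :: "(real \<Rightarrow> complex) \<Rightarrow> complex" where
  "path_log z = (SOME e. \<exists>h. path h \<and> pathstart h = 0 \<and> (\<forall>t\<in>{0..1}. exp (h t) = z t) \<and> pathfinish h = e)"

text \<open>Monodromy for the exponential as a covering of the punctured plane. It makes the choice
  in \<open>path_log\<close> harmless and \<open>path_log\<close> a homotopy invariant.\<close>

lemma path_lift_unique:
  fixes z :: "real \<Rightarrow> complex"
  assumes z: "homotopic_paths (- {0}) z z'"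
    and h: "path h" "pathstart h = 0" "\<And>t. t \<in> {0..1} \<Longrightarrow> exp (h t) = z t"
    and h': "path h'" "pathstart h' = 0" "\<And>t. t \<in> {0..1} \<Longrightarrow> exp (h' t) = z' t"
  shows "pathfinish h = pathfinish h'"
  by (rule covering_space_monodromy[OF covering_space_exp_punctured_plane, of z z'])
     (use assms homotopic_paths_imp_path[OF z] homotopic_paths_imp_subset[OF z] in auto)

lemma path_log_eq:
  assumes z: "path z" "path_image z \<subseteq> - {0}"
    and h: "path h" "pathstart h = 0" "\<And>t. t \<in> {0..1} \<Longrightarrow> exp (h t) = z t"
  shows "path_log z = pathfinish h"
  unfolding path_log_def
proof (rule some_equality)
  fix e assume "\<exists>h. path h \<and> pathstart h = 0 \<and> (\<forall>t\<in>{0..1}. exp (h t) = z t) \<and> pathfinish h = e"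
  then obtain k where "path k" "pathstart k = 0" "\<And>t. t \<in> {0..1} \<Longrightarrow> exp (k t) = z t" "pathfinish k = e"
    by blast
  with path_lift_unique[of z z k h] z h show "e = pathfinish h" by auto
qed (use h in auto)

lemma path_log_lift:
  assumes z: "path z" "path_image z \<subseteq> - {0}" "pathstart z = 1"
  obtains h where "path h" "pathstart h = 0" "\<And>t. t \<in> {0..1} \<Longrightarrow> exp (h t) = z t"
    "path_log z = pathfinish h"
proof -
  obtain h where "path h" "pathstart h = 0" "\<And>t. t \<in> {0..1} \<Longrightarrow> exp (h t) = z t"
    using covering_space_lift_path_strong[OF covering_space_exp_punctured_plane, of 0 z] z by auto
  with that path_log_eq[OF z(1,2)] show thesis by blast
qed

lemma path_log_homotopic:
  assumes z: "homotopic_paths (- {0}) z z'" and 1: "pathstart z = 1"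
  shows "path_log z = path_log z'"
proof -
  note zz = homotopic_paths_imp_path[OF z] homotopic_paths_imp_subset[OF z]
  obtain h where h: "path h" "pathstart h = 0" "\<And>t. t \<in> {0..1} \<Longrightarrow> exp (h t) = z t" "path_log z = pathfinish h"
    by (rule path_log_lift[of z]) (use zz 1 in auto)
  obtain h' where h': "path h'" "pathstart h' = 0" "\<And>t. t \<in> {0..1} \<Longrightarrow> exp (h' t) = z' t" "path_log z' = pathfinish h'"
    by (rule path_log_lift[of z']) (use zz 1 homotopic_paths_imp_pathstart[OF z] in auto)
  show ?thesis using path_lift_unique[OF z h(1-3) h'(1-3)] h(4) h'(4) by simp
qed

lemma exp_path_log:
  assumes "path z" "path_image z \<subseteq> - {0}" "pathstart z = 1"
  shows "exp (path_log z) = pathfinish z"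
proof -
  obtain h where h: "\<And>t. t \<in> {0..1} \<Longrightarrow> exp (h t) = z t" "path_log z = pathfinish h"
    using path_log_lift[OF assms] by metis
  show ?thesis using h(1)[of 1] h(2) by (simp add: pathfinish_def)
qed

text \<open>Along \<open>y\<close> the ratio to the end point of \<open>z\<close> stays in the right
  half plane, where the principal logarithm is continuous; it starts at 0, so adding it prolongs the
  lift of \<open>z\<close>.\<close>

lemma path_log_join:
  fixes y z :: "real \<Rightarrow> complex"
  assumes z: "path z" "path_image z \<subseteq> - {0}" "pathstart z = 1"
    and y: "path y" "pathstart y = pathfinish z" "\<And>t. t \<in> {0..1} \<Longrightarrow> 0 < Re (y t / pathfinish z)"
  shows "path_log (z +++ y) = path_log z + Ln (pathfinish y / pathfinish z)"
proof -
  obtain h where h: "path h" "pathstart h = 0" "\<And>t. t \<in> {0..1} \<Longrightarrow> exp (h t) = z t" "path_log z = pathfinish h"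
    by (metis path_log_lift[OF z])
  let ?e = "pathfinish z" and ?k = "\<lambda>t. path_log z + Ln (y t / pathfinish z)"
  have e: "?e \<noteq> 0" using z(2) pathfinish_in_path_image[of z] by auto
  have nz: "y t \<noteq> 0" "y t / ?e \<notin> \<real>\<^sub>\<le>\<^sub>0" if "t \<in> {0..1}" for t
    using y(3)[OF that] by (auto simp: complex_nonpos_Reals_iff)
  have "path_log (z +++ y) = pathfinish (h +++ ?k)"
  proof (rule path_log_eq)
    show "path (z +++ y)" using z y by simp
    show "path_image (z +++ y) \<subseteq> - {0}"
      unfolding path_image_join[OF y(2)[symmetric]] using z(2) nz(1) by (auto simp: path_image_def[of y])
    have "path ?k"
      unfolding path_def using y(1) nz(2) e by (intro continuous_intros) (auto simp: path_def)
    then show "path (h +++ ?k)"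
      using h y(2) e by (intro path_join_imp) (auto simp: pathstart_def)
    show "pathstart (h +++ ?k) = 0" using h by simp
    have "exp (?k t) = y t" if "t \<in> {0..1}" for t
      using nz(1)[OF that] e by (simp add: exp_add exp_path_log[OF z])
    then show "exp ((h +++ ?k) t) = (z +++ y) t" if "t \<in> {0..1}" for t
      using that h(3) by (auto simp: joinpaths_def)
  qed
  also have "\<dots> = pathfinish ?k" by (rule pathfinish_join)
  finally show ?thesis by (simp add: pathfinish_def)
qed

text \<open>Forming quotients of matrices, pointwise along two paths, avoids inverses in the
  covering group.\<close>

definition quotient_column :: "mat2 \<Rightarrow> mat2 \<Rightarrow> complex" where
  "quotient_column P Q = complex_column 1 (adj P ** Q)"

lemma quotient_column_nonzero: "P \<in> SL2 \<Longrightarrow> Q \<in> SL2 \<Longrightarrow> quotient_column P Q \<noteq> 0"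
  unfolding quotient_column_def by (intro complex_column_SL2(2) SL2_mult SL2_adj)

lemma continuous_quotient_column: "continuous_on S (\<lambda>x. quotient_column (fst x) (snd x))"
  unfolding quotient_column_def
  by (intro bounded_linear.continuous_on[OF bounded_linear_complex_column]
      bounded_bilinear.continuous_on[OF bounded_bilinear_matrix_mult]
      bounded_linear.continuous_on[OF bounded_linear_adj] continuous_intros)

lemma path_quotient_column:
  assumes "path p" "path q"
  shows "path (\<lambda>t. quotient_column (p t) (q t))"
proof -
  have "continuous_on {0..1} (\<lambda>t. (p t, q t))" using assms by (auto simp: path_def intro: continuous_intros)
  from continuous_on_compose2[OF continuous_quotient_column[of UNIV] this] show ?thesis
    by (simp add: path_def)
qed

lemma path_image_quotient_column:
  assumes "path_image p \<subseteq> SL2" "path_image q \<subseteq> SL2"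
  shows "path_image (\<lambda>t. quotient_column (p t) (q t)) \<subseteq> - {0}"
proof
  fix z assume "z \<in> path_image (\<lambda>t. quotient_column (p t) (q t))"
  then obtain t where t: "t \<in> {0..1}" "z = quotient_column (p t) (q t)"
    by (auto simp: path_image_def)
  have "p t \<in> SL2" "q t \<in> SL2" using assms t(1) by (auto simp: path_image_def)
  then show "z \<in> - {0}" using quotient_column_nonzero t(2) by simp
qed

text \<open>The logarithm of the first column of \<open>C\<inverse> D\<close>, continued along paths that represent \<open>C\<close> and \<open>D\<close>.\<close>

definition cover_log :: "mat2 path_class \<Rightarrow> mat2 path_class \<Rightarrow> complex" where
  "cover_log C D = path_log (\<lambda>t. quotient_column ((SOME p. p \<in> C) t) ((SOME q. q \<in> D) t))"

text \<open>The chosen representatives are homotopic to \<open>p\<close> and \<open>q\<close>, so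
  the quotient columns are homotopic in the punctured plane. The condition \<open>start\<close> lets
  the logarithm begin at 0, which fixes its branch.\<close>

lemma cover_log_eq:
  assumes p: "path p" "path_image p \<subseteq> SL2" and q: "path q" "path_image q \<subseteq> SL2"
    and start: "quotient_column (p 0) (q 0) = 1"
  shows "cover_log (path_class SL2 p) (path_class SL2 q) = path_log (\<lambda>t. quotient_column (p t) (q t))"
proof -
  define p' where "p' = (SOME r. r \<in> path_class SL2 p)"
  define q' where "q' = (SOME r. r \<in> path_class SL2 q)"
  have "p' \<in> path_class SL2 p" unfolding p'_def some_in_eq using path_class_self[OF p] by blast
  then have p': "homotopic_paths SL2 p p'" by (simp add: path_class_def)
  have "q' \<in> path_class SL2 q" unfolding q'_def some_in_eq using path_class_self[OF q] by blast
  then have q': "homotopic_paths SL2 q q'" by (simp add: path_class_def)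
  have "homotopic_paths (- {0}) (\<lambda>t. quotient_column (p t) (q t)) (\<lambda>t. quotient_column (p' t) (q' t))"
    by (rule homotopic_paths_map2[OF p' q' continuous_quotient_column])
       (simp add: quotient_column_nonzero)
  then show ?thesis
    unfolding cover_log_def p'_def[symmetric] q'_def[symmetric]
    by (rule path_log_homotopic[symmetric]) (simp add: pathstart_def start)
qed

lemma quotient_column_translate:
  assumes "R \<in> SL2"
  shows "quotient_column (R ** P) (R ** Q) = quotient_column P Q"
proof -
  have "adj (R ** P) ** (R ** Q) = adj P ** (adj R ** R) ** Q"
    by (simp add: adj_mult matrix_mul_assoc)
  then show ?thesis by (simp add: quotient_column_def adj_mult_self[OF assms])
qed

lemma quotient_column_one: "quotient_column (mat 1) (mat 1) = 1"
  by (simp add: quotient_column_def complex_column_def adj_def mat2_simps complex_eq_iff)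

lemma SL2_cover_mult:
  assumes p: "path p" "path_image p \<subseteq> SL2" and q: "path q" "path_image q \<subseteq> SL2"
  shows "path_class SL2 p \<otimes>\<^bsub>SL2_cover\<^esub> path_class SL2 q = path_class SL2 (\<lambda>t. p t ** q t)"
proof -
  have *: "homotopic_paths SL2 (\<lambda>t. p t ** q t) (\<lambda>t. p' t ** q' t)"
    if "p' \<in> path_class SL2 p" "q' \<in> path_class SL2 q" for p' q'
  proof (rule homotopic_paths_map2[of SL2 p p' SL2 q q' "(**)"])
    show "continuous_on (SL2 \<times> SL2) (\<lambda>x. fst x ** snd x)"
      by (intro bounded_bilinear.continuous_on[OF bounded_bilinear_matrix_mult] continuous_intros)
  qed (use that SL2_mult in \<open>auto simp: path_class_def\<close>)
  have "{r. \<exists>p\<in>path_class SL2 p. \<exists>q\<in>path_class SL2 q. homotopic_paths SL2 (\<lambda>t. p t ** q t) r}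
      = path_class SL2 (\<lambda>t. p t ** q t)"
  proof (intro equalityI subsetI)
    fix r assume "r \<in> {r. \<exists>p\<in>path_class SL2 p. \<exists>q\<in>path_class SL2 q. homotopic_paths SL2 (\<lambda>t. p t ** q t) r}"
    then obtain p' q' where "p' \<in> path_class SL2 p" "q' \<in> path_class SL2 q"
      "homotopic_paths SL2 (\<lambda>t. p' t ** q' t) r" by blast
    with * show "r \<in> path_class SL2 (\<lambda>t. p t ** q t)"
      unfolding path_class_def by (blast intro: homotopic_paths_trans)
  next
    fix r assume "r \<in> path_class SL2 (\<lambda>t. p t ** q t)"
    then have "homotopic_paths SL2 (\<lambda>t. p t ** q t) r" by (simp add: path_class_def)
    then show "r \<in> {r. \<exists>p\<in>path_class SL2 p. \<exists>q\<in>path_class SL2 q. homotopic_paths SL2 (\<lambda>t. p t ** q t) r}"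
      using path_class_self[OF p] path_class_self[OF q] by blast
  qed
  then show ?thesis by (simp add: SL2_cover_def)
qed

lemma path_pointwise_mult:
  fixes p q :: "real \<Rightarrow> mat2"
  assumes "path p" "path_image p \<subseteq> SL2" "path q" "path_image q \<subseteq> SL2"
  shows "path (\<lambda>t. p t ** q t)" "path_image (\<lambda>t. p t ** q t) \<subseteq> SL2"
  using assms SL2_mult unfolding path_def path_image_def
  by (auto intro!: bounded_bilinear.continuous_on[OF bounded_bilinear_matrix_mult])

lemma endpoint_SL2_cover_mult:
  assumes "C \<in> ucover SL2 (mat 1)" "D \<in> ucover SL2 (mat 1)"
  shows "endpoint (C \<otimes>\<^bsub>SL2_cover\<^esub> D) = endpoint C ** endpoint D"
proof -
  obtain p where p: "path p" "path_image p \<subseteq> SL2" "C = path_class SL2 p" "endpoint C = pathfinish p"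
    using assms(1) by (rule ucoverE)
  obtain q where q: "path q" "path_image q \<subseteq> SL2" "D = path_class SL2 q" "endpoint D = pathfinish q"
    using assms(2) by (rule ucoverE)
  have "endpoint (C \<otimes>\<^bsub>SL2_cover\<^esub> D) = pathfinish (\<lambda>t. p t ** q t)"
    unfolding p(3) q(3) SL2_cover_mult[OF p(1,2) q(1,2)]
    by (rule endpoint_path_class[OF path_pointwise_mult[OF p(1,2) q(1,2)]])
  then show ?thesis unfolding p(4) q(4) by (simp add: pathfinish_def)
qed

text \<open>The common factor cancels pointwise along representing paths. This is where equality in
  the covering group enters: with equal projections only, the logarithm would be determined up to
  multiples of 2 pi i.\<close>

lemma cover_log_translate:
  assumes "E \<in> ucover SL2 (mat 1)" "C \<in> ucover SL2 (mat 1)" "D \<in> ucover SL2 (mat 1)"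
  shows "cover_log (E \<otimes>\<^bsub>SL2_cover\<^esub> C) (E \<otimes>\<^bsub>SL2_cover\<^esub> D) = cover_log C D"
proof -
  obtain e where e: "path e" "path_image e \<subseteq> SL2" "pathstart e = mat 1" "E = path_class SL2 e"
    using assms(1) by (rule ucoverE)
  obtain p where p: "path p" "path_image p \<subseteq> SL2" "pathstart p = mat 1" "C = path_class SL2 p"
    using assms(2) by (rule ucoverE)
  obtain q where q: "path q" "path_image q \<subseteq> SL2" "pathstart q = mat 1" "D = path_class SL2 q"
    using assms(3) by (rule ucoverE)
  have "cover_log (E \<otimes>\<^bsub>SL2_cover\<^esub> C) (E \<otimes>\<^bsub>SL2_cover\<^esub> D)
      = path_log (\<lambda>t. quotient_column (e t ** p t) (e t ** q t))"
    unfolding e(4) p(4) q(4) SL2_cover_mult[OF e(1,2) p(1,2)] SL2_cover_mult[OF e(1,2) q(1,2)]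
    by (rule cover_log_eq[OF path_pointwise_mult[OF e(1,2) p(1,2)] path_pointwise_mult[OF e(1,2) q(1,2)]])
       (use e(3) p(3) q(3) quotient_column_one in \<open>simp add: pathstart_def\<close>)
  also have "\<dots> = path_log (\<lambda>t. quotient_column (p t) (q t))"
  proof (rule path_log_homotopic)
    have pq: "path (\<lambda>t. quotient_column (p t) (q t))"
      by (rule path_quotient_column[OF p(1) q(1)])
    have pqe: "path (\<lambda>t. quotient_column (e t ** p t) (e t ** q t))"
      by (rule path_quotient_column[OF path_pointwise_mult(1)[OF e(1,2) p(1,2)]
            path_pointwise_mult(1)[OF e(1,2) q(1,2)]])
    show "homotopic_paths (- {0}) (\<lambda>t. quotient_column (e t ** p t) (e t ** q t))
      (\<lambda>t. quotient_column (p t) (q t))"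
    proof (rule homotopic_paths_eq[OF pqe])
      show "path_image (\<lambda>t. quotient_column (e t ** p t) (e t ** q t)) \<subseteq> - {0}"
        by (rule path_image_quotient_column[OF path_pointwise_mult(2)[OF e(1,2) p(1,2)]
            path_pointwise_mult(2)[OF e(1,2) q(1,2)]])
      show "quotient_column (e t ** p t) (e t ** q t) = quotient_column (p t) (q t)"
        if "t \<in> {0..1}" for t
        by (rule quotient_column_translate) (use that e(2) in \<open>auto simp: path_image_def\<close>)
    qed
    show "pathstart (\<lambda>t. quotient_column (e t ** p t) (e t ** q t)) = 1"
      using e(3) p(3) q(3) quotient_column_one by (simp add: pathstart_def)
  qed
  also have "\<dots> = cover_log C D"
    unfolding p(4) q(4)
    by (rule cover_log_eq[symmetric]) (use p q quotient_column_one in \<open>auto simp: pathstart_def\<close>)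
  finally show ?thesis .
qed

lemma exp_cover_log:
  assumes "C \<in> ucover SL2 (mat 1)" "D \<in> ucover SL2 (mat 1)"
  shows "exp (cover_log C D) = quotient_column (endpoint C) (endpoint D)"
proof -
  obtain p where p: "path p" "path_image p \<subseteq> SL2" "pathstart p = mat 1" "C = path_class SL2 p"
    "endpoint C = pathfinish p" using assms(1) by (rule ucoverE)
  obtain q where q: "path q" "path_image q \<subseteq> SL2" "pathstart q = mat 1" "D = path_class SL2 q"
    "endpoint D = pathfinish q" using assms(2) by (rule ucoverE)
  have "exp (path_log (\<lambda>t. quotient_column (p t) (q t))) = pathfinish (\<lambda>t. quotient_column (p t) (q t))"
  proof (rule exp_path_log[OF path_quotient_column[OF p(1) q(1)]])
    show "path_image (\<lambda>t. quotient_column (p t) (q t)) \<subseteq> - {0}"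
      by (rule path_image_quotient_column[OF p(2) q(2)])
  qed (use p q quotient_column_one in \<open>simp add: pathstart_def\<close>)
  moreover have "cover_log C D = path_log (\<lambda>t. quotient_column (p t) (q t))"
    unfolding p(4) q(4)
    by (rule cover_log_eq) (use p q quotient_column_one in \<open>auto simp: pathstart_def\<close>)
  ultimately show ?thesis using p(5) q(5) by (simp add: pathfinish_def)
qed

text \<open>Nearby classes are represented by continuing the given paths inside small sets, where
  the quotient column divided by its old end value has positive real part; then
  \<open>path_log_join\<close> applies. The positivity is recorded because it keeps
  \<open>Ln\<close> away from its cut.\<close>

lemma cover_log_local:
  assumes "C \<in> ucover SL2 (mat 1)" "D \<in> ucover SL2 (mat 1)"
  obtains V W where "openin (ucover_topology SL2 (mat 1)) V" "C \<in> V"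
    "openin (ucover_topology SL2 (mat 1)) W" "D \<in> W"
    "\<And>C' D'. C' \<in> V \<Longrightarrow> D' \<in> W \<Longrightarrow>
       0 < Re (quotient_column (endpoint C') (endpoint D') / quotient_column (endpoint C) (endpoint D)) \<and>
       cover_log C' D' = cover_log C D +
         Ln (quotient_column (endpoint C') (endpoint D') / quotient_column (endpoint C) (endpoint D))"
proof -
  obtain p where p: "path p" "path_image p \<subseteq> SL2" "pathstart p = mat 1" "C = path_class SL2 p"
    "endpoint C = pathfinish p" using assms(1) by (rule ucoverE)
  obtain q where q: "path q" "path_image q \<subseteq> SL2" "pathstart q = mat 1" "D = path_class SL2 q"
    "endpoint D = pathfinish q" using assms(2) by (rule ucoverE)
  let ?P = "pathfinish p" and ?Q = "pathfinish q"
  let ?e = "quotient_column ?P ?Q"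
  have PQ: "?P \<in> SL2" "?Q \<in> SL2" using p(2) q(2) pathfinish_in_path_image by blast+
  have e: "?e \<noteq> 0" by (rule quotient_column_nonzero[OF PQ])
  have "open {x. 0 < Re (quotient_column (fst x) (snd x) / ?e)}"
    by (intro open_Collect_less continuous_on_const continuous_on_Re continuous_on_divide
        continuous_quotient_column ballI e)
  moreover have "(?P, ?Q) \<in> {x. 0 < Re (quotient_column (fst x) (snd x) / ?e)}" using e by simp
  ultimately obtain S T where ST: "open S" "open T" "?P \<in> S" "?Q \<in> T"
    "S \<times> T \<subseteq> {x. 0 < Re (quotient_column (fst x) (snd x) / ?e)}"
    by (rule open_prod_elim) auto
  let ?S = "SL2 \<inter> S" and ?T = "SL2 \<inter> T"
  show thesis
  proof (rule that[of "continuations SL2 p ?S" "continuations SL2 q ?T"])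
    show "openin (ucover_topology SL2 (mat 1)) (continuations SL2 p ?S)"
      by (rule openin_continuations) (use p ST PQ in \<open>auto intro: openin_open_Int\<close>)
    show "openin (ucover_topology SL2 (mat 1)) (continuations SL2 q ?T)"
      by (rule openin_continuations) (use q ST PQ in \<open>auto intro: openin_open_Int\<close>)
    show "C \<in> continuations SL2 p ?S"
      unfolding p(4) by (rule continuations_self) (use p ST PQ in auto)
    show "D \<in> continuations SL2 q ?T"
      unfolding q(4) by (rule continuations_self) (use q ST PQ in auto)
  next
    fix C' D' assume C': "C' \<in> continuations SL2 p ?S" and D': "D' \<in> continuations SL2 q ?T"
    obtain p' where p': "path p'" "path_image p' \<subseteq> ?S" "pathstart p' = pathfinish p"
      "C' = path_class SL2 (p +++ p')" using C' by (rule continuationsE)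
    obtain q' where q': "path q'" "path_image q' \<subseteq> ?T" "pathstart q' = pathfinish q"
      "D' = path_class SL2 (q +++ q')" using D' by (rule continuationsE)
    have pp: "path (p +++ p')" "path_image (p +++ p') \<subseteq> SL2"
      and qq: "path (q +++ q')" "path_image (q +++ q') \<subseteq> SL2"
      using p p' q q' by (auto simp: path_image_join)
    have ends: "endpoint C' = pathfinish p'" "endpoint D' = pathfinish q'"
      using p'(4) q'(4) endpoint_path_class[OF pp] endpoint_path_class[OF qq] by simp_all
    let ?z = "\<lambda>t. quotient_column (p t) (q t)" and ?y = "\<lambda>t. quotient_column (p' t) (q' t)"
    have pos: "0 < Re (?y t / ?e)" if "t \<in> {0..1}" for t
    proof -
      have "(p' t, q' t) \<in> S \<times> T" using that p'(2) q'(2) by (auto simp: path_image_def)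
      with ST(5) show ?thesis by auto
    qed
    have "cover_log C' D' = path_log (\<lambda>t. quotient_column ((p +++ p') t) ((q +++ q') t))"
      unfolding p'(4) q'(4) by (rule cover_log_eq[OF pp qq])
        (use p(3) q(3) quotient_column_one in \<open>simp add: joinpaths_def pathstart_def\<close>)
    also have "(\<lambda>t. quotient_column ((p +++ p') t) ((q +++ q') t)) = ?z +++ ?y"
      by (auto simp: joinpaths_def fun_eq_iff)
    also have "path_log (?z +++ ?y) = path_log ?z + Ln (pathfinish ?y / pathfinish ?z)"
    proof (rule path_log_join[OF path_quotient_column[OF p(1) q(1)] _ _ path_quotient_column[OF p'(1) q'(1)]])
      show "path_image ?z \<subseteq> - {0}"
        by (rule path_image_quotient_column[OF p(2) q(2)])
      show "pathstart ?z = 1" using p(3) q(3) quotient_column_one by (simp add: pathstart_def)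
      show "pathstart ?y = pathfinish ?z" using p'(3) q'(3) by (simp add: pathstart_def pathfinish_def)
      show "0 < Re (?y t / pathfinish ?z)" if "t \<in> {0..1}" for t
        using pos[OF that] by (simp add: pathfinish_def)
    qed
    also have "path_log ?z = cover_log C D"
      unfolding p(4) q(4)
      by (rule cover_log_eq[symmetric]) (use p q quotient_column_one in \<open>auto simp: pathstart_def\<close>)
    finally have "cover_log C' D' = cover_log C D + Ln (pathfinish ?y / pathfinish ?z)" .
    then show "0 < Re (quotient_column (endpoint C') (endpoint D') / quotient_column (endpoint C) (endpoint D)) \<and>
       cover_log C' D' = cover_log C D +
         Ln (quotient_column (endpoint C') (endpoint D') / quotient_column (endpoint C) (endpoint D))"
      using pos[of 1] ends p(5) q(5) by (simp add: pathfinish_def)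
  qed
qed

section \<open>Interpolation between two configurations\<close>

context bordered_surface
begin

lemma configurationD:
  assumes conf: "configuration N x0 A L g f b c"
  shows "\<And>C. C \<in> ucover N x0 \<Longrightarrow> g C \<in> ucover SL2 (mat 1)"
    "\<And>C. C \<in> ucover N x0 \<Longrightarrow> f C \<in> sl2"
    "\<And>l C. l \<in> loop_classes N x0 \<Longrightarrow> C \<in> ucover N x0 \<Longrightarrow>
       g (class_join N l C) = g l \<otimes>\<^bsub>SL2_cover\<^esub> g C"
    "\<And>l C. l \<in> loop_classes N x0 \<Longrightarrow> C \<in> ucover N x0 \<Longrightarrow>
       f (class_join N l C) = f l + endpoint (g l) ** f C ** matrix_inv (endpoint (g l))"
    "continuous_map (ucover_topology N x0) (ucover_topology SL2 (mat 1)) g"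
    "section_smooth (\<lambda>C. endpoint (g C))" "section_smooth f"
    "\<And>l. l \<in> L \<Longrightarrow> b l \<in> SL2 \<and> c l \<in> sl2"
proof -
  obtain F\<^sub>0 where F\<^sub>0: "quasiperiodic_with N x0 ISO12_cover (\<lambda>C. (g C, f C)) F\<^sub>0"
    "\<forall>l\<in>loop_classes N x0. F\<^sub>0 l = (g l, f l)"
    using conf unfolding configuration_def normalized_quasiperiodic_def by blast
  have in_carrier: "(g C, f C) \<in> carrier ISO12_cover" if "C \<in> ucover N x0" for C
    using F\<^sub>0(1) that unfolding quasiperiodic_with_def by auto
  then show "g C \<in> ucover SL2 (mat 1)" "f C \<in> sl2" if "C \<in> ucover N x0" for C
    using that by (auto simp: ISO12_cover_def SL2_cover_def)
  have "(g (class_join N l C), f (class_join N l C)) = (g l, f l) \<otimes>\<^bsub>ISO12_cover\<^esub> (g C, f C)"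
    if "l \<in> loop_classes N x0" "C \<in> ucover N x0" for l C
    using F\<^sub>0 that unfolding quasiperiodic_with_def by auto
  then show "g (class_join N l C) = g l \<otimes>\<^bsub>SL2_cover\<^esub> g C"
    "f (class_join N l C) = f l + endpoint (g l) ** f C ** matrix_inv (endpoint (g l))"
    if "l \<in> loop_classes N x0" "C \<in> ucover N x0" for l C
    using that by (auto simp: ISO12_cover_def)
  show "continuous_map (ucover_topology N x0) (ucover_topology SL2 (mat 1)) g"
    "section_smooth (\<lambda>C. endpoint (g C))" "section_smooth f"
    using conf section_smooth_if_smooth_fun
    by (auto simp: configuration_def smooth_ISO12_def comp_def)
  show "b l \<in> SL2 \<and> c l \<in> sl2" if "l \<in> L" for l
    using conf that by (simp add: configuration_def)
qed

lemma fields_of_eq: "fields_of N x0 \<alpha> g f b c = potential_fields (\<lambda>C. endpoint (g C)) f b c"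
  by (simp add: fields_of_def potential_fields_def comp_def)

lemma endpoint_SL2: "C \<in> ucover SL2 (mat 1) \<Longrightarrow> endpoint C \<in> SL2"
  using pathfinish_in_path_image by (auto elim!: ucoverE)

text \<open>The projection to \<open>SL2\<close> is multiplicative
  (\<open>endpoint_SL2_cover_mult\<close>), so the law in the covering group becomes left
  multiplication of matrices; normalization makes the value at a loop its factor.\<close>

lemma potential_configuration:
  assumes conf: "configuration N x0 A L g f b c"
  shows "potential (\<lambda>l. endpoint (g l)) f (\<lambda>C. endpoint (g C)) f"
proof -
  note D = configurationD[OF conf]
  have loop: "l \<in> ucover N x0" if "l \<in> loop_classes N x0" for l
    using that by (simp add: loop_classes_def)
  show ?thesis
    unfolding potential_def
    using D(1-4,6,7) loop endpoint_SL2
    by (auto simp: endpoint_SL2_cover_mult matrix_inv_SL2)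
qed

lemma continuous_map_section_preimage:
  assumes s: "local_section k U s" and g: "continuous_map (ucover_topology N x0) Y g"
    and W: "openin Y W" and y: "y \<in> U" "g (s y) \<in> W"
  obtains T where "open T" "y \<in> T" "\<And>z. z \<in> U \<inter> T \<Longrightarrow> g (s z) \<in> W"
proof -
  have "continuous_map (top_of_set U) Y (g \<circ> s)"
    using continuous_map_compose[OF local_sectionD(7)[OF s] g] .
  then have "openin (top_of_set U) {z \<in> U. g (s z) \<in> W}"
    using W by (simp add: continuous_map_def)
  then obtain T where "open T" "{z \<in> U. g (s z) \<in> W} = U \<inter> T" by (auto simp: openin_open)
  with y that[of T] show thesis by blast
qed

text \<open>Locally the logarithm is a constant plus \<open>Ln\<close> of an expression in the
  projections. Continuity of the lifted maps provides the neighbourhood, smoothness of the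
  projections the rest.\<close>

lemma section_smooth_cover_log:
  assumes g: "configuration N x0 A L g f b c" and g': "configuration N x0 A L g' f' b' c'"
  shows "section_smooth (\<lambda>C. cover_log (g C) (g' C))"
  unfolding section_smooth_def
proof (intro allI impI)
  fix k U s assume s: "local_section k U s"
  note D = configurationD[OF g] and D' = configurationD[OF g']
  show "smooth_on U (\<lambda>y. cover_log (g (s y)) (g' (s y)))"
  proof (rule smooth_on_locally)
    fix y assume y: "y \<in> U"
    note sy = local_sectionD(4)[OF s y]
    let ?q = "\<lambda>z. quotient_column (endpoint (g (s z))) (endpoint (g' (s z)))"
    obtain V W where VW: "openin (ucover_topology SL2 (mat 1)) V" "g (s y) \<in> V"
      "openin (ucover_topology SL2 (mat 1)) W" "g' (s y) \<in> W"
      "\<And>C' D'. C' \<in> V \<Longrightarrow> D' \<in> W \<Longrightarrow>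
         0 < Re (quotient_column (endpoint C') (endpoint D') / ?q y) \<and>
         cover_log C' D' = cover_log (g (s y)) (g' (s y)) +
           Ln (quotient_column (endpoint C') (endpoint D') / ?q y)"
      using cover_log_local[OF D(1)[OF sy] D'(1)[OF sy]] by blast
    obtain T where T: "open T" "y \<in> T" "\<And>z. z \<in> U \<inter> T \<Longrightarrow> g (s z) \<in> V"
      using continuous_map_section_preimage[OF s D(5) VW(1) y VW(2)] by metis
    obtain T' where T': "open T'" "y \<in> T'" "\<And>z. z \<in> U \<inter> T' \<Longrightarrow> g' (s z) \<in> W"
      using continuous_map_section_preimage[OF s D'(5) VW(3) y VW(4)] by metis
    let ?U = "U \<inter> (T \<inter> T')"
    have loc: "0 < Re (?q z / ?q y)" "cover_log (g (s z)) (g' (s z))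
        = cover_log (g (s y)) (g' (s y)) + Ln (?q z / ?q y)" if "z \<in> ?U" for z
      using VW(5)[OF T(3) T'(3), of z z] that by auto
    have G: "smooth_on ?U (\<lambda>z. endpoint (g (s z)))" "smooth_on ?U (\<lambda>z. endpoint (g' (s z)))"
      using smooth_on_section[OF s D(6)] smooth_on_section[OF s D'(6)] by (auto intro: smooth_on_subset)
    have q: "smooth_on ?U (\<lambda>z. ?q z / ?q y)"
      unfolding quotient_column_def
      by (rule smooth_on_linear_comp[OF bounded_linear_divide smooth_on_linear_comp[OF
              bounded_linear_complex_column smooth_on_matrix_mult[OF smooth_on_adj[OF G(1)] G(2)]]])
    have "?q z / ?q y \<notin> \<real>\<^sub>\<le>\<^sub>0" if "z \<in> ?U" for z
      using loc(1)[OF that] unfolding complex_nonpos_Reals_iff by linarith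
    then have "smooth_on ?U (\<lambda>z. cover_log (g (s y)) (g' (s y)) + Ln (?q z / ?q y))"
      by (intro smooth_on_add smooth_on_const smooth_on_Ln[OF q])
    then have "smooth_on ?U (\<lambda>z. cover_log (g (s z)) (g' (s z)))"
      by (rule smooth_on_cong) (use loc(2) in auto)
    then show "\<exists>W. open W \<and> y \<in> W \<and> smooth_on (U \<inter> W) (\<lambda>y. cover_log (g (s y)) (g' (s y)))"
      using T T' by (intro exI[of _ "T \<inter> T'"]) auto
  qed
qed

lemma gauge_related_configurations:
  assumes g: "configuration N x0 A L g f b c" and g': "configuration N x0 A L g' f' b' c'"
    and loops: "\<And>l. l \<in> loop_classes N x0 \<Longrightarrow> g l = g' l \<and> f l = f' l"
    and bc: "\<And>l. l \<in> L \<Longrightarrow> b l = b' l \<and> c l = c' l"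
  shows "gauge_related N A L \<sigma> (fields_of N x0 \<alpha> g f b c) (fields_of N x0 \<alpha> g' f' b' c')"
proof -
  note D = configurationD[OF g] and D' = configurationD[OF g']
  define G where "G = (\<lambda>C. endpoint (g C))"
  define G' where "G' = (\<lambda>C. endpoint (g' C))"
  define H where "H = (\<lambda>C. adj (G C) ** G' C)"
  define w where "w = (\<lambda>C. cover_log (g C) (g' C))"
  define \<tau> where "\<tau> = (\<lambda>C. Re (complex_column 2 (H C) * exp (- w C)))"
  define K where "K = (\<lambda>C. contraction (w C) (\<tau> C))"
  \<comment> \<open>Multiplication on the right does not interfere with the left action of the
    loops; \<open>K C 0\<close> is the unit matrix and \<open>K C 1\<close> is
    \<open>H C\<close>.\<close>
  define GG where "GG = (\<lambda>r C. G C ** K C r)"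
  \<comment> \<open>Both translational parts obey the same affine law under loops, and the
    coefficients add up to 1, so the combination obeys it too.\<close>
  define FF where "FF = (\<lambda>r C. (1 - r) *\<^sub>R f C + r *\<^sub>R f' C)"
  let ?M = "\<lambda>l. endpoint (g l)"
  have P: "potential ?M f G f"
    unfolding G_def by (rule potential_configuration[OF g])
  have P0': "potential (\<lambda>l. endpoint (g' l)) f' G' f'"
    unfolding G'_def by (rule potential_configuration[OF g'])
  \<comment> \<open>Agreement on loops gives the second pair of potentials the quasiperiodicity
    factors of the first.\<close>
  have P': "potential ?M f G' f'"
    using P0' loops unfolding potential_def by simp
  note PD = potentialD[OF P] and PD' = potentialD[OF P']
  have H: "H C \<in> SL2" if "C \<in> ucover N x0" for C
    unfolding H_def using PD(3) PD'(3) that by (intro SL2_mult SL2_adj) auto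
  have w: "exp (w C) = complex_column 1 (H C)" if "C \<in> ucover N x0" for C
    unfolding w_def H_def G_def G'_def using exp_cover_log[OF D(1) D'(1)] that
    by (simp add: quotient_column_def)
  have K1: "G C ** K C 1 = G' C" if "C \<in> ucover N x0" for C
  proof -
    have "K C 1 = H C" unfolding K_def \<tau>_def by (rule contraction_1[OF H w]) (use that in auto)
    then show ?thesis using self_mult_adj[OF PD(3)[OF that]] by (simp add: H_def matrix_mul_assoc)
  qed
  \<comment> \<open>\<open>K C\<close> depends only on \<open>w C\<close> and \<open>H C\<close>,
    and a loop multiplies \<open>g\<close> and \<open>g'\<close> on the left by the same factor,
    which cancels in both.\<close>
  have inv: "K (class_join N l C) = K C" if l: "l \<in> loop_classes N x0" and C: "C \<in> ucover N x0" for l C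
  proof -
    have lN: "l \<in> ucover N x0" using l by (simp add: loop_classes_def)
    have "w (class_join N l C) = w C"
      unfolding w_def D(3)[OF l C] D'(3)[OF l C] using loops[OF l] cover_log_translate[OF D(1)[OF lN] D(1)[OF C] D'(1)[OF C]]
      by simp
    moreover have "H (class_join N l C) = adj (G C) ** (adj (?M l) ** ?M l) ** G' C"
      unfolding H_def by (simp add: PD(7)[OF l C] PD'(7)[OF l C] adj_mult matrix_mul_assoc)
    then have "H (class_join N l C) = H C" by (simp add: adj_mult_self[OF PD(5)[OF l]] H_def)
    ultimately show ?thesis unfolding K_def \<tau>_def by simp
  qed
  have sm: "smooth_on ({0..1} \<times> U) (\<lambda>p. GG (fst p) (s (snd p)))"
    "smooth_on ({0..1} \<times> U) (\<lambda>p. FF (fst p) (s (snd p)))"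
    if s: "local_section k U s" for k U s
  proof -
    have par: "smooth_on ({0..1} \<times> U) (\<lambda>p. E (s (snd p)))" if "smooth_on U (\<lambda>y. E (s y))"
      for E :: "'a path_class \<Rightarrow> 'e::euclidean_space"
      by (rule smooth_on_compose[OF smooth_on_snd that]) auto
    note smG = smooth_on_section[OF s PD(1)] and smG' = smooth_on_section[OF s PD'(1)]
    have smw: "smooth_on U (\<lambda>y. w (s y))"
      unfolding w_def by (rule smooth_on_section[OF s section_smooth_cover_log[OF g g']])
    have sm\<tau>: "smooth_on U (\<lambda>y. \<tau> (s y))"
      unfolding \<tau>_def H_def
      by (intro smooth_on_linear_comp[OF bounded_linear_Re] smooth_on_bilinear[OF bounded_bilinear_mult]
          smooth_on_linear_comp[OF bounded_linear_complex_column] smooth_on_matrix_mult smooth_on_adj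
          smooth_on_exp smooth_on_linear_comp[OF bounded_linear_minus[OF bounded_linear_ident]] smG smG' smw)
    show "smooth_on ({0..1} \<times> U) (\<lambda>p. GG (fst p) (s (snd p)))"
      unfolding GG_def K_def
      by (intro smooth_on_matrix_mult smooth_on_contraction smooth_on_fst
          par[of G] par[of w] par[of \<tau>] smG smw sm\<tau>)
    show "smooth_on ({0..1} \<times> U) (\<lambda>p. FF (fst p) (s (snd p)))"
      unfolding FF_def
      by (intro smooth_on_add smooth_on_bilinear[OF bounded_bilinear_scaleR] smooth_on_diff
          smooth_on_const smooth_on_fst par[of f] par[of f'] smooth_on_section[OF s PD(2)]
          smooth_on_section[OF s PD'(2)])
  qed
  have fam: "potential_family ?M f GG FF"
    unfolding potential_family_def
  proof (intro conjI allI impI ballI)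
    fix r :: real assume r: "r \<in> {0..1}"
    have slice: "smooth_on U (\<lambda>y. E r (s y))" if "smooth_on ({0..1} \<times> U) (\<lambda>p. E (fst p) (s (snd p)))"
      for E :: "real \<Rightarrow> 'a path_class \<Rightarrow> mat2" and U s
    proof -
      have "smooth_on U (\<lambda>y. E (fst (r, y)) (s (snd (r, y))))"
        by (rule smooth_on_compose[OF smooth_on_Pair[OF smooth_on_const smooth_on_ident] that]) (use r in auto)
      then show ?thesis by simp
    qed
    show "potential ?M f (GG r) (FF r)"
      unfolding potential_def
    proof (intro conjI ballI)
      show "section_smooth (GG r)" "section_smooth (FF r)"
        unfolding section_smooth_def using slice sm by blast+
    next
      fix C assume C: "C \<in> ucover N x0"
      show "GG r C \<in> SL2" unfolding GG_def K_def by (intro SL2_mult contraction_SL2 PD(3) C)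
      show "FF r C \<in> sl2" unfolding FF_def by (intro sl2_add sl2_scaleR PD(4) PD'(4) C)
    next
      fix l assume l: "l \<in> loop_classes N x0"
      show "?M l \<in> SL2" "f l \<in> sl2" using PD(5,6)[OF l] by auto
      fix C assume C: "C \<in> ucover N x0"
      show "GG r (class_join N l C) = ?M l ** GG r C"
        unfolding GG_def inv[OF l C] PD(7)[OF l C] by (simp add: matrix_mul_assoc)
      show "FF r (class_join N l C) = f l + ?M l ** FF r C ** adj (?M l)"
        unfolding FF_def PD(8)[OF l C] PD'(8)[OF l C]
        by (simp add: matrix_mult_bilinear_simps bounded_bilinear.scaleR_left[OF bounded_bilinear_matrix_mult]
            bounded_bilinear.scaleR_right[OF bounded_bilinear_matrix_mult] algebra_simps)
    qed
  qed (use sm in auto)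
  have "gauge_related N A L \<sigma> (potential_fields G f b c) (potential_fields G' f' b' c')"
    by (rule gauge_related_potential_family[OF fam D(8) P _ P' _ bc])
       (auto simp: GG_def FF_def K1, simp add: K_def contraction_0)
  then show ?thesis unfolding fields_of_eq G_def G'_def .
qed

end

theorem theorem3p2:
  fixes N :: "'a::t2_space set" and A :: "'a chart set" and x0 :: 'a
    and L :: "'l set" and \<sigma> :: "'l \<Rightarrow> real \<Rightarrow> 'a" and \<alpha> :: "'l \<Rightarrow> real \<Rightarrow> 'a path_class"
    and g g' :: "'a path_class \<Rightarrow> mat2 path_class" and f f' :: "'a path_class \<Rightarrow> mat2"
    and b b' c c' :: "'l \<Rightarrow> mat2"
  assumes "smooth_atlas (top_of_set N) A"
    and "compact N" and "connected N"
    and "orientable (top_of_set N) A" and "trivial_tangent_bundle A"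
    and "boundary_circles A L \<sigma>"
    and "x0 \<in> N"
    and "boundary_families N x0 L \<sigma> \<alpha>"
    and "configuration N x0 A L g f b c"
    and "configuration N x0 A L g' f' b' c'"
    and "\<And>l. l \<in> loop_classes N x0 \<Longrightarrow> g l = g' l"
    and "\<And>l. l \<in> loop_classes N x0 \<Longrightarrow> f l = f' l"
    and "\<And>l. l \<in> L \<Longrightarrow> b l = b' l"
    and "\<And>l. l \<in> L \<Longrightarrow> c l = c' l"
  shows "gauge_related N A L \<sigma> (fields_of N x0 \<alpha> g f b c) (fields_of N x0 \<alpha> g' f' b' c')"
proof -
  interpret bordered_surface N A x0 L \<sigma> \<alpha>
    by unfold_locales (use assms in auto)
  show ?thesis
    by (rule gauge_related_configurations) (use assms in auto)
qed

end
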